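(* Let $G$ be a compact Hausdorff group with dual object $\widehat{G}$ and let $E$ be an operator space. Then the map $$\Lambda:\ \mathcal{L}_E^{\infty}(\widehat{G})\longrightarrow cb(\mathcal{L}^1(\widehat{G}),E),\qquad \Lambda(A)=\Big(B\mapsto \sum_{\pi\in\widehat{G}} d_\pi\,\mathrm{tr}(A^\pi B^\pi)\Big)$$ is a completely isometric isomorphism.
   Context: Operator spaces: an operator space is a closed subspace $E\subset \mathcal{B}(\mathcal{H})$, with norms on $M_n(E)=M_n\otimes E$ inherited from $\mathcal{B}(\ell^2_{\mathcal{H}}(n))$. $cb(E_1,E_2)$ is the space of completely bounded maps, with operator space structure $M_n(cb(E_1,E_2))=cb(E_1,M_n(E_2))$; in particular $E^\star=cb(E,\mathbb{C})$. $\otimes_{\min}$ and $\otimes^{\wedge}$ are the minimal and operator space projective tensor products. Schatten classes: $S_n^\infty=\mathcal{B}(\ell^2(n))$, $S_n^1=(S_n^\infty)^\star$ through the trace pairing $(A,B)\mapsto \mathrm{tr}(AB)$; $S_n^\infty(E)=S_n^\infty\otimes_{\min}E=M_n(E)$ and $S_n^1(E)=S_n^1\otimes^{\wedge}E$. Dual object: $\widehat{G}$ is the set of (classes of) irreducible unitary representations $\pi$ of $G$, $d_\pi$ is the degree of $\pi$, and an orthonormal basis of $\mathbb{C}^{d_\pi}$ is fixed for each $\pi$. $\mathcal{M}_E(\widehat{G})=\prod_{\pi\in\widehat{G}}M_{d_\pi}\otimes E$. Define $\mathcal{L}_E^\infty(\widehat{G})=\{A\in\mathcal{M}_E(\widehat{G}):\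 \|A\|=\sup_\pi\|A^\pi\|_{S_{d_\pi}^\infty(E)}<\infty\}$ and $\mathcal{L}_E^1(\widehat{G})=\{A\in\mathcal{M}_E(\widehat{G}):\ \|A\|=\sum_\pi d_\pi\|A^\pi\|_{S_{d_\pi}^1(E)}<\infty\}$; $\mathcal{L}^p(\widehat{G})$ is the case $E=\mathbb{C}$. Operator space structures: $M_n(\mathcal{L}_E^\infty(\widehat{G}))=\mathcal{L}^\infty_{M_n(E)}(\widehat{G})$, and $\mathcal{L}_E^1(\widehat{G})$ carries the structure induced by the isometric embedding into $\mathcal{L}_{E^\star}^\infty(\widehat{G})^\star$ given by $B\mapsto\big(A\mapsto\sum_\pi d_\pi\,\mathrm{tr}(A^\pi B^\pi)\big)$. For matrices $A=(a_{kl})$ and $B=(b_{kl})$, $\mathrm{tr}(AB)=\sum_{k,l}a_{kl}b_{lk}$, with the product of entries being scalar multiplication or the duality bracket. *)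

theory Defs
  imports
    "HOL-Analysis.Analysis"
    "HOL-Library.Function_Algebras"
    "HOL-Algebra.Group"
    "Jordan_Normal_Form.Schur_Decomposition"
begin

section \<open>Complex vector spaces and complex Hilbert spaces\<close>

class complex_vector = ab_group_add +
  fixes scaleC :: "complex \<Rightarrow> 'a \<Rightarrow> 'a" (infixr "*\<^sub>C" 75)
  assumes scaleC_add_right: "c *\<^sub>C (x + y) = c *\<^sub>C x + c *\<^sub>C y"
    and scaleC_add_left: "(c + d) *\<^sub>C x = c *\<^sub>C x + d *\<^sub>C x"
    and scaleC_scaleC: "c *\<^sub>C d *\<^sub>C x = (c * d) *\<^sub>C x"
    and scaleC_one: "1 *\<^sub>C x = x"

text \<open>The norm and the topology of a complex Hilbert space are those of the underlying
  real inner product space, whose inner product is the real part of the complex one.\<close>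

class complex_hilbert = complex_vector + real_inner + complete_space +
  fixes cinner :: "'a \<Rightarrow> 'a \<Rightarrow> complex"
  assumes scaleC_of_real: "complex_of_real r *\<^sub>C x = r *\<^sub>R x"
    and cinner_add_left: "cinner (x + y) z = cinner x z + cinner y z"
    and cinner_scaleC_left: "cinner (c *\<^sub>C x) y = c * cinner x y"
    and cinner_commute: "cinner y x = cnj (cinner x y)"
    and Re_cinner: "Re (cinner x y) = inner x y"

lemma norm_scaleC: "norm (c *\<^sub>C x) = cmod c * norm (x :: 'a :: complex_hilbert)"
proof -
  have r: "cinner x (c *\<^sub>C y) = cnj c * cinner x y" for x y :: 'a
    by (metis cinner_commute cinner_scaleC_left complex_cnj_mult)
  have "inner (c *\<^sub>C x) (c *\<^sub>C x) = Re ((c * cnj c) * cinner x x)"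
    by (simp only: Re_cinner[symmetric] cinner_scaleC_left r mult.assoc mult.left_commute)
  also have "\<dots> = (cmod c)\<^sup>2 * inner x x"
    by (simp only: complex_norm_square[symmetric] Re_cinner[symmetric]) simp
  finally show ?thesis
    by (simp add: norm_eq_sqrt_inner real_sqrt_mult)
qed

instantiation complex :: complex_hilbert
begin
definition "scaleC_complex (c :: complex) x = c * x"
definition "cinner_complex (x :: complex) y = x * cnj y"
instance
  by standard
    (auto simp: scaleC_complex_def cinner_complex_def algebra_simps inner_complex_def
      scaleR_conv_of_real)
end

instantiation "fun" :: (type, complex_vector) complex_vector
begin
definition "scaleC_fun c (f :: 'a \<Rightarrow> 'b) = (\<lambda>x. c *\<^sub>C f x)"
instance
  by standard
    (auto simp: scaleC_fun_def plus_fun_def fun_eq_iff scaleC_add_right scaleC_add_left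
      scaleC_scaleC scaleC_one)
end

lemma bounded_linear_scaleC_comp:
  fixes f :: "'a :: real_normed_vector \<Rightarrow> 'b :: complex_hilbert"
  assumes "bounded_linear f"
  shows "bounded_linear (\<lambda>x. c *\<^sub>C f x)"
proof -
  have "bounded_linear (\<lambda>y :: 'b. c *\<^sub>C y)"
  proof (rule bounded_linear_intro[where K = "cmod c"])
    show "c *\<^sub>C (r *\<^sub>R x) = r *\<^sub>R (c *\<^sub>C x)" for r and x :: 'b
      by (simp only: scaleC_of_real[symmetric] scaleC_scaleC mult.commute)
  qed (simp_all add: scaleC_add_right norm_scaleC mult.commute)
  from bounded_linear_compose[OF this assms] show ?thesis .
qed

instantiation blinfun :: (real_normed_vector, complex_hilbert) complex_vector
begin
lift_definition scaleC_blinfun :: "complex \<Rightarrow> ('a \<Rightarrow>\<^sub>L 'b) \<Rightarrow> ('a \<Rightarrow>\<^sub>L 'b)"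
  is "\<lambda>c f x. c *\<^sub>C f x"
  by (rule bounded_linear_scaleC_comp)
instance
  by standard
    (transfer, simp add: fun_eq_iff scaleC_add_right scaleC_add_left scaleC_scaleC scaleC_one)+
end


section \<open>Operator spaces and completely bounded maps\<close>

text \<open>A vector space together with a family of norms, the n-th one on the n by n matrices
  over the space.  An n by n matrix is a function of two indices, relevant below n only.
  The norm of the space itself is the norm on 1 by 1 matrices.\<close>

record 'v matnormed =
  vecs :: "'v set"
  mnorm :: "nat \<Rightarrow> (nat \<Rightarrow> nat \<Rightarrow> 'v) \<Rightarrow> real"

text \<open>Operator norm of a matrix of operators, acting on the Hilbert sum of n copies of a space.\<close>

definition op_matrix_norm ::
    "('a \<Rightarrow> 'h :: real_normed_vector \<Rightarrow> 'h) \<Rightarrow> nat \<Rightarrow> (nat \<Rightarrow> nat \<Rightarrow> 'a) \<Rightarrow> real" where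
  "op_matrix_norm act n X =
     Sup {L2_set (\<lambda>i. norm (\<Sum>j<n. act (X i j) (\<xi> j))) {..<n} | \<xi>.
            L2_set (\<lambda>j. norm (\<xi> j)) {..<n} \<le> 1}"

text \<open>Operators are given as bounded real-linear maps, hence the explicit requirement of
  complex linearity; the closure is taken in the operator norm.\<close>

definition operator_space :: "('h :: complex_hilbert \<Rightarrow>\<^sub>L 'h) set \<Rightarrow> bool" where
  "operator_space E \<longleftrightarrow>
     (\<forall>S\<in>E. \<forall>c x. blinfun_apply S (c *\<^sub>C x) = c *\<^sub>C blinfun_apply S x) \<and>
     0 \<in> E \<and> (\<forall>S\<in>E. \<forall>S'\<in>E. S + S' \<in> E) \<and> (\<forall>c. \<forall>S\<in>E. c *\<^sub>C S \<in> E) \<and> closed E"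

definition opspace :: "('h :: complex_hilbert \<Rightarrow>\<^sub>L 'h) set \<Rightarrow> ('h \<Rightarrow>\<^sub>L 'h) matnormed" where
  "opspace E = \<lparr>vecs = E, mnorm = op_matrix_norm blinfun_apply\<rparr>"

definition scalar_space :: "complex matnormed" where
  "scalar_space = \<lparr>vecs = UNIV, mnorm = op_matrix_norm (*)\<rparr>"

definition mtrunc :: "nat \<Rightarrow> (nat \<Rightarrow> nat \<Rightarrow> 'v :: zero) \<Rightarrow> nat \<Rightarrow> nat \<Rightarrow> 'v" where
  "mtrunc n X = (\<lambda>i j. if i < n \<and> j < n then X i j else 0)"

definition matrices :: "nat \<Rightarrow> 'v :: zero matnormed \<Rightarrow> (nat \<Rightarrow> nat \<Rightarrow> 'v) set" where
  "matrices n V = {X. (\<forall>i<n. \<forall>j<n. X i j \<in> vecs V) \<and> mtrunc n X = X}"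

text \<open>A k by k matrix of n by n matrices is regarded as a matrix of size k n.\<close>

definition Mat :: "nat \<Rightarrow> 'v :: zero matnormed \<Rightarrow> (nat \<Rightarrow> nat \<Rightarrow> 'v) matnormed" where
  "Mat n V = \<lparr>vecs = matrices n V,
     mnorm = (\<lambda>k X. mnorm V (k * n) (\<lambda>r s. X (r div n) (s div n) (r mod n) (s mod n)))\<rparr>"

definition amplify :: "nat \<Rightarrow> ('v \<Rightarrow> 'w :: zero) \<Rightarrow> (nat \<Rightarrow> nat \<Rightarrow> 'v) \<Rightarrow> nat \<Rightarrow> nat \<Rightarrow> 'w" where
  "amplify n f X = mtrunc n (\<lambda>i j. f (X i j))"

definition complex_linear_between ::
    "'v :: complex_vector matnormed \<Rightarrow> 'w :: complex_vector matnormed \<Rightarrow> ('v \<Rightarrow> 'w) \<Rightarrow> bool" where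
  "complex_linear_between V W f \<longleftrightarrow>
     f \<in> vecs V \<rightarrow> vecs W \<and>
     (\<forall>x\<in>vecs V. \<forall>y\<in>vecs V. f (x + y) = f x + f y) \<and>
     (\<forall>c. \<forall>x\<in>vecs V. f (c *\<^sub>C x) = c *\<^sub>C f x)"

definition completely_bounded ::
    "'v :: complex_vector matnormed \<Rightarrow> 'w :: complex_vector matnormed \<Rightarrow> ('v \<Rightarrow> 'w) \<Rightarrow> bool" where
  "completely_bounded V W f \<longleftrightarrow>
     (\<exists>C. \<forall>n\<ge>1. \<forall>X\<in>matrices n V. mnorm W n (amplify n f X) \<le> C * mnorm V n X)"

definition cb_norm ::
    "'v :: complex_vector matnormed \<Rightarrow> 'w :: complex_vector matnormed \<Rightarrow> ('v \<Rightarrow> 'w) \<Rightarrow> real" where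
  "cb_norm V W f =
     Sup {mnorm W n (amplify n f X) | n X. 1 \<le> n \<and> X \<in> matrices n V \<and> mnorm V n X \<le> 1}"

text \<open>Maps are extended by zero outside their domain, so that equality of maps is equality
  of functions and the pointwise operations are the vector space operations.\<close>

definition extend_zero :: "'v set \<Rightarrow> ('v \<Rightarrow> 'w :: zero) \<Rightarrow> 'v \<Rightarrow> 'w" where
  "extend_zero S f = (\<lambda>x. if x \<in> S then f x else 0)"

definition cb ::
    "'v :: complex_vector matnormed \<Rightarrow> 'w :: complex_vector matnormed \<Rightarrow> ('v \<Rightarrow> 'w) matnormed" where
  "cb V W = \<lparr>vecs = {f. complex_linear_between V W f \<and> extend_zero (vecs V) f = f \<and>
                         completely_bounded V W f},
     mnorm = (\<lambda>n F. cb_norm V (Mat n W) (\<lambda>x. mtrunc n (\<lambda>i j. F i j x)))\<rparr>"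

definition op_dual :: "'v :: complex_vector matnormed \<Rightarrow> ('v \<Rightarrow> complex) matnormed" where
  "op_dual V = cb V scalar_space"

definition complete_isometric_isomorphism ::
    "'v :: complex_vector matnormed \<Rightarrow> 'w :: complex_vector matnormed \<Rightarrow> ('v \<Rightarrow> 'w) \<Rightarrow> bool" where
  "complete_isometric_isomorphism V W f \<longleftrightarrow>
     complex_linear_between V W f \<and> bij_betw f (vecs V) (vecs W) \<and>
     (\<forall>n\<ge>1. \<forall>X\<in>matrices n V. mnorm W n (amplify n f X) = mnorm V n X)"


section \<open>Compact groups and their dual object\<close>

definition compact_hausdorff_group :: "('g, 'm) monoid_scheme \<Rightarrow> 'g topology \<Rightarrow> bool" where
  "compact_hausdorff_group G T \<longleftrightarrow>
     group G \<and> topspace T = carrier G \<and>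
     continuous_map (prod_topology T T) T (\<lambda>(x, y). x \<otimes>\<^bsub>G\<^esub> y) \<and>
     continuous_map T T (\<lambda>x. inv\<^bsub>G\<^esub> x) \<and>
     compact_space T \<and> Hausdorff_space T"

definition unitary_matrix :: "nat \<Rightarrow> complex mat \<Rightarrow> bool" where
  "unitary_matrix d U \<longleftrightarrow> U \<in> carrier_mat d d \<and> mat_adjoint U * U = 1\<^sub>m d"

definition unitary_rep ::
    "('g, 'm) monoid_scheme \<Rightarrow> 'g topology \<Rightarrow> nat \<Rightarrow> ('g \<Rightarrow> complex mat) \<Rightarrow> bool" where
  "unitary_rep G T d \<rho> \<longleftrightarrow>
     (\<forall>x\<in>carrier G. unitary_matrix d (\<rho> x)) \<and>
     (\<forall>x\<in>carrier G. \<forall>y\<in>carrier G. \<rho> (x \<otimes>\<^bsub>G\<^esub> y) = \<rho> x * \<rho> y) \<and>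
     (\<forall>i<d. \<forall>j<d. continuous_map T euclidean (\<lambda>x. \<rho> x $$ (i, j)))"

definition irreducible_rep ::
    "('g, 'm) monoid_scheme \<Rightarrow> nat \<Rightarrow> ('g \<Rightarrow> complex mat) \<Rightarrow> bool" where
  "irreducible_rep G d \<rho> \<longleftrightarrow> 0 < d \<and>
     (\<forall>W \<subseteq> carrier_vec d.
        0\<^sub>v d \<in> W \<and> (\<forall>v\<in>W. \<forall>w\<in>W. v + w \<in> W) \<and> (\<forall>c. \<forall>w\<in>W. c \<cdot>\<^sub>v w \<in> W) \<and>
        (\<forall>x\<in>carrier G. \<forall>w\<in>W. \<rho> x *\<^sub>v w \<in> W)
        \<longrightarrow> W = {0\<^sub>v d} \<or> W = carrier_vec d)"

definition irreps :: "('g, 'm) monoid_scheme \<Rightarrow> 'g topology \<Rightarrow> ('g \<Rightarrow> complex mat) set" where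
  "irreps G T = {\<rho>. \<exists>d. unitary_rep G T d \<rho> \<and> irreducible_rep G d \<rho>}"

definition rep_degree :: "('g, 'm) monoid_scheme \<Rightarrow> ('g \<Rightarrow> complex mat) \<Rightarrow> nat" where
  "rep_degree G \<rho> = dim_row (\<rho> \<one>\<^bsub>G\<^esub>)"

definition rep_equiv ::
    "('g, 'm) monoid_scheme \<Rightarrow> 'g topology \<Rightarrow> (('g \<Rightarrow> complex mat) \<times> ('g \<Rightarrow> complex mat)) set" where
  "rep_equiv G T = {(\<rho>, \<sigma>). \<rho> \<in> irreps G T \<and> \<sigma> \<in> irreps G T \<and> rep_degree G \<sigma> = rep_degree G \<rho> \<and>
     (\<exists>U. unitary_matrix (rep_degree G \<rho>) U \<and> (\<forall>x\<in>carrier G. U * \<rho> x = \<sigma> x * U))}"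

type_synonym 'g rep_class = "('g \<Rightarrow> complex mat) set"

definition dual_object :: "('g, 'm) monoid_scheme \<Rightarrow> 'g topology \<Rightarrow> 'g rep_class set" where
  "dual_object G T = irreps G T // rep_equiv G T"

text \<open>Equivalent representations have the same degree, so the choice of a representative
  is immaterial.\<close>

definition deg :: "('g, 'm) monoid_scheme \<Rightarrow> 'g rep_class \<Rightarrow> nat" where
  "deg G \<pi> = rep_degree G (SOME \<rho>. \<rho> \<in> \<pi>)"


section \<open>The spaces of the dual object\<close>

text \<open>Families of matrices indexed by the dual object are extended by zero outside it.\<close>

definition families ::
    "('g, 'm) monoid_scheme \<Rightarrow> 'g topology \<Rightarrow> 'v :: zero matnormed
      \<Rightarrow> ('g rep_class \<Rightarrow> nat \<Rightarrow> nat \<Rightarrow> 'v) set" where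
  "families G T V =
     {A. (\<forall>\<pi>\<in>dual_object G T. A \<pi> \<in> matrices (deg G \<pi>) V) \<and>
         extend_zero (dual_object G T) A = A}"

text \<open>The norm of an n by n matrix X over this space is that of the corresponding
  family with values in the n by n matrices over V.\<close>

definition Linf ::
    "('g, 'm) monoid_scheme \<Rightarrow> 'g topology \<Rightarrow> 'v :: zero matnormed
      \<Rightarrow> ('g rep_class \<Rightarrow> nat \<Rightarrow> nat \<Rightarrow> 'v) matnormed" where
  "Linf G T V = \<lparr>vecs = {A \<in> families G T V.
                    bdd_above ((\<lambda>\<pi>. mnorm V (deg G \<pi>) (A \<pi>)) ` dual_object G T)},
     mnorm = (\<lambda>n X. SUP \<pi>\<in>dual_object G T.
                mnorm (Mat n V) (deg G \<pi>) (\<lambda>k l. mtrunc n (\<lambda>i j. X i j \<pi> k l)))\<rparr>"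

definition mtrace ::
    "('a \<Rightarrow> 'b \<Rightarrow> 'c :: comm_monoid_add) \<Rightarrow> nat \<Rightarrow> (nat \<Rightarrow> nat \<Rightarrow> 'a) \<Rightarrow> (nat \<Rightarrow> nat \<Rightarrow> 'b) \<Rightarrow> 'c" where
  "mtrace br d A B = (\<Sum>k<d. \<Sum>l<d. br (A k l) (B l k))"

definition pairing_term ::
    "('g, 'm) monoid_scheme \<Rightarrow> ('a \<Rightarrow> 'b \<Rightarrow> 'c :: complex_vector)
      \<Rightarrow> ('g rep_class \<Rightarrow> nat \<Rightarrow> nat \<Rightarrow> 'a) \<Rightarrow> ('g rep_class \<Rightarrow> nat \<Rightarrow> nat \<Rightarrow> 'b)
      \<Rightarrow> 'g rep_class \<Rightarrow> 'c" where
  "pairing_term G br A B \<pi> = of_nat (deg G \<pi>) *\<^sub>C mtrace br (deg G \<pi>) (A \<pi>) (B \<pi>)"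

text \<open>The trace class norm is the dual norm of the operator norm under the trace pairing.\<close>

definition schatten1_norm :: "nat \<Rightarrow> (nat \<Rightarrow> nat \<Rightarrow> complex) \<Rightarrow> real" where
  "schatten1_norm d B = cb_norm (Mat d scalar_space) scalar_space (\<lambda>A. mtrace (*) d A B)"

text \<open>The embedding of the scalar L1 space into the dual of the L-infinity space with values
  in the dual of the scalars; the entries of A are functionals, paired with scalars by
  evaluation.\<close>

definition L1_embedding ::
    "('g, 'm) monoid_scheme \<Rightarrow> 'g topology \<Rightarrow> ('g rep_class \<Rightarrow> nat \<Rightarrow> nat \<Rightarrow> complex)
      \<Rightarrow> ('g rep_class \<Rightarrow> nat \<Rightarrow> nat \<Rightarrow> complex \<Rightarrow> complex) \<Rightarrow> complex" where
  "L1_embedding G T B = extend_zero (vecs (Linf G T (op_dual scalar_space)))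
     (\<lambda>A. \<Sum>\<^sub>\<infinity>\<pi>\<in>dual_object G T. pairing_term G (\<lambda>\<phi> z. \<phi> z) A B \<pi>)"

text \<open>The norm of the scalar L1 space is the sum of the terms required here to be summable;
  as the embedding is isometric, it is also the norm induced on 1 by 1 matrices.\<close>

definition L1 ::
    "('g, 'm) monoid_scheme \<Rightarrow> 'g topology
      \<Rightarrow> ('g rep_class \<Rightarrow> nat \<Rightarrow> nat \<Rightarrow> complex) matnormed" where
  "L1 G T = \<lparr>vecs = {B \<in> families G T scalar_space.
                (\<lambda>\<pi>. real (deg G \<pi>) * schatten1_norm (deg G \<pi>) (B \<pi>)) summable_on dual_object G T},
     mnorm = (\<lambda>n X. mnorm (op_dual (Linf G T (op_dual scalar_space))) n
                       (\<lambda>i j. L1_embedding G T (X i j)))\<rparr>"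

definition Lambda ::
    "('g, 'm) monoid_scheme \<Rightarrow> 'g topology
      \<Rightarrow> ('g rep_class \<Rightarrow> nat \<Rightarrow> nat \<Rightarrow> ('h :: complex_hilbert \<Rightarrow>\<^sub>L 'h))
      \<Rightarrow> ('g rep_class \<Rightarrow> nat \<Rightarrow> nat \<Rightarrow> complex) \<Rightarrow> ('h \<Rightarrow>\<^sub>L 'h)" where
  "Lambda G T A = extend_zero (vecs (L1 G T))
     (\<lambda>B. \<Sum>\<^sub>\<infinity>\<pi>\<in>dual_object G T. pairing_term G (\<lambda>a b. b *\<^sub>C a) A B \<pi>)"

end

theory Submission
  imports Defs
begin

text \<open>The element B of L1 tested by B = E_lk / d at a single class recovers the entry A_kl from
  Lambda A. The d by d matrix of these elements of L1 has norm at most 1, since pairing it with a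
  family returns the component of the family at that class. This gives the lower bound for the
  norm, injectivity, and a candidate for the preimage of a completely bounded map; the candidate
  works because a family in L1 is approximated by its finite parts.

  For the upper bound, let B be an n by n matrix over L1. By definition of its norm, B acts on
  bounded families of scalar matrices as a completely bounded map. The operators in A enter a given
  value of a bilinear form only through finitely many vectors of the Hilbert space. Compressing A
  to their span turns it into a matrix of scalar families of no larger norm, so that the bound for
  scalars applies.\<close>

text \<open>The norms in the definitions are suprema, and in HOL the supremum of an unbounded set of
  reals carries no information. Using such a norm as an upper bound therefore requires a finite
  bound beforehand, often a crude one as in \<open>schatten1_crude\<close> or
  \<open>L1_crude\<close>, which the sharp bound then replaces. Two norms on L1 are in play: the
  weighted sum \<open>L1sum\<close> controls convergence and tails, while the sharp constants come
  from the norm given by the embedding, itself a completely bounded norm. Since that norm admits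
  test matrices of every size, the upper bound loses no constant: the size of the matrix over the
  bounded families and the number of vectors used for the compression together form the size of a
  single test matrix. The factor 1 / d in the test elements cancels the weight of the class in the
  pairing.\<close>

section \<open>Matrices of operators\<close>

text \<open>Bounding the bilinear form instead of the operator norm makes reindexing along
  bijections of index sets, and hence passing between the nested matrices and their flattenings,
  a mere renaming of summation variables.\<close>

definition form_bounded ::
    "('a \<Rightarrow> 'h :: real_inner \<Rightarrow> 'h) \<Rightarrow> 'i set \<Rightarrow> ('i \<Rightarrow> 'i \<Rightarrow> 'a) \<Rightarrow> real \<Rightarrow> bool" where
  "form_bounded act I X C \<longleftrightarrow>
     (\<forall>\<xi> \<eta>. (\<Sum>i\<in>I. \<Sum>j\<in>I. inner (act (X i j) (\<xi> j)) (\<eta> i))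
            \<le> C * L2_set (\<lambda>j. norm (\<xi> j)) I * L2_set (\<lambda>i. norm (\<eta> i)) I)"

lemma form_boundedD:
  "form_bounded act I X C \<Longrightarrow> (\<Sum>i\<in>I. \<Sum>j\<in>I. inner (act (X i j) (\<xi> j)) (\<eta> i))
            \<le> C * L2_set (\<lambda>j. norm (\<xi> j)) I * L2_set (\<lambda>i. norm (\<eta> i)) I"
  by (simp add: form_bounded_def)

lemma form_bounded_cong:
  assumes "\<And>i j. i \<in> I \<Longrightarrow> j \<in> I \<Longrightarrow> X i j = Y i j"
  shows "form_bounded act I X C \<longleftrightarrow> form_bounded act I Y C"
  using assms by (simp add: form_bounded_def cong: sum.cong)

lemma L2_set_power2: "(L2_set f I)\<^sup>2 = (\<Sum>i\<in>I. (f i)\<^sup>2)"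
  by (simp add: L2_set_def sum_nonneg)

text \<open>Testing the form with the image vector in place of \<eta> gives the squared norm of the
  image. The other direction is Cauchy-Schwarz, first in each component and then over the index
  set.\<close>

lemma form_bounded_iff_L2:
  assumes "0 \<le> C"
  shows "form_bounded act I X C \<longleftrightarrow>
    (\<forall>\<xi>. L2_set (\<lambda>i. norm (\<Sum>j\<in>I. act (X i j) (\<xi> j))) I \<le> C * L2_set (\<lambda>j. norm (\<xi> j)) I)"
    (is "?L \<longleftrightarrow> ?R")
proof
  assume L: ?L
  show ?R
  proof
    fix \<xi>
    let ?v = "\<lambda>i. \<Sum>j\<in>I. act (X i j) (\<xi> j)"
    let ?N = "L2_set (\<lambda>i. norm (?v i)) I"
    have "?N * ?N = (\<Sum>i\<in>I. inner (?v i) (?v i))"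
      using L2_set_power2[of "\<lambda>i. norm (?v i)" I]
      by (simp add: power2_eq_square[symmetric] power2_norm_eq_inner)
    also have "\<dots> = (\<Sum>i\<in>I. \<Sum>j\<in>I. inner (act (X i j) (\<xi> j)) (?v i))"
      by (simp only: inner_sum_left)
    also have "\<dots> \<le> C * L2_set (\<lambda>j. norm (\<xi> j)) I * ?N"
      by (rule form_boundedD[OF L])
    finally have *: "?N * ?N \<le> C * L2_set (\<lambda>j. norm (\<xi> j)) I * ?N" .
    show "?N \<le> C * L2_set (\<lambda>j. norm (\<xi> j)) I"
    proof (cases "?N = 0")
      case True
      then show ?thesis using assms by (simp only:) simp
    next
      case False
      then have "0 < ?N" using L2_set_nonneg[of "\<lambda>i. norm (?v i)" I] by linarith
      then show ?thesis using * by (rule mult_right_le_imp_le[rotated])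
    qed
  qed
next
  assume R: ?R
  show ?L
    unfolding form_bounded_def
  proof (intro allI)
    fix \<xi> \<eta>
    let ?v = "\<lambda>i. \<Sum>j\<in>I. act (X i j) (\<xi> j)"
    have "(\<Sum>i\<in>I. \<Sum>j\<in>I. inner (act (X i j) (\<xi> j)) (\<eta> i)) = (\<Sum>i\<in>I. inner (?v i) (\<eta> i))"
      by (simp only: inner_sum_left)
    also have "\<dots> \<le> (\<Sum>i\<in>I. \<bar>norm (?v i)\<bar> * \<bar>norm (\<eta> i)\<bar>)"
      by (rule sum_mono) (simp add: norm_cauchy_schwarz)
    also have "\<dots> \<le> L2_set (\<lambda>i. norm (?v i)) I * L2_set (\<lambda>i. norm (\<eta> i)) I"
      by (rule L2_set_mult_ineq)
    also have "\<dots> \<le> C * L2_set (\<lambda>j. norm (\<xi> j)) I * L2_set (\<lambda>i. norm (\<eta> i)) I"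
      using R by (intro mult_right_mono) auto
    finally show "(\<Sum>i\<in>I. \<Sum>j\<in>I. inner (act (X i j) (\<xi> j)) (\<eta> i)) \<le> \<dots>" .
  qed
qed

lemma form_bounded_mono:
  assumes "form_bounded act I X C" "C \<le> D"
  shows "form_bounded act I X D"
  unfolding form_bounded_def
proof (intro allI)
  fix \<xi> \<eta>
  have "(\<Sum>i\<in>I. \<Sum>j\<in>I. inner (act (X i j) (\<xi> j)) (\<eta> i))
      \<le> C * L2_set (\<lambda>j. norm (\<xi> j)) I * L2_set (\<lambda>i. norm (\<eta> i)) I"
    by (rule form_boundedD[OF assms(1)])
  also have "\<dots> \<le> D * L2_set (\<lambda>j. norm (\<xi> j)) I * L2_set (\<lambda>i. norm (\<eta> i)) I"
    using assms(2) by (intro mult_right_mono) auto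
  finally show "(\<Sum>i\<in>I. \<Sum>j\<in>I. inner (act (X i j) (\<xi> j)) (\<eta> i)) \<le> \<dots>" .
qed

text \<open>For fixed vectors the claim is a limit of inequalities as e tends to 0. It removes the
  excess left by normalizations with \<open>C + e\<close>; \<open>K\<close> absorbs the factor of
  that excess.\<close>

lemma form_bounded_of_greater:
  assumes "\<And>e. 0 < e \<Longrightarrow> form_bounded act I X (C + e * K)"
  shows "form_bounded act I X C"
  unfolding form_bounded_def
proof (intro allI)
  fix \<xi> \<eta>
  let ?s = "\<Sum>i\<in>I. \<Sum>j\<in>I. inner (act (X i j) (\<xi> j)) (\<eta> i)"
  let ?p = "L2_set (\<lambda>j. norm (\<xi> j)) I * L2_set (\<lambda>i. norm (\<eta> i)) I"
  have *: "?s \<le> C * ?p + e * (K * ?p)" if "0 < e" for e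
    using form_boundedD[OF assms[OF that], of \<xi> \<eta>] by (simp add: algebra_simps)
  have "((\<lambda>e. C * ?p + e * (K * ?p)) \<longlongrightarrow> C * ?p + 0 * (K * ?p)) (at_right 0)"
    by (intro tendsto_intros)
  moreover have "eventually (\<lambda>e. ?s \<le> C * ?p + e * (K * ?p)) (at_right 0)"
    using eventually_at_right_less[of "0::real"] by eventually_elim (rule *)
  ultimately have "?s \<le> C * ?p + 0 * (K * ?p)"
    by (rule tendsto_lowerbound) simp
  then show "?s \<le> C * L2_set (\<lambda>j. norm (\<xi> j)) I * L2_set (\<lambda>i. norm (\<eta> i)) I"
    by (simp add: mult.assoc)
qed

lemma L2_set_extend:
  assumes "finite I" "inj_on f J" "f ` J \<subseteq> I"
  shows "L2_set (\<lambda>i. norm (if i \<in> f ` J then \<xi> (the_inv_into J f i) else 0)) I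
    = L2_set (\<lambda>j. norm (\<xi> j :: 'a :: real_normed_vector)) J"
proof -
  have "(\<Sum>i\<in>I. (norm (if i \<in> f ` J then \<xi> (the_inv_into J f i) else 0))\<^sup>2)
     = (\<Sum>i\<in>f ` J. (norm (\<xi> (the_inv_into J f i)))\<^sup>2)"
    using assms by (intro sum.mono_neutral_cong_right) auto
  also have "\<dots> = (\<Sum>j\<in>J. (norm (\<xi> j))\<^sup>2)"
    using assms by (simp add: sum.reindex the_inv_into_f_f)
  finally show ?thesis by (simp add: L2_set_def)
qed

text \<open>Vectors indexed by \<open>J\<close> are extended by zero along the injections, which
  preserves their norms. Rows and columns are selected independently, so that off-diagonal blocks
  and entries are covered as well.\<close>

lemma form_bounded_select:
  fixes act :: "'a \<Rightarrow> 'h \<Rightarrow> 'h :: real_inner" and J :: "'j set"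
  assumes X: "form_bounded act I X C" and lin: "\<And>a. bounded_linear (act a)" and "finite I"
    and f: "inj_on f J" "f ` J \<subseteq> I" and g: "inj_on g J" "g ` J \<subseteq> I"
  shows "form_bounded act J (\<lambda>i j. X (f i) (g j)) C"
  unfolding form_bounded_def
proof (intro allI)
  fix \<xi> \<eta> :: "'j \<Rightarrow> 'h"
  let ?\<xi> = "\<lambda>i. if i \<in> g ` J then \<xi> (the_inv_into J g i) else 0"
  let ?\<eta> = "\<lambda>i. if i \<in> f ` J then \<eta> (the_inv_into J f i) else 0"
  have z: "act a 0 = 0" for a
    using lin by (simp add: linear_simps)
  have "(\<Sum>i\<in>J. \<Sum>j\<in>J. inner (act (X (f i) (g j)) (\<xi> j)) (\<eta> i))
     = (\<Sum>i\<in>f ` J. \<Sum>j\<in>g ` J. inner (act (X i j) (?\<xi> j)) (?\<eta> i))"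
    using f g by (simp add: sum.reindex the_inv_into_f_f)
  also have "\<dots> = (\<Sum>i\<in>I. \<Sum>j\<in>I. inner (act (X i j) (?\<xi> j)) (?\<eta> i))"
    by (rule sum.mono_neutral_cong_left[OF \<open>finite I\<close> f(2)], simp,
        rule sum.mono_neutral_cong_left[OF \<open>finite I\<close> g(2)]) (auto simp: z)
  also have "\<dots> \<le> C * L2_set (\<lambda>j. norm (?\<xi> j)) I * L2_set (\<lambda>i. norm (?\<eta> i)) I"
    by (rule form_boundedD[OF X])
  also have "\<dots> = C * L2_set (\<lambda>j. norm (\<xi> j)) J * L2_set (\<lambda>i. norm (\<eta> i)) J"
    using assms by (simp only: L2_set_extend)
  finally show "(\<Sum>i\<in>J. \<Sum>j\<in>J. inner (act (X (f i) (g j)) (\<xi> j)) (\<eta> i)) \<le> \<dots>" .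
qed

lemma form_bounded_reindex:
  assumes "form_bounded act I X C" "\<And>a. bounded_linear (act a)" "finite I" "bij_betw f J I"
    "\<And>i j. i \<in> J \<Longrightarrow> j \<in> J \<Longrightarrow> Y i j = X (f i) (f j)"
  shows "form_bounded act J Y C"
proof -
  have "form_bounded act J (\<lambda>i j. X (f i) (f j)) C"
    using assms(4) by (intro form_bounded_select[OF assms(1-3)]) (auto simp: bij_betw_def)
  then show ?thesis
    using form_bounded_cong[of J Y "\<lambda>i j. X (f i) (f j)" act C] assms(5) by blast
qed

lemma L2_set_slice_le:
  assumes "finite I" "finite P" "u \<in> P"
  shows "L2_set (\<lambda>i. \<xi> (i, u)) I \<le> L2_set \<xi> (I \<times> P)"
proof -
  have "(\<Sum>i\<in>I. (\<xi> (i, u))\<^sup>2) = (\<Sum>x\<in>(\<lambda>i. (i, u)) ` I. (\<xi> x)\<^sup>2)"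
    by (simp add: sum.reindex inj_on_def)
  also have "\<dots> \<le> (\<Sum>x\<in>I \<times> P. (\<xi> x)\<^sup>2)"
    using assms by (intro sum_mono2) auto
  finally show ?thesis by (simp add: L2_set_def)
qed

lemma sum_delta2:
  fixes f :: "nat \<Rightarrow> nat \<Rightarrow> 'a :: comm_monoid_add"
  assumes "k < d" "l < d" "\<And>i j. \<not> (i = k \<and> j = l) \<Longrightarrow> f i j = 0"
  shows "(\<Sum>i<d. \<Sum>j<d. f i j) = f k l"
proof -
  have "(\<Sum>i<d. \<Sum>j<d. f i j) = (\<Sum>i<d. if i = k then f k l else 0)"
  proof (intro sum.cong refl)
    fix i
    have "(\<Sum>j<d. f i j) = (\<Sum>j<d. if j = l then f i l else 0)"
      by (intro sum.cong refl) (use assms(3) in auto)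
    then show "(\<Sum>j<d. f i j) = (if i = k then f k l else 0)"
      using assms by auto
  qed
  then show ?thesis using assms by simp
qed

lemma sum_Times: "(\<Sum>a\<in>I \<times> J. f a) = (\<Sum>i\<in>I. \<Sum>j\<in>J. f (i, j))"
  by (simp add: sum.cartesian_product)

text \<open>A crude triangle inequality over the blocks. It serves to show that suprema are
  finite.\<close>

lemma form_bounded_blocks:
  fixes act :: "'a \<Rightarrow> 'h \<Rightarrow> 'h :: real_inner" and I :: "'i set" and P :: "'p set"
  assumes "finite I" "finite P"
    and b: "\<And>u v. u \<in> P \<Longrightarrow> v \<in> P \<Longrightarrow> form_bounded act I (\<lambda>i j. X (i, u) (j, v)) (K u v)"
    and K: "\<And>u v. u \<in> P \<Longrightarrow> v \<in> P \<Longrightarrow> 0 \<le> K u v"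
  shows "form_bounded act (I \<times> P) X (\<Sum>u\<in>P. \<Sum>v\<in>P. K u v)"
  unfolding form_bounded_def
proof (intro allI)
  fix \<xi> \<eta> :: "'i \<times> 'p \<Rightarrow> 'h"
  let ?x = "\<lambda>v. L2_set (\<lambda>j. norm (\<xi> (j, v))) I" and ?e = "\<lambda>u. L2_set (\<lambda>j. norm (\<eta> (j, u))) I"
  let ?X = "L2_set (\<lambda>j. norm (\<xi> j)) (I \<times> P)" and ?E = "L2_set (\<lambda>j. norm (\<eta> j)) (I \<times> P)"
  have "(\<Sum>a\<in>I \<times> P. \<Sum>b\<in>I \<times> P. inner (act (X a b) (\<xi> b)) (\<eta> a))
     = (\<Sum>i\<in>I. \<Sum>u\<in>P. \<Sum>v\<in>P. \<Sum>j\<in>I. inner (act (X (i, u) (j, v)) (\<xi> (j, v))) (\<eta> (i, u)))"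
    by (simp add: sum_Times sum.swap[of _ P I])
  also have "\<dots> = (\<Sum>u\<in>P. \<Sum>v\<in>P. \<Sum>i\<in>I. \<Sum>j\<in>I.
      inner (act (X (i, u) (j, v)) (\<xi> (j, v))) (\<eta> (i, u)))"
    by (simp add: sum.swap[of _ P I])
  also have "\<dots> \<le> (\<Sum>u\<in>P. \<Sum>v\<in>P. K u v * ?X * ?E)"
  proof (intro sum_mono)
    fix u v assume uv: "u \<in> P" "v \<in> P"
    have "(\<Sum>i\<in>I. \<Sum>j\<in>I. inner (act (X (i, u) (j, v)) (\<xi> (j, v))) (\<eta> (i, u)))
        \<le> K u v * ?x v * ?e u"
      by (rule form_boundedD[OF b[OF uv]])
    also have "\<dots> \<le> K u v * ?X * ?E"
      using uv K assms(1,2) L2_set_slice_le[of I P v "\<lambda>a. norm (\<xi> a)"]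
        L2_set_slice_le[of I P u "\<lambda>a. norm (\<eta> a)"]
      by (intro mult_mono) auto
    finally show "(\<Sum>i\<in>I. \<Sum>j\<in>I. inner (act (X (i, u) (j, v)) (\<xi> (j, v))) (\<eta> (i, u)))
      \<le> K u v * ?X * ?E" .
  qed
  finally show "(\<Sum>a\<in>I \<times> P. \<Sum>b\<in>I \<times> P. inner (act (X a b) (\<xi> b)) (\<eta> a))
      \<le> (\<Sum>u\<in>P. \<Sum>v\<in>P. K u v) * ?X * ?E"
    by (simp add: sum_distrib_right)
qed

lemma form_bounded_norm_le:
  fixes act :: "'a \<Rightarrow> 'h \<Rightarrow> 'h :: real_inner"
  assumes "form_bounded act I X C" "\<And>a. bounded_linear (act a)" "finite I" "0 \<le> C"
    "i \<in> I" "j \<in> I"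
  shows "norm (act (X i j) x) \<le> C * norm x"
proof -
  have "form_bounded act {()} (\<lambda>_ _. X i j) C"
    using form_bounded_select[OF assms(1-3), of "\<lambda>_. i" "{()}" "\<lambda>_. j"] assms(5,6) by simp
  then show ?thesis
    using \<open>0 \<le> C\<close> by (auto simp: form_bounded_iff_L2)
qed

lemma op_matrix_norm_le:
  assumes "form_bounded act {..<n} X C" "0 \<le> C"
  shows "op_matrix_norm act n X \<le> C"
  unfolding op_matrix_norm_def
proof (rule cSup_least)
  show "{L2_set (\<lambda>i. norm (\<Sum>j<n. act (X i j) (\<xi> j))) {..<n} |\<xi>.
     L2_set (\<lambda>j. norm (\<xi> j)) {..<n} \<le> 1} \<noteq> {}"
    by (auto intro!: exI[of _ "\<lambda>_. 0"] simp: L2_set_def)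
next
  fix x assume "x \<in> {L2_set (\<lambda>i. norm (\<Sum>j<n. act (X i j) (\<xi> j))) {..<n} |\<xi>.
     L2_set (\<lambda>j. norm (\<xi> j)) {..<n} \<le> 1}"
  then obtain \<xi> where x: "x = L2_set (\<lambda>i. norm (\<Sum>j<n. act (X i j) (\<xi> j))) {..<n}"
    and \<xi>: "L2_set (\<lambda>j. norm (\<xi> j)) {..<n} \<le> 1" by auto
  have "x \<le> C * L2_set (\<lambda>j. norm (\<xi> j)) {..<n}"
    using assms x by (simp add: form_bounded_iff_L2)
  also have "\<dots> \<le> C" using \<xi> assms(2) by (simp add: mult_left_le)
  finally show "x \<le> C" .
qed

text \<open>Every entry counts as a block of size one, bounded by its operator norm. This makes
  \<open>op_matrix_norm\<close> the supremum of a bounded set.\<close>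

lemma form_bounded_finite:
  fixes act :: "'a \<Rightarrow> 'h \<Rightarrow> 'h :: real_inner"
  assumes "\<And>a. bounded_linear (act a)" "finite I"
  shows "\<exists>C\<ge>0. form_bounded act I X C"
proof -
  have "form_bounded act {()} (\<lambda>i j. X u v) (onorm (act (X u v)))" for u v
    using onorm_pos_le[OF assms(1)] onorm[OF assms(1)]
    by (simp add: form_bounded_iff_L2)
  then have "form_bounded act ({()} \<times> I) (\<lambda>a b. X (snd a) (snd b))
      (\<Sum>u\<in>I. \<Sum>v\<in>I. onorm (act (X u v)))"
    using assms onorm_pos_le[OF assms(1)] by (intro form_bounded_blocks) auto
  then have "form_bounded act I X (\<Sum>u\<in>I. \<Sum>v\<in>I. onorm (act (X u v)))"
    by (rule form_bounded_reindex[where f = "Pair ()"])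
      (use assms in \<open>auto simp: bij_betw_def inj_on_def\<close>)
  then show ?thesis
    using onorm_pos_le[OF assms(1)] sum_nonneg by (metis (no_types, lifting))
qed

lemma
  fixes act :: "'a \<Rightarrow> 'h \<Rightarrow> 'h :: real_inner"
  assumes "\<And>a. bounded_linear (act a)"
  shows form_bounded_op_matrix_norm: "form_bounded act {..<n} X (op_matrix_norm act n X)"
    and op_matrix_norm_nonneg: "0 \<le> op_matrix_norm act n X"
proof -
  let ?v = "\<lambda>\<xi>. L2_set (\<lambda>i. norm (\<Sum>j<n. act (X i j) (\<xi> j))) {..<n}"
  let ?n = "\<lambda>\<xi>. L2_set (\<lambda>j. norm (\<xi> j)) {..<n}"
  let ?S = "{?v \<xi> |\<xi>. ?n \<xi> \<le> 1}"
  obtain C where C: "0 \<le> C" "form_bounded act {..<n} X C"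
    using form_bounded_finite[of act "{..<n}" X] assms by auto
  then have le: "?v \<xi> \<le> C * ?n \<xi>" for \<xi> by (simp add: form_bounded_iff_L2)
  have bdd: "bdd_above ?S"
  proof (rule bdd_aboveI)
    fix x assume "x \<in> ?S"
    then obtain \<xi> where "x = ?v \<xi>" "?n \<xi> \<le> 1" by auto
    then show "x \<le> C" using le[of \<xi>] C(1) mult_left_le[of "?n \<xi>" C] by linarith
  qed
  have up: "?v \<xi> \<le> op_matrix_norm act n X" if "?n \<xi> \<le> 1" for \<xi>
    unfolding op_matrix_norm_def by (rule cSup_upper[OF _ bdd]) (use that in auto)
  have "0 \<le> ?v (\<lambda>_. 0)" by simp
  also have "\<dots> \<le> op_matrix_norm act n X" by (rule up) (simp add: L2_set_def)
  finally show nonneg: "0 \<le> op_matrix_norm act n X" .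
  have "?v \<xi> \<le> op_matrix_norm act n X * ?n \<xi>" for \<xi>
  \<comment> \<open>A vector of norm zero cannot be normalized; there the finite bound
    \<open>C\<close> shows that its image vanishes.\<close>
  proof (cases "?n \<xi> = 0")
    case True
    then show ?thesis using le[of \<xi>] by simp
  next
    case False
    then have pos: "0 < ?n \<xi>" using L2_set_nonneg[of "\<lambda>j. norm (\<xi> j)" "{..<n}"] by linarith
    let ?\<zeta> = "\<lambda>j. \<xi> j /\<^sub>R ?n \<xi>"
    have sc: "act a (c *\<^sub>R y) = c *\<^sub>R act a y" for a c y
      using assms by (simp add: linear_simps)
    have div: "L2_set (\<lambda>i. norm (w i /\<^sub>R ?n \<xi>)) {..<n} = L2_set (\<lambda>i. norm (w i)) {..<n} / ?n \<xi>"
      for w :: "nat \<Rightarrow> 'h"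
      using L2_set_right_distrib[of "inverse (?n \<xi>)" "\<lambda>i. norm (w i)" "{..<n}"] pos
      by (simp add: divide_inverse mult.commute)
    have "?n ?\<zeta> = ?n \<xi> / ?n \<xi>" by (rule div)
    then have "?v ?\<zeta> \<le> op_matrix_norm act n X" using pos by (intro up) simp
    also have "?v ?\<zeta> = ?v \<xi> / ?n \<xi>"
      by (simp only: sc scaleR_sum_right[symmetric] div)
    finally show ?thesis using pos by (simp add: divide_le_eq)
  qed
  then show "form_bounded act {..<n} X (op_matrix_norm act n X)"
    using nonneg by (simp add: form_bounded_iff_L2)
qed

lemma op_matrix_norm_cong:
  assumes "\<And>i j. i < n \<Longrightarrow> j < n \<Longrightarrow> X i j = Y i j"
  shows "op_matrix_norm act n X = op_matrix_norm act n Y"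
proof -
  have "L2_set (\<lambda>i. norm (\<Sum>j<n. act (X i j) (\<xi> j))) {..<n}
      = L2_set (\<lambda>i. norm (\<Sum>j<n. act (Y i j) (\<xi> j))) {..<n}" for \<xi>
    using assms by (intro L2_set_cong refl arg_cong[where f = norm] sum.cong) auto
  then show ?thesis by (simp add: op_matrix_norm_def)
qed

text \<open>Division with remainder by \<open>n\<close> identifies the flat indices used by
  \<open>Mat\<close> with pairs; for \<open>n = 0\<close> both index sets are empty. The arguments
  of \<open>Z\<close> are outer row, outer column, inner row, inner column.\<close>

lemma form_bounded_flatten:
  fixes n N :: nat
  assumes "\<And>a. bounded_linear (act a)"
  shows "form_bounded act {..<N * n} (\<lambda>r s. Z (r div n) (s div n) (r mod n) (s mod n)) C \<longleftrightarrow>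
    form_bounded act ({..<N} \<times> {..<n}) (\<lambda>a b. Z (fst a) (fst b) (snd a) (snd b)) C"
    (is "?L \<longleftrightarrow> ?R")
proof (cases "n = 0")
  case False
  have lt: "u * n + p < N * n" if "u < N" "p < n" for u p
  proof -
    have "u * n + p < Suc u * n" using that by simp
    also have "\<dots> \<le> N * n" using that by (intro mult_right_mono) auto
    finally show ?thesis .
  qed
  have b1: "bij_betw (\<lambda>r. (r div n, r mod n)) {..<N * n} ({..<N} \<times> {..<n})"
    using False lt
    by (intro bij_betwI[where g = "\<lambda>(u, p). u * n + p"]) (auto simp: less_mult_imp_div_less)
  have b2: "bij_betw (\<lambda>(u, p). u * n + p) ({..<N} \<times> {..<n}) {..<N * n}"
    using False lt
    by (intro bij_betwI[where g = "\<lambda>r. (r div n, r mod n)"]) (auto simp: less_mult_imp_div_less)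
  show ?thesis
  proof
    assume ?L
    then show ?R
      by (rule form_bounded_reindex[OF _ assms _ b2]) auto
  next
    assume ?R
    then show ?L
      by (rule form_bounded_reindex[OF _ assms _ b1]) auto
  qed
qed (simp add: form_bounded_def)

section \<open>Matrices of scalars\<close>

lemma L2_set_Times: "L2_set (\<lambda>i. L2_set (\<lambda>p. f (i, p)) J) I = L2_set f (I \<times> J)"
  unfolding L2_set_def by (simp add: sum_nonneg sum_Times)

lemma L2_set_Times': "L2_set (\<lambda>p. L2_set (\<lambda>i. f (i, p)) I) J = L2_set f (I \<times> J)"
  unfolding L2_set_def by (simp add: sum_nonneg sum_Times, subst sum.swap, rule refl)

lemma form_bounded_scale:
  fixes X :: "'i \<Rightarrow> 'i \<Rightarrow> complex"
  assumes "form_bounded (*) I X C"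
  shows "form_bounded (*) I (\<lambda>i j. c * X i j) (cmod c * C)"
  unfolding form_bounded_def
proof (intro allI)
  fix \<xi> \<eta> :: "'i \<Rightarrow> complex"
  have "(\<Sum>i\<in>I. \<Sum>j\<in>I. inner (X i j * (c * \<xi> j)) (\<eta> i))
     \<le> C * L2_set (\<lambda>j. norm (c * \<xi> j)) I * L2_set (\<lambda>i. norm (\<eta> i)) I"
    by (rule form_boundedD[OF assms])
  then show "(\<Sum>i\<in>I. \<Sum>j\<in>I. inner (c * X i j * \<xi> j) (\<eta> i))
     \<le> cmod c * C * L2_set (\<lambda>j. norm (\<xi> j)) I * L2_set (\<lambda>i. norm (\<eta> i)) I"
    by (simp add: norm_mult L2_set_right_distrib[symmetric] mult_ac)
qed

lemma form_bounded_sum: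
  fixes X :: "'s \<Rightarrow> 'i \<Rightarrow> 'i \<Rightarrow> complex"
  assumes "\<And>s. s \<in> S \<Longrightarrow> form_bounded (*) I (X s) (C s)"
  shows "form_bounded (*) I (\<lambda>i j. \<Sum>s\<in>S. X s i j) (\<Sum>s\<in>S. C s)"
  unfolding form_bounded_def
proof (intro allI)
  fix \<xi> \<eta> :: "'i \<Rightarrow> complex"
  have "(\<Sum>i\<in>I. \<Sum>j\<in>I. inner ((\<Sum>s\<in>S. X s i j) * \<xi> j) (\<eta> i))
     = (\<Sum>i\<in>I. \<Sum>s\<in>S. \<Sum>j\<in>I. inner (X s i j * \<xi> j) (\<eta> i))"
    by (intro sum.cong refl) (simp only: sum_distrib_right inner_sum_left, rule sum.swap)
  also have "\<dots> = (\<Sum>s\<in>S. \<Sum>i\<in>I. \<Sum>j\<in>I. inner (X s i j * \<xi> j) (\<eta> i))"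
    by (rule sum.swap)
  also have "\<dots> \<le> (\<Sum>s\<in>S. C s * L2_set (\<lambda>j. norm (\<xi> j)) I * L2_set (\<lambda>i. norm (\<eta> i)) I)"
    by (intro sum_mono form_boundedD assms)
  finally show "(\<Sum>i\<in>I. \<Sum>j\<in>I. inner ((\<Sum>s\<in>S. X s i j) * \<xi> j) (\<eta> i))
     \<le> (\<Sum>s\<in>S. C s) * L2_set (\<lambda>j. norm (\<xi> j)) I * L2_set (\<lambda>i. norm (\<eta> i)) I"
    by (simp add: sum_distrib_right)
qed

lemma form_bounded_entry:
  fixes X :: "'i \<Rightarrow> 'i \<Rightarrow> complex"
  assumes "form_bounded (*) I X C" "finite I" "0 \<le> C" "i \<in> I" "j \<in> I"
  shows "cmod (X i j) \<le> C"
  using form_bounded_norm_le[OF assms(1) bounded_linear_mult_right assms(2-5), of 1] by simp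

text \<open>For fixed vectors the form is a finite combination of entries. A bound of a matrix also
  bounds its entries, so each entry series converges absolutely and the estimate for finite partial
  sums passes to the limit.\<close>

lemma form_bounded_infsum:
  fixes X :: "'s \<Rightarrow> 'i \<Rightarrow> 'i \<Rightarrow> complex"
  assumes X: "\<And>s. s \<in> S \<Longrightarrow> form_bounded (*) I (X s) (C s)" and C: "\<And>s. s \<in> S \<Longrightarrow> 0 \<le> C s"
    and sm: "C summable_on S" and I: "finite I"
  shows "form_bounded (*) I (\<lambda>i j. \<Sum>\<^sub>\<infinity>s\<in>S. X s i j) (\<Sum>\<^sub>\<infinity>s\<in>S. C s)"
proof -
  have summ: "(\<lambda>s. X s i j) summable_on S" if "i \<in> I" "j \<in> I" for i j
  proof -
    have "(\<lambda>s. norm (X s i j)) summable_on S"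
      by (rule summable_on_comparison_test[OF sm]) (use form_bounded_entry[OF X I C] that in auto)
    then show ?thesis by (rule abs_summable_summable)
  qed
  show "form_bounded (*) I (\<lambda>i j. \<Sum>\<^sub>\<infinity>s\<in>S. X s i j) (\<Sum>\<^sub>\<infinity>s\<in>S. C s)"
    unfolding form_bounded_def
  proof (intro allI)
    fix \<xi> \<eta> :: "'i \<Rightarrow> complex"
    let ?p = "L2_set (\<lambda>j. norm (\<xi> j)) I * L2_set (\<lambda>i. norm (\<eta> i)) I"
    let ?f = "\<lambda>F. \<Sum>i\<in>I. \<Sum>j\<in>I. inner ((\<Sum>s\<in>F. X s i j) * \<xi> j) (\<eta> i)"
    have "(?f \<longlongrightarrow> (\<Sum>i\<in>I. \<Sum>j\<in>I. inner ((\<Sum>\<^sub>\<infinity>s\<in>S. X s i j) * \<xi> j) (\<eta> i)))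
        (finite_subsets_at_top S)"
      by (intro tendsto_intros tendsto_sum infsum_tendsto summ)
    moreover have "\<forall>\<^sub>F F in finite_subsets_at_top S. ?f F \<le> (\<Sum>\<^sub>\<infinity>s\<in>S. C s) * ?p"
    proof (rule eventually_finite_subsets_at_top_weakI)
      fix F assume F: "finite F" "F \<subseteq> S"
      have "?f F \<le> (\<Sum>s\<in>F. C s) * ?p"
        using form_boundedD[OF form_bounded_sum[of F I X C]] X F by (auto simp: mult.assoc)
      also have "\<dots> \<le> (\<Sum>\<^sub>\<infinity>s\<in>S. C s) * ?p"
        using F C by (intro mult_right_mono finite_sum_le_infsum[OF sm]) auto
      finally show "?f F \<le> (\<Sum>\<^sub>\<infinity>s\<in>S. C s) * ?p" .
    qed
    ultimately show "(\<Sum>i\<in>I. \<Sum>j\<in>I. inner ((\<Sum>\<^sub>\<infinity>s\<in>S. X s i j) * \<xi> j) (\<eta> i))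
      \<le> (\<Sum>\<^sub>\<infinity>s\<in>S. C s) * L2_set (\<lambda>j. norm (\<xi> j)) I * L2_set (\<lambda>i. norm (\<eta> i)) I"
      unfolding mult.assoc by (rule tendsto_upperbound) simp
  qed
qed

text \<open>The tensor product is applied in two stages. \<open>M\<close> acts on the second index
  and yields \<open>\<zeta>\<close>, enlarging the norm by at most \<open>b\<close>; then
  \<open>X\<close> acts on the first index for each fixed second index, and Cauchy-Schwarz sums over
  the latter.\<close>

lemma form_bounded_tensor:
  fixes X :: "'i \<Rightarrow> 'i \<Rightarrow> complex" and M :: "'j \<Rightarrow> 'j \<Rightarrow> complex"
  assumes X: "form_bounded (*) I X a" and M: "form_bounded (*) J M b" and ab: "0 \<le> a" "0 \<le> b"
  shows "form_bounded (*) (I \<times> J) (\<lambda>p q. X (fst p) (fst q) * M (snd p) (snd q)) (a * b)"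
  unfolding form_bounded_def
proof (intro allI)
  fix \<xi> \<eta> :: "'i \<times> 'j \<Rightarrow> complex"
  define \<zeta> where "\<zeta> x = (\<Sum>q\<in>J. M (snd x) q * \<xi> (fst x, q))" for x :: "'i \<times> 'j"
  let ?N = "\<lambda>f K. L2_set (\<lambda>j. cmod (f j)) K"
  have "?N \<zeta> (I \<times> J) = L2_set (\<lambda>i. L2_set (\<lambda>p. cmod (\<Sum>q\<in>J. M p q * \<xi> (i, q))) J) I"
    unfolding L2_set_Times[symmetric] \<zeta>_def by simp
  also have "\<dots> \<le> L2_set (\<lambda>i. b * L2_set (\<lambda>q. cmod (\<xi> (i, q))) J) I"
    using M ab by (intro L2_set_mono) (simp_all add: form_bounded_iff_L2)
  also have "\<dots> = b * ?N \<xi> (I \<times> J)"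
    using ab L2_set_Times[of "\<lambda>x. cmod (\<xi> x)"] by (simp add: L2_set_right_distrib[symmetric])
  finally have \<zeta>: "?N \<zeta> (I \<times> J) \<le> b * ?N \<xi> (I \<times> J)" .
  have "(\<Sum>p\<in>I \<times> J. \<Sum>q\<in>I \<times> J. inner (X (fst p) (fst q) * M (snd p) (snd q) * \<xi> q) (\<eta> p))
      = (\<Sum>i\<in>I. \<Sum>p\<in>J. \<Sum>j\<in>I. inner (X i j * \<zeta> (j, p)) (\<eta> (i, p)))"
    by (simp add: sum_Times \<zeta>_def sum_distrib_left inner_sum_left mult.assoc)
  also have "\<dots> = (\<Sum>p\<in>J. \<Sum>i\<in>I. \<Sum>j\<in>I. inner (X i j * \<zeta> (j, p)) (\<eta> (i, p)))"
    by (rule sum.swap)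
  also have "\<dots> \<le> (\<Sum>p\<in>J. a * ?N (\<lambda>j. \<zeta> (j, p)) I * ?N (\<lambda>i. \<eta> (i, p)) I)"
    by (intro sum_mono form_boundedD X)
  also have "\<dots> = a * (\<Sum>p\<in>J. \<bar>?N (\<lambda>j. \<zeta> (j, p)) I\<bar> * \<bar>?N (\<lambda>i. \<eta> (i, p)) I\<bar>)"
    by (simp add: sum_distrib_left mult.assoc)
  also have "\<dots> \<le> a * (L2_set (\<lambda>p. ?N (\<lambda>j. \<zeta> (j, p)) I) J * L2_set (\<lambda>p. ?N (\<lambda>i. \<eta> (i, p)) I) J)"
    using ab by (intro mult_left_mono L2_set_mult_ineq) auto
  also have "\<dots> = a * (?N \<zeta> (I \<times> J) * ?N \<eta> (I \<times> J))"
    using L2_set_Times'[of "\<lambda>x. cmod (\<zeta> x)" I J] L2_set_Times'[of "\<lambda>x. cmod (\<eta> x)" I J] by simp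
  also have "\<dots> \<le> a * ((b * ?N \<xi> (I \<times> J)) * ?N \<eta> (I \<times> J))"
    using ab \<zeta> by (intro mult_left_mono mult_right_mono) auto
  finally show "(\<Sum>p\<in>I \<times> J. \<Sum>q\<in>I \<times> J.
        inner (X (fst p) (fst q) * M (snd p) (snd q) * \<xi> q) (\<eta> p))
      \<le> a * b * ?N \<xi> (I \<times> J) * ?N \<eta> (I \<times> J)"
    by (simp add: mult.assoc)
qed

section \<open>Completely bounded norms\<close>

text \<open>The witness \<open>X0\<close> makes the set under the supremum nonempty.\<close>

lemma cb_norm_least:
  assumes "X0 \<in> matrices 1 V" "mnorm V 1 X0 \<le> 1"
    and "\<And>n X. 1 \<le> n \<Longrightarrow> X \<in> matrices n V \<Longrightarrow> mnorm V n X \<le> 1 \<Longrightarrow> mnorm W n (amplify n f X) \<le> C"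
  shows "cb_norm V W f \<le> C"
  unfolding cb_norm_def using assms by (intro cSup_least) (auto intro: exI[of _ "1::nat"])

text \<open>Any finite bound \<open>C\<close>, however bad, makes the supremum an upper
  bound.\<close>

lemma cb_norm_upper:
  assumes "\<And>n X. 1 \<le> n \<Longrightarrow> X \<in> matrices n V \<Longrightarrow> mnorm V n X \<le> 1 \<Longrightarrow> mnorm W n (amplify n f X) \<le> C"
    and "1 \<le> n" "X \<in> matrices n V" "mnorm V n X \<le> 1"
  shows "mnorm W n (amplify n f X) \<le> cb_norm V W f"
  unfolding cb_norm_def
proof (rule cSup_upper)
  show "bdd_above {mnorm W n (amplify n f X) |n X. 1 \<le> n \<and> X \<in> matrices n V \<and> mnorm V n X \<le> 1}"
    using assms(1) by (intro bdd_aboveI[of _ C]) auto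
qed (use assms in auto)

lemma mnorm_scalar_space [simp]: "mnorm scalar_space = op_matrix_norm (*)"
  and vecs_scalar_space [simp]: "vecs scalar_space = UNIV"
  by (simp_all add: scalar_space_def)

lemma mnorm_opspace [simp]: "mnorm (opspace E) = op_matrix_norm blinfun_apply"
  and vecs_opspace [simp]: "vecs (opspace E) = E"
  by (simp_all add: opspace_def)

lemma mnorm_Mat:
  "mnorm (Mat n V) k X = mnorm V (k * n) (\<lambda>r s. X (r div n) (s div n) (r mod n) (s mod n))"
  by (simp add: Mat_def)

lemma mtrunc_mtrunc [simp]: "mtrunc n (mtrunc n X) = mtrunc n X"
  by (auto simp: mtrunc_def fun_eq_iff)

lemma mtrunc_less [simp]: "i < n \<Longrightarrow> j < n \<Longrightarrow> mtrunc n X i j = X i j"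
  by (simp add: mtrunc_def)

lemma mtrunc_ge [simp]: "\<not> (i < n \<and> j < n) \<Longrightarrow> mtrunc n X i j = 0"
  by (auto simp: mtrunc_def)

lemma amplify_less [simp]: "i < n \<Longrightarrow> j < n \<Longrightarrow> amplify n f X i j = f (X i j)"
  by (simp add: amplify_def)

lemma matricesI:
  assumes "\<And>i j. i < n \<Longrightarrow> j < n \<Longrightarrow> X i j \<in> vecs V"
  shows "mtrunc n X \<in> matrices n V"
  using assms by (simp add: matrices_def)

lemma matricesD: "X \<in> matrices n V \<Longrightarrow> i < n \<Longrightarrow> j < n \<Longrightarrow> X i j \<in> vecs V"
  by (simp add: matrices_def)

lemma div_less_mult: "r < N * n \<Longrightarrow> r div n < N" for r n N :: nat
  by (simp add: less_mult_imp_div_less)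

lemma mod_less_mult: "r < N * n \<Longrightarrow> r mod n < n" for r n N :: nat
  by (cases "n = 0") auto

text \<open>The scalars are completely isometric to their own dual. Amplifying the multiplications
  by the entries of \<open>M\<close> at a scalar matrix X gives the tensor product of X and
  \<open>M\<close>, which \<open>form_bounded_tensor\<close> bounds; the 1 by 1 matrix with entry 1
  attains the bound.\<close>

lemma op_dual_scalar_norm:
  assumes "1 \<le> k" "\<And>i j z. i < k \<Longrightarrow> j < k \<Longrightarrow> F i j z = M i j * z"
  shows "mnorm (op_dual scalar_space) k F = op_matrix_norm (*) k M"
proof -
  note bl = bounded_linear_mult_right
  let ?f = "\<lambda>x. mtrunc k (\<lambda>i j. F i j x)"
  let ?m = "op_matrix_norm (*) k M"
  have *: "mnorm (Mat k scalar_space) n (amplify n ?f X)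
      = op_matrix_norm (*) (n * k) (\<lambda>r s. X (r div k) (s div k) * M (r mod k) (s mod k))" for n X
    unfolding mnorm_Mat mnorm_scalar_space
    by (rule op_matrix_norm_cong) (simp add: div_less_mult mod_less_mult assms mult.commute)
  have up: "mnorm (Mat k scalar_space) n (amplify n ?f X) \<le> ?m"
    if "mnorm scalar_space n X \<le> 1" for n X
    unfolding * 
  proof (rule op_matrix_norm_le)
    have "form_bounded (*) {..<n} X 1"
      using that form_bounded_mono[OF form_bounded_op_matrix_norm[OF bl]] by simp
    then have "form_bounded (*) ({..<n} \<times> {..<k})
        (\<lambda>p q. X (fst p) (fst q) * M (snd p) (snd q)) (1 * ?m)"
      by (rule form_bounded_tensor[OF _ form_bounded_op_matrix_norm[OF bl]])
        (simp_all add: op_matrix_norm_nonneg[OF bl])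
    then show "form_bounded (*) {..<n * k}
        (\<lambda>r s. X (r div k) (s div k) * M (r mod k) (s mod k)) ?m"
      by (subst form_bounded_flatten[OF bl, where Z = "\<lambda>a b c d. X a b * M c d"]) simp
  qed (simp add: op_matrix_norm_nonneg[OF bl])
  have one: "mtrunc 1 (\<lambda>_ _. 1) \<in> matrices 1 scalar_space"
    by (rule matricesI) simp
  have one': "mnorm scalar_space 1 (mtrunc 1 (\<lambda>_ _. 1)) \<le> 1"
    unfolding mnorm_scalar_space by (rule op_matrix_norm_le) (simp_all add: form_bounded_iff_L2 lessThan_Suc)
  have "mnorm (Mat k scalar_space) 1 (amplify 1 ?f (mtrunc 1 (\<lambda>_ _. 1))) = ?m"
    unfolding * mult_1 by (rule op_matrix_norm_cong) (simp add: div_less)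
  then have "?m \<le> cb_norm scalar_space (Mat k scalar_space) ?f"
    using cb_norm_upper[OF up _ one one'] by simp
  moreover have "cb_norm scalar_space (Mat k scalar_space) ?f \<le> ?m"
    using cb_norm_least[OF one one'] up by blast
  ultimately show ?thesis by (simp add: op_dual_def cb_def)
qed

lemma vecs_op_dual_scalar: "vecs (op_dual scalar_space) = range (\<lambda>c z. c * z)"
proof (intro equalityI subsetI)
  fix f assume "f \<in> vecs (op_dual scalar_space)"
  then have "f (c *\<^sub>C 1) = c *\<^sub>C f 1" for c
    unfolding op_dual_def cb_def complex_linear_between_def by simp
  then have "f z = f 1 * z" for z
    by (metis mult.commute mult_1_right scaleC_complex_def)
  then have "f = (\<lambda>z. f 1 * z)" by blast
  then show "f \<in> range (\<lambda>c z. c * z)" by blast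
next
  fix f :: "complex \<Rightarrow> complex" assume "f \<in> range (\<lambda>c z. c * z)"
  then obtain c where f: "f = (\<lambda>z. c * z)" by auto
  note bl = bounded_linear_mult_right
  have "op_matrix_norm (*) n (amplify n f X) \<le> cmod c * op_matrix_norm (*) n X" for n X
  proof -
    have "op_matrix_norm (*) n (amplify n f X) = op_matrix_norm (*) n (\<lambda>i j. c * X i j)"
      by (rule op_matrix_norm_cong) (simp add: f)
    also have "\<dots> \<le> cmod c * op_matrix_norm (*) n X"
      by (intro op_matrix_norm_le form_bounded_scale form_bounded_op_matrix_norm bl)
        (simp add: op_matrix_norm_nonneg[OF bl])
    finally show ?thesis .
  qed
  then have "completely_bounded scalar_space scalar_space f"
    by (auto simp: completely_bounded_def)
  then show "f \<in> vecs (op_dual scalar_space)"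
    by (simp add: op_dual_def cb_def complex_linear_between_def extend_zero_def f
      scaleC_complex_def algebra_simps)
qed

lemma op_dual_scalar_apply: "f \<in> vecs (op_dual scalar_space) \<Longrightarrow> f z = f 1 * z"
  by (auto simp: vecs_op_dual_scalar)

lemma op_dual_scalar_norm':
  assumes "1 \<le> k" "\<And>i j. i < k \<Longrightarrow> j < k \<Longrightarrow> F i j \<in> vecs (op_dual scalar_space)"
  shows "mnorm (op_dual scalar_space) k F = op_matrix_norm (*) k (\<lambda>i j. F i j 1)"
  using assms by (intro op_dual_scalar_norm op_dual_scalar_apply)

section \<open>Bounded families\<close>

text \<open>Nonemptiness makes the suprema over the dual object genuine. Positive degrees permit
  division by the degree and make the degree an admissible matrix size.\<close>

locale nonempty_dual =
  fixes G :: "('g, 'm) monoid_scheme" and T :: "'g topology"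
  assumes dual_nonempty: "dual_object G T \<noteq> {}"
    and deg_pos: "\<pi> \<in> dual_object G T \<Longrightarrow> 0 < deg G \<pi>"
begin

abbreviation D where "D \<equiv> dual_object G T"

lemma Linf_entry:
  assumes "A \<in> vecs (Linf G T V)" "\<pi> \<in> D" "k < deg G \<pi>" "l < deg G \<pi>"
  shows "A \<pi> k l \<in> vecs V"
  using assms by (auto simp: Linf_def families_def matrices_def)

text \<open>Both kinds of bounded families are treated at once by representing the entries as
  operators through \<open>h\<close>: a functional on the scalars by its value at 1, acting by
  multiplication, and an element of an operator space by itself.\<close>

context
  fixes V :: "'v :: zero matnormed" and h :: "'v \<Rightarrow> 'a"
    and act :: "'a \<Rightarrow> 'h :: real_inner \<Rightarrow> 'h" and N :: nat
  assumes repr: "\<And>k F. 1 \<le> k \<Longrightarrow> (\<And>i j. i < k \<Longrightarrow> j < k \<Longrightarrow> F i j \<in> vecs V) \<Longrightarrow>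
      mnorm V k F = op_matrix_norm act k (\<lambda>i j. h (F i j))"
    and lin: "\<And>a. bounded_linear (act a)"
    and N: "1 \<le> N"
begin

lemma Linf_mnorm:
  assumes "X \<in> matrices N (Linf G T V)"
  shows "mnorm (Linf G T V) N X = (SUP \<pi>\<in>D. op_matrix_norm act (deg G \<pi> * N)
    (\<lambda>r s. h (X (r mod N) (s mod N) \<pi> (r div N) (s div N))))"
proof -
  have "mnorm (Mat N V) (deg G \<pi>) (\<lambda>k l. mtrunc N (\<lambda>i j. X i j \<pi> k l))
    = op_matrix_norm act (deg G \<pi> * N) (\<lambda>r s. h (X (r mod N) (s mod N) \<pi> (r div N) (s div N)))"
    if "\<pi> \<in> D" for \<pi>
  proof -
    have e: "X (r mod N) (s mod N) \<pi> (r div N) (s div N) \<in> vecs V"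
      if "r < deg G \<pi> * N" "s < deg G \<pi> * N" for r s
      by (rule Linf_entry[OF matricesD[OF assms] \<open>\<pi> \<in> D\<close>])
        (use that in \<open>simp_all add: div_less_mult mod_less_mult\<close>)
    have "1 \<le> deg G \<pi> * N" using deg_pos[OF that] N by simp
    then show ?thesis
      unfolding mnorm_Mat using e
      by (subst repr) (auto simp: mod_less_mult intro!: op_matrix_norm_cong)
  qed
  then show ?thesis by (simp add: Linf_def)
qed

lemma Linf_mnorm_le:
  assumes "X \<in> matrices N (Linf G T V)" "0 \<le> C"
    and "\<And>\<pi>. \<pi> \<in> D \<Longrightarrow> form_bounded act ({..<deg G \<pi>} \<times> {..<N})
       (\<lambda>a b. h (X (snd a) (snd b) \<pi> (fst a) (fst b))) C"
  shows "mnorm (Linf G T V) N X \<le> C"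
  unfolding Linf_mnorm[OF assms(1)] using assms(2,3)
  by (intro cSUP_least dual_nonempty op_matrix_norm_le)
    (auto simp: form_bounded_flatten[OF lin, where Z = "\<lambda>k l i j. h (X i j _ k l)"])

text \<open>The N by N entries of \<open>X\<close> are bounded families. Adding their bounds
  blockwise bounds the supremum over the dual object, and only then does the supremum dominate each
  component.\<close>

lemma
  assumes X: "X \<in> matrices N (Linf G T V)"
  shows Linf_form_bounded: "\<And>\<pi>. \<pi> \<in> D \<Longrightarrow> form_bounded act ({..<deg G \<pi>} \<times> {..<N})
       (\<lambda>a b. h (X (snd a) (snd b) \<pi> (fst a) (fst b))) (mnorm (Linf G T V) N X)"
    and Linf_mnorm_nonneg: "0 \<le> mnorm (Linf G T V) N X"
proof -
  let ?o = "\<lambda>\<pi>. op_matrix_norm act (deg G \<pi> * N)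
    (\<lambda>r s. h (X (r mod N) (s mod N) \<pi> (r div N) (s div N)))"
  have "\<exists>K\<ge>0. \<forall>\<pi>\<in>D. form_bounded act {..<deg G \<pi>} (\<lambda>k l. h (X u v \<pi> k l)) K"
    if uv: "u < N" "v < N" for u v
  proof -
    have Xuv: "X u v \<in> vecs (Linf G T V)" using X uv by (simp add: matricesD)
    then obtain K where K: "\<And>\<pi>. \<pi> \<in> D \<Longrightarrow> mnorm V (deg G \<pi>) (X u v \<pi>) \<le> K"
      by (auto simp: Linf_def bdd_above_def)
    have "form_bounded act {..<deg G \<pi>} (\<lambda>k l. h (X u v \<pi> k l)) (max K 0)" if \<pi>: "\<pi> \<in> D" for \<pi>
    proof (rule form_bounded_mono[OF form_bounded_op_matrix_norm[OF lin]])
      have "op_matrix_norm act (deg G \<pi>) (\<lambda>k l. h (X u v \<pi> k l)) = mnorm V (deg G \<pi>) (X u v \<pi>)"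
        using Linf_entry[OF Xuv \<pi>] deg_pos[OF \<pi>] by (subst repr) auto
      then show "op_matrix_norm act (deg G \<pi>) (\<lambda>k l. h (X u v \<pi> k l)) \<le> max K 0"
        using K[OF \<pi>] by simp
    qed
    then show ?thesis by (intro exI[of _ "max K 0"]) auto
  qed
  then obtain K where K: "\<And>u v. u < N \<Longrightarrow> v < N \<Longrightarrow> 0 \<le> K u v"
      "\<And>u v \<pi>. u < N \<Longrightarrow> v < N \<Longrightarrow> \<pi> \<in> D \<Longrightarrow>
        form_bounded act {..<deg G \<pi>} (\<lambda>k l. h (X u v \<pi> k l)) (K u v)"
    by metis
  have "?o \<pi> \<le> (\<Sum>u<N. \<Sum>v<N. K u v)" if "\<pi> \<in> D" for \<pi>
  proof (rule op_matrix_norm_le)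
    have "form_bounded act ({..<deg G \<pi>} \<times> {..<N})
       (\<lambda>a b. h (X (snd a) (snd b) \<pi> (fst a) (fst b))) (\<Sum>u<N. \<Sum>v<N. K u v)"
      using K that by (intro form_bounded_blocks) auto
    then show "form_bounded act {..<deg G \<pi> * N}
      (\<lambda>r s. h (X (r mod N) (s mod N) \<pi> (r div N) (s div N))) (\<Sum>u<N. \<Sum>v<N. K u v)"
      by (simp add: form_bounded_flatten[OF lin, where Z = "\<lambda>k l i j. h (X i j \<pi> k l)"])
  qed (use K in \<open>auto intro!: sum_nonneg\<close>)
  then have bdd: "bdd_above (?o ` D)" by (auto intro!: bdd_aboveI[of _ "\<Sum>u<N. \<Sum>v<N. K u v"])
  have le: "?o \<pi> \<le> mnorm (Linf G T V) N X" if "\<pi> \<in> D" for \<pi>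
    unfolding Linf_mnorm[OF X] by (rule cSUP_upper[OF that bdd])
  show "form_bounded act ({..<deg G \<pi>} \<times> {..<N})
       (\<lambda>a b. h (X (snd a) (snd b) \<pi> (fst a) (fst b))) (mnorm (Linf G T V) N X)" if "\<pi> \<in> D" for \<pi>
    using form_bounded_mono[OF form_bounded_op_matrix_norm[OF lin] le[OF that]]
    by (simp add: form_bounded_flatten[OF lin, where Z = "\<lambda>k l i j. h (X i j \<pi> k l)"])
  obtain \<pi> where "\<pi> \<in> D" using dual_nonempty by blast
  show "0 \<le> mnorm (Linf G T V) N X"
    by (rule order_trans[OF op_matrix_norm_nonneg[OF lin] le[OF \<open>\<pi> \<in> D\<close>]])
qed

end

end

section \<open>The trace class norm and the space L1\<close>

lemma form_bounded_swap:
  assumes "form_bounded act (I \<times> J) (\<lambda>a b. X (fst a) (fst b) (snd a) (snd b)) C"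
    "\<And>a. bounded_linear (act a)" "finite I" "finite J"
  shows "form_bounded act (J \<times> I) (\<lambda>a b. X (snd a) (snd b) (fst a) (fst b)) C"
proof (rule form_bounded_reindex[OF assms(1,2)])
  show "bij_betw prod.swap (J \<times> I) (I \<times> J)"
    by (intro bij_betwI[where g = prod.swap]) auto
qed (use assms in auto)

lemma form_bounded_zero: "0 \<le> C \<Longrightarrow> form_bounded (*) I (\<lambda>_ _. 0 :: complex) C"
  by (simp add: form_bounded_def)

lemma form_bounded_block:
  assumes "form_bounded act (I \<times> P) (\<lambda>a b. X (snd a) (snd b) (fst a) (fst b)) C"
    "\<And>a. bounded_linear (act a)" "finite I" "finite P" "u \<in> P" "v \<in> P"
  shows "form_bounded act I (\<lambda>i j. X u v i j) C"
  using form_bounded_select[OF assms(1,2), of "\<lambda>i. (i, u)" I "\<lambda>i. (i, v)"] assms(3-)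
  by (auto simp: inj_on_def)

text \<open>Dividing by \<open>C + e\<close> instead of \<open>C\<close> covers the case
  \<open>C = 0\<close>. Multiplying back leaves the excess \<open>e * S\<close>, which vanishes with
  e.\<close>

lemma form_bounded_rescale:
  fixes Z :: "'i \<Rightarrow> 'i \<Rightarrow> complex"
  assumes "0 \<le> C" "\<And>e. 0 < e \<Longrightarrow> form_bounded (*) I (\<lambda>i j. complex_of_real (1 / (C + e)) * Z i j) S"
  shows "form_bounded (*) I Z (S * C)"
proof (rule form_bounded_of_greater)
  fix e :: real assume e: "0 < e"
  then have nz: "C + e \<noteq> 0" using \<open>0 \<le> C\<close> by linarith
  have "form_bounded (*) I (\<lambda>i j. complex_of_real (C + e) * (complex_of_real (1 / (C + e)) * Z i j))
      (cmod (complex_of_real (C + e)) * S)"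
    using assms(2)[OF e] by (rule form_bounded_scale)
  moreover have "complex_of_real (C + e) * (complex_of_real (1 / (C + e)) * z) = z" for z
    unfolding mult.assoc[symmetric] of_real_mult[symmetric] using nz by simp
  moreover have "cmod (complex_of_real (C + e)) * S = S * C + e * S"
    unfolding norm_of_real using e \<open>0 \<le> C\<close> by (simp add: algebra_simps)
  ultimately show "form_bounded (*) I Z (S * C + e * S)" by simp
qed

lemma form_bounded_normalize:
  fixes Z :: "'i \<Rightarrow> 'i \<Rightarrow> complex"
  assumes "form_bounded (*) I Z C" "0 \<le> C" "0 < e"
  shows "form_bounded (*) I (\<lambda>i j. complex_of_real (1 / (C + e)) * Z i j) 1"
proof (rule form_bounded_mono[OF form_bounded_scale[OF assms(1)]])
  show "cmod (complex_of_real (1 / (C + e))) * C \<le> 1"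
    unfolding norm_of_real using assms(2,3) by simp
qed

section \<open>The trace class norm as a completely bounded norm\<close>

context
  fixes d :: nat and B :: "nat \<Rightarrow> nat \<Rightarrow> complex"
begin

text \<open>The triangle inequality over the entries of \<open>B\<close>. It makes the supremum in
  \<open>schatten1_norm\<close> finite.\<close>

lemma schatten1_crude:
  fixes y :: "'p \<Rightarrow> 'p \<Rightarrow> nat \<Rightarrow> nat \<Rightarrow> complex"
  assumes "finite P" "form_bounded (*) ({..<d} \<times> P) (\<lambda>a b. y (snd a) (snd b) (fst a) (fst b)) 1"
  shows "form_bounded (*) P (\<lambda>u v. \<Sum>k<d. \<Sum>l<d. y u v k l * B l k)
     (\<Sum>k<d. \<Sum>l<d. cmod (B l k) * 1)"
proof (intro form_bounded_sum)
  fix k l assume kl: "k \<in> {..<d}" "l \<in> {..<d}"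
  have "form_bounded (*) P (\<lambda>u v. y u v k l) 1"
    using form_bounded_select[OF assms(2) bounded_linear_mult_right, of "Pair k" P "Pair l"] assms(1) kl
    by (auto simp: inj_on_def)
  then show "form_bounded (*) P (\<lambda>u v. y u v k l * B l k) (cmod (B l k) * 1)"
    using form_bounded_scale[of P "\<lambda>u v. y u v k l" 1 "B l k"] by (simp add: mult.commute)
qed

text \<open>Translates from the layout of \<open>Mat\<close>, where the index of the trace is
  innermost, to the layout used in the estimates, where it comes first.\<close>

lemma schatten1_amplify:
  assumes "1 \<le> n" "X \<in> matrices n (Mat d scalar_space)" "mnorm (Mat d scalar_space) n X \<le> 1"
    and K: "0 \<le> K"
    "form_bounded (*) ({..<d} \<times> {..<n}) (\<lambda>a b. X (snd a) (snd b) (fst a) (fst b)) 1 \<Longrightarrow>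
        form_bounded (*) {..<n} (\<lambda>u v. \<Sum>k<d. \<Sum>l<d. X u v k l * B l k) K"
  shows "mnorm scalar_space n (amplify n (\<lambda>A. mtrace (*) d A B) X) \<le> K"
proof -
  note bl = bounded_linear_mult_right
  have "form_bounded (*) {..<n * d} (\<lambda>r s. X (r div d) (s div d) (r mod d) (s mod d)) 1"
    using assms(3) unfolding mnorm_Mat mnorm_scalar_space
    by (rule form_bounded_mono[OF form_bounded_op_matrix_norm[OF bl]])
  then have "form_bounded (*) ({..<d} \<times> {..<n}) (\<lambda>a b. X (snd a) (snd b) (fst a) (fst b)) 1"
    unfolding form_bounded_flatten[OF bl, where Z = X]
    by (rule form_bounded_swap[OF _ bl, where X = X]) auto
  then have f: "form_bounded (*) {..<n} (\<lambda>u v. \<Sum>k<d. \<Sum>l<d. X u v k l * B l k) K" by (rule K)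
  have "mnorm scalar_space n (amplify n (\<lambda>A. mtrace (*) d A B) X)
     = op_matrix_norm (*) n (\<lambda>u v. \<Sum>k<d. \<Sum>l<d. X u v k l * B l k)"
    unfolding mnorm_scalar_space by (rule op_matrix_norm_cong) (simp add: mtrace_def)
  also have "\<dots> \<le> K" by (rule op_matrix_norm_le[OF f K(1)])
  finally show ?thesis .
qed

text \<open>The converse translation: an array with form bound 1 becomes an element of the unit ball
  over which the supremum runs.\<close>

lemma schatten1_test_matrix:
  assumes "form_bounded (*) ({..<d} \<times> {..<n}) (\<lambda>a b. y (snd a) (snd b) (fst a) (fst b)) 1"
  defines "X \<equiv> mtrunc n (\<lambda>u v. mtrunc d (y u v))"
  shows "X \<in> matrices n (Mat d scalar_space)" "mnorm (Mat d scalar_space) n X \<le> 1"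
proof -
  note bl = bounded_linear_mult_right
  show "X \<in> matrices n (Mat d scalar_space)"
    unfolding X_def by (intro matricesI) (simp add: Mat_def matricesI)
  have "form_bounded (*) ({..<n} \<times> {..<d}) (\<lambda>a b. y (fst a) (fst b) (snd a) (snd b)) 1"
    using assms(1)
    by (rule form_bounded_swap[OF _ bl, where X = "\<lambda>k l u v. y u v k l"]) auto
  then have *: "form_bounded (*) {..<n * d} (\<lambda>r s. y (r div d) (s div d) (r mod d) (s mod d)) 1"
    unfolding form_bounded_flatten[OF bl, where Z = y] .
  have "mnorm (Mat d scalar_space) n X
      = op_matrix_norm (*) (n * d) (\<lambda>r s. y (r div d) (s div d) (r mod d) (s mod d))"
    unfolding mnorm_Mat mnorm_scalar_space X_def
    by (rule op_matrix_norm_cong) (simp add: div_less_mult mod_less_mult)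
  also have "\<dots> \<le> 1" using * by (rule op_matrix_norm_le) simp
  finally show "mnorm (Mat d scalar_space) n X \<le> 1" .
qed

lemma schatten1_norm_le:
  assumes "0 \<le> K" "\<And>(n::nat) y. 1 \<le> n \<Longrightarrow>
      form_bounded (*) ({..<d} \<times> {..<n}) (\<lambda>a b. y (snd a) (snd b) (fst a) (fst b)) 1 \<Longrightarrow>
      form_bounded (*) {..<n} (\<lambda>u v. \<Sum>k<d. \<Sum>l<d. y u v k l * B l k) K"
  shows "schatten1_norm d B \<le> K"
  unfolding schatten1_norm_def
proof (rule cb_norm_least)
  have "form_bounded (*) ({..<d} \<times> {..<1}) (\<lambda>a b. 0 :: complex) 1"
    by (rule form_bounded_zero) simp
  from schatten1_test_matrix[where y = "\<lambda>_ _ _ _. 0", OF this]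
  show "mtrunc 1 (\<lambda>u v. mtrunc d (\<lambda>_ _. 0)) \<in> matrices 1 (Mat d scalar_space)"
    "mnorm (Mat d scalar_space) 1 (mtrunc 1 (\<lambda>u v. mtrunc d (\<lambda>_ _. 0))) \<le> 1" by auto
next
  fix n X assume a: "1 \<le> n" "X \<in> matrices n (Mat d scalar_space)"
    "mnorm (Mat d scalar_space) n X \<le> 1"
  show "mnorm scalar_space n (amplify n (\<lambda>A. mtrace (*) d A B) X) \<le> K"
    by (rule schatten1_amplify[OF a assms(1) assms(2)[OF a(1)]])
qed

lemma schatten1_test_le:
  assumes "1 \<le> n"
    and "form_bounded (*) ({..<d} \<times> {..<n}) (\<lambda>a b. y (snd a) (snd b) (fst a) (fst b)) 1"
  shows "op_matrix_norm (*) n (\<lambda>u v. \<Sum>k<d. \<Sum>l<d. y u v k l * B l k) \<le> schatten1_norm d B"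
proof -
  define X where "X = mtrunc n (\<lambda>u v. mtrunc d (y u v))"
  note X = schatten1_test_matrix[OF assms(2), folded X_def]
  have "op_matrix_norm (*) n (\<lambda>u v. \<Sum>k<d. \<Sum>l<d. y u v k l * B l k)
      = mnorm scalar_space n (amplify n (\<lambda>A. mtrace (*) d A B) X)"
    unfolding mnorm_scalar_space by (rule op_matrix_norm_cong) (simp add: X_def mtrace_def)
  also have "\<dots> \<le> schatten1_norm d B"
    unfolding schatten1_norm_def
  proof (rule cb_norm_upper[OF _ assms(1) X])
    fix n X assume a: "1 \<le> n" "X \<in> matrices n (Mat d scalar_space)"
      "mnorm (Mat d scalar_space) n X \<le> 1"
    show "mnorm scalar_space n (amplify n (\<lambda>A. mtrace (*) d A B) X)
        \<le> (\<Sum>k<d. \<Sum>l<d. cmod (B l k) * 1)"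
      by (rule schatten1_amplify[OF a _ schatten1_crude]) (auto intro!: sum_nonneg)
  qed
  finally show ?thesis .
qed

lemma schatten1_norm_nonneg [simp]: "0 \<le> schatten1_norm d B"
proof -
  have "0 \<le> op_matrix_norm (*) 1 (\<lambda>u v. \<Sum>k<d. \<Sum>l<d. 0 * B l k)"
    by (rule op_matrix_norm_nonneg) (rule bounded_linear_mult_right)
  also have "\<dots> \<le> schatten1_norm d B"
    by (rule schatten1_test_le[where y = "\<lambda>_ _ _ _. 0"]) (simp_all add: form_bounded_zero)
  finally show ?thesis .
qed

text \<open>Since the trace class norm is a completely bounded norm, pairing with \<open>B\<close>
  costs the same constant over every finite index set. Homogeneity reduces to bound 1 and an
  enumeration of \<open>P\<close> to an initial segment of the naturals. The empty set is separate
  because the supremum runs over sizes at least 1.\<close>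

lemma schatten1_form_bounded:
  fixes y :: "'p \<Rightarrow> 'p \<Rightarrow> nat \<Rightarrow> nat \<Rightarrow> complex"
  assumes P: "finite P" and C: "0 \<le> C"
    and y: "form_bounded (*) ({..<d} \<times> P) (\<lambda>a b. y (snd a) (snd b) (fst a) (fst b)) C"
  shows "form_bounded (*) P (\<lambda>u v. \<Sum>k<d. \<Sum>l<d. y u v k l * B l k) (schatten1_norm d B * C)"
proof (cases "P = {}")
  case False
  note bl = bounded_linear_mult_right
  show ?thesis
  proof (rule form_bounded_rescale[OF C])
    fix e :: real assume e: "0 < e"
    let ?c = "complex_of_real (1 / (C + e))"
    obtain g where g: "bij_betw g {..<card P} P"
      using ex_bij_betw_nat_finite[OF P] by (auto simp: atLeast0LessThan)
    have 1: "form_bounded (*) ({..<d} \<times> P) (\<lambda>a b. ?c * y (snd a) (snd b) (fst a) (fst b)) 1"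
      by (rule form_bounded_normalize[OF y C e])
    have "form_bounded (*) ({..<d} \<times> {..<card P})
        (\<lambda>a b. ?c * y (g (snd a)) (g (snd b)) (fst a) (fst b)) 1"
    proof (rule form_bounded_reindex[OF 1 bl])
      show "bij_betw (map_prod id g) ({..<d} \<times> {..<card P}) ({..<d} \<times> P)"
        by (intro bij_betw_map_prod bij_betw_id g)
    qed (use P in auto)
    then have "op_matrix_norm (*) (card P) (\<lambda>u v. \<Sum>k<d. \<Sum>l<d. ?c * y (g u) (g v) k l * B l k)
        \<le> schatten1_norm d B"
      using False P by (intro schatten1_test_le[where y = "\<lambda>u v k l. ?c * y (g u) (g v) k l"])
        (auto simp: Suc_le_eq card_gt_0_iff)
    then have 2: "form_bounded (*) {..<card P} (\<lambda>u v. \<Sum>k<d. \<Sum>l<d. ?c * y (g u) (g v) k l * B l k)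
        (schatten1_norm d B)"
      by (rule form_bounded_mono[OF form_bounded_op_matrix_norm[OF bl]])
    show "form_bounded (*) P (\<lambda>u v. ?c * (\<Sum>k<d. \<Sum>l<d. y u v k l * B l k)) (schatten1_norm d B)"
    proof (rule form_bounded_reindex[OF 2 bl])
      show "bij_betw (the_inv_into {..<card P} g) P {..<card P}"
        by (rule bij_betw_the_inv_into[OF g])
      fix u v assume "u \<in> P" "v \<in> P"
      then have "g (the_inv_into {..<card P} g u) = u" "g (the_inv_into {..<card P} g v) = v"
        using f_the_inv_into_f_bij_betw[OF g] by auto
      then show "?c * (\<Sum>k<d. \<Sum>l<d. y u v k l * B l k)
        = (\<Sum>k<d. \<Sum>l<d. ?c * y (g (the_inv_into {..<card P} g u)) (g (the_inv_into {..<card P} g v)) k l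
            * B l k)"
        by (simp only: sum_distrib_left mult.assoc)
    qed simp
  qed
qed (simp add: form_bounded_def)

end

lemma schatten1_norm_add:
  "schatten1_norm d (B + B') \<le> schatten1_norm d B + schatten1_norm d B'"
proof (rule schatten1_norm_le)
  fix n :: nat and y :: "nat \<Rightarrow> nat \<Rightarrow> nat \<Rightarrow> nat \<Rightarrow> complex"
  assume "form_bounded (*) ({..<d} \<times> {..<n}) (\<lambda>a b. y (snd a) (snd b) (fst a) (fst b)) 1"
  then have "form_bounded (*) {..<n} (\<lambda>u v. \<Sum>k<d. \<Sum>l<d. y u v k l * X l k) (schatten1_norm d X * 1)"
    for X by (intro schatten1_form_bounded) auto
  then have "form_bounded (*) {..<n} (\<lambda>u v. (\<Sum>k<d. \<Sum>l<d. y u v k l * B l k) +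
      (\<Sum>k<d. \<Sum>l<d. y u v k l * B' l k)) (schatten1_norm d B + schatten1_norm d B')"
    \<comment> \<open>The sum of two forms is taken as a sum over the two truth values.\<close>
    using form_bounded_sum[of "{True, False}" "{..<n}" "\<lambda>s u v. \<Sum>k<d. \<Sum>l<d. y u v k l * (if s then B else B') l k"
       "\<lambda>s. schatten1_norm d (if s then B else B')"]
    by simp
  then show "form_bounded (*) {..<n} (\<lambda>u v. \<Sum>k<d. \<Sum>l<d. y u v k l * (B + B') l k)
     (schatten1_norm d B + schatten1_norm d B')"
    by (simp add: distrib_left sum.distrib)
qed simp

lemma schatten1_norm_scale:
  "schatten1_norm d (c *\<^sub>C B) \<le> cmod c * schatten1_norm d B"
proof (rule schatten1_norm_le)
  fix n :: nat and y :: "nat \<Rightarrow> nat \<Rightarrow> nat \<Rightarrow> nat \<Rightarrow> complex"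
  assume "form_bounded (*) ({..<d} \<times> {..<n}) (\<lambda>a b. y (snd a) (snd b) (fst a) (fst b)) 1"
  then have "form_bounded (*) {..<n} (\<lambda>u v. \<Sum>k<d. \<Sum>l<d. y u v k l * B l k) (schatten1_norm d B * 1)"
    by (intro schatten1_form_bounded) auto
  from form_bounded_scale[OF this, of c]
  show "form_bounded (*) {..<n} (\<lambda>u v. \<Sum>k<d. \<Sum>l<d. y u v k l * (c *\<^sub>C B) l k)
     (cmod c * schatten1_norm d B)"
    by (simp add: sum_distrib_left scaleC_fun_def scaleC_complex_def mult_ac)
qed simp

lemma schatten1_norm_zero [simp]: "schatten1_norm d 0 = 0"
proof -
  have "0 *\<^sub>C (0 :: nat \<Rightarrow> nat \<Rightarrow> complex) = 0"
    by (simp add: scaleC_fun_def scaleC_complex_def zero_fun_def)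
  then show ?thesis
    using schatten1_norm_scale[of d 0 0] schatten1_norm_nonneg[of d 0] by simp
qed

lemma mtrunc_add: "mtrunc n (X + Y) = mtrunc n X + mtrunc n (Y :: _ \<Rightarrow> _ \<Rightarrow> _ :: comm_monoid_add)"
  by (auto simp: mtrunc_def fun_eq_iff)

lemma scaleC_zero [simp]: "c *\<^sub>C 0 = (0 :: _ :: complex_vector)"
  by (metis add_cancel_right_right add_0 scaleC_add_right)

lemma mtrunc_scaleC: "mtrunc n (c *\<^sub>C X) = c *\<^sub>C mtrunc n (X :: _ \<Rightarrow> _ \<Rightarrow> _ :: complex_vector)"
  by (auto simp: mtrunc_def fun_eq_iff scaleC_fun_def)

section \<open>The scalar L1 space: linear structure, pairing and matrix norms\<close>

context nonempty_dual
begin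

lemma L1_iff:
  "B \<in> vecs (L1 G T) \<longleftrightarrow> (\<forall>\<pi>\<in>D. mtrunc (deg G \<pi>) (B \<pi>) = B \<pi>) \<and> (\<forall>\<pi>. \<pi> \<notin> D \<longrightarrow> B \<pi> = 0) \<and>
     (\<lambda>\<pi>. real (deg G \<pi>) * schatten1_norm (deg G \<pi>) (B \<pi>)) summable_on D"
  by (auto simp: L1_def families_def matrices_def extend_zero_def fun_eq_iff)

lemma L1_add:
  assumes "B \<in> vecs (L1 G T)" "B' \<in> vecs (L1 G T)"
  shows "B + B' \<in> vecs (L1 G T)"
proof -
  have "(\<lambda>\<pi>. real (deg G \<pi>) * schatten1_norm (deg G \<pi>) ((B + B') \<pi>)) summable_on D"
  proof (rule summable_on_comparison_test)
    show "(\<lambda>\<pi>. real (deg G \<pi>) * schatten1_norm (deg G \<pi>) (B \<pi>)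
       + real (deg G \<pi>) * schatten1_norm (deg G \<pi>) (B' \<pi>)) summable_on D"
      using assms by (intro summable_on_add) (auto simp: L1_iff)
  qed (simp_all add: distrib_left[symmetric] mult_left_mono schatten1_norm_add)
  then show ?thesis
    using assms by (simp add: L1_iff mtrunc_add)
qed

lemma L1_scale:
  assumes "B \<in> vecs (L1 G T)"
  shows "c *\<^sub>C B \<in> vecs (L1 G T)"
proof -
  have "(\<lambda>\<pi>. real (deg G \<pi>) * schatten1_norm (deg G \<pi>) ((c *\<^sub>C B) \<pi>)) summable_on D"
  proof (rule summable_on_comparison_test)
    show "(\<lambda>\<pi>. cmod c * (real (deg G \<pi>) * schatten1_norm (deg G \<pi>) (B \<pi>))) summable_on D"
      using assms by (intro summable_on_cmult_right) (auto simp: L1_iff)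
    show "real (deg G \<pi>) * schatten1_norm (deg G \<pi>) ((c *\<^sub>C B) \<pi>)
       \<le> cmod c * (real (deg G \<pi>) * schatten1_norm (deg G \<pi>) (B \<pi>))" for \<pi>
      using mult_left_mono[OF schatten1_norm_scale[of "deg G \<pi>" c "B \<pi>"], of "real (deg G \<pi>)"]
      by (simp add: scaleC_fun_def[of c B] mult_ac)
  qed simp
  then show ?thesis
    using assms by (simp add: L1_iff mtrunc_scaleC scaleC_fun_def[of c B])
qed

text \<open>The norm as a weighted sum, whereas \<open>mnorm\<close> of \<open>L1\<close> comes from
  the embedding. The two are compared in \<open>L1_single_mnorm_le\<close>.\<close>

definition L1sum :: "('g rep_class \<Rightarrow> nat \<Rightarrow> nat \<Rightarrow> complex) \<Rightarrow> real" where
  "L1sum B = (\<Sum>\<^sub>\<infinity>\<pi>\<in>D. real (deg G \<pi>) * schatten1_norm (deg G \<pi>) (B \<pi>))"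

lemma L1sum_nonneg: "0 \<le> L1sum B"
  unfolding L1sum_def by (rule infsum_nonneg) simp

definition dual_pair ::
    "('g rep_class \<Rightarrow> nat \<Rightarrow> nat \<Rightarrow> complex) \<Rightarrow> ('g rep_class \<Rightarrow> nat \<Rightarrow> nat \<Rightarrow> complex) \<Rightarrow> complex" where
  "dual_pair y B = (\<Sum>\<^sub>\<infinity>\<pi>\<in>D. of_nat (deg G \<pi>) * mtrace (*) (deg G \<pi>) (y \<pi>) (B \<pi>))"

lemma pair_term_form_bounded:
  assumes "finite P" "0 \<le> C"
    "form_bounded (*) ({..<d} \<times> P) (\<lambda>a b. y (snd a) (snd b) (fst a) (fst b)) C"
  shows "form_bounded (*) P (\<lambda>u v. of_nat d * mtrace (*) d (y u v) B)
    (real d * schatten1_norm d B * C)"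
  using form_bounded_scale[OF schatten1_form_bounded[where y = y and B = B, OF assms], of "of_nat d"]
  by (simp add: mtrace_def mult.assoc)

text \<open>Each class contributes at most its degree times the trace class norm times
  \<open>C\<close>, and these bounds are summable because \<open>B\<close> lies in L1.\<close>

lemma dual_pair_form_bounded:
  fixes y :: "'p \<Rightarrow> 'p \<Rightarrow> 'g rep_class \<Rightarrow> nat \<Rightarrow> nat \<Rightarrow> complex"
  assumes B: "B \<in> vecs (L1 G T)" and P: "finite P" and C: "0 \<le> C"
    and y: "\<And>\<pi>. \<pi> \<in> D \<Longrightarrow>
      form_bounded (*) ({..<deg G \<pi>} \<times> P) (\<lambda>a b. y (snd a) (snd b) \<pi> (fst a) (fst b)) C"
  shows "form_bounded (*) P (\<lambda>u v. dual_pair (y u v) B) (L1sum B * C)"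
proof -
  have 1: "(\<lambda>\<pi>. real (deg G \<pi>) * schatten1_norm (deg G \<pi>) (B \<pi>) * C) summable_on D"
    using B by (intro summable_on_cmult_left) (simp add: L1_iff)
  have 2: "form_bounded (*) P (\<lambda>u v. of_nat (deg G \<pi>) * mtrace (*) (deg G \<pi>) (y u v \<pi>) (B \<pi>))
    (real (deg G \<pi>) * schatten1_norm (deg G \<pi>) (B \<pi>) * C)" if "\<pi> \<in> D" for \<pi>
    by (rule pair_term_form_bounded[where y = "\<lambda>u v. y u v \<pi>", OF P C y[OF that]])
  show ?thesis
    unfolding dual_pair_def L1sum_def infsum_cmult_left'[symmetric]
    by (rule form_bounded_infsum[where
          X = "\<lambda>\<pi> u v. of_nat (deg G \<pi>) * mtrace (*) (deg G \<pi>) (y u v \<pi>) (B \<pi>)", OF 2 _ 1 P])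
      (simp_all add: C)
qed

abbreviation "Linf_dual \<equiv> Linf G T (op_dual scalar_space)"

lemmas Linf_dual_form_bounded =
  Linf_form_bounded[where V = "op_dual scalar_space" and h = "\<lambda>f. f 1" and act = "(*)",
    OF op_dual_scalar_norm' bounded_linear_mult_right]

lemmas Linf_dual_mnorm_le =
  Linf_mnorm_le[where V = "op_dual scalar_space" and h = "\<lambda>f. f 1" and act = "(*)",
    OF op_dual_scalar_norm' bounded_linear_mult_right]

text \<open>A functional on the scalars is multiplication by its value at 1, which turns the
  embedding into the scalar pairing.\<close>

lemma L1_embedding_eq:
  assumes "Y \<in> vecs Linf_dual"
  shows "L1_embedding G T B Y = dual_pair (\<lambda>\<pi> k l. Y \<pi> k l 1) B"
proof -
  have "pairing_term G (\<lambda>\<phi> z. \<phi> z) Y B \<pi>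
      = of_nat (deg G \<pi>) * mtrace (*) (deg G \<pi>) (\<lambda>k l. Y \<pi> k l 1) (B \<pi>)" if "\<pi> \<in> D" for \<pi>
  proof -
    have lin: "Y \<pi> k l z = Y \<pi> k l 1 * z" if "k < deg G \<pi>" "l < deg G \<pi>" for k l z
      using Linf_entry[where A = Y and k = k and l = l, OF assms \<open>\<pi> \<in> D\<close> that]
      by (rule op_dual_scalar_apply[where f = "Y \<pi> k l"])
    have "mtrace (\<lambda>\<phi> z. \<phi> z) (deg G \<pi>) (Y \<pi>) (B \<pi>)
        = mtrace (*) (deg G \<pi>) (\<lambda>k l. Y \<pi> k l 1) (B \<pi>)"
      unfolding mtrace_def by (intro sum.cong refl) (rule lin, auto)
    then show ?thesis
      by (simp add: pairing_term_def scaleC_complex_def)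
  qed
  then show ?thesis
    using assms by (simp add: L1_embedding_def extend_zero_def dual_pair_def cong: infsum_cong)
qed

text \<open>Uniformly bounded arrays of scalars are realized by matrices of bounded families of
  functionals. These are the test matrices for the norm of L1.\<close>

lemma Linf_dual_test:
  assumes N: "1 \<le> N" and C: "0 \<le> C"
    and y: "\<And>\<pi>. \<pi> \<in> D \<Longrightarrow>
      form_bounded (*) ({..<deg G \<pi>} \<times> {..<N}) (\<lambda>a b. y (snd a) (snd b) \<pi> (fst a) (fst b)) C"
  shows "\<exists>Y \<in> matrices N Linf_dual. mnorm Linf_dual N Y \<le> C \<and>
    (\<forall>u<N. \<forall>v<N. \<forall>\<pi>\<in>D. \<forall>k<deg G \<pi>. \<forall>l<deg G \<pi>. Y u v \<pi> k l 1 = y u v \<pi> k l)"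
proof -
  note bl = bounded_linear_mult_right
  define Z where "Z u v = extend_zero D (\<lambda>\<pi>. mtrunc (deg G \<pi>) (\<lambda>k l z. y u v \<pi> k l * z))" for u v
  have Z: "Z u v \<in> vecs Linf_dual" if uv: "u < N" "v < N" for u v
  proof -
    have "Z u v \<in> families G T (op_dual scalar_space)"
      by (auto simp: families_def Z_def extend_zero_def vecs_op_dual_scalar intro!: matricesI)
    moreover have "mnorm (op_dual scalar_space) (deg G \<pi>) (Z u v \<pi>) \<le> C" if "\<pi> \<in> D" for \<pi>
    proof -
      have "mnorm (op_dual scalar_space) (deg G \<pi>) (Z u v \<pi>) = op_matrix_norm (*) (deg G \<pi>) (y u v \<pi>)"
        using deg_pos[OF that] that by (intro op_dual_scalar_norm) (auto simp: Z_def extend_zero_def)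
      also have "\<dots> \<le> C"
        using form_bounded_block[OF y[OF that] bl] C uv by (intro op_matrix_norm_le) auto
      finally show ?thesis .
    qed
    ultimately show ?thesis by (auto simp: Linf_def intro!: bdd_aboveI[of _ C])
  qed
  have Y: "mtrunc N Z \<in> matrices N Linf_dual" by (rule matricesI) (rule Z)
  have e: "mtrunc N Z u v \<pi> k l 1 = y u v \<pi> k l"
    if "u < N" "v < N" "\<pi> \<in> D" "k < deg G \<pi>" "l < deg G \<pi>" for u v \<pi> k l
    using that by (simp add: Z_def extend_zero_def)
  have "mnorm Linf_dual N (mtrunc N Z) \<le> C"
  proof (rule Linf_dual_mnorm_le[OF _ _ N Y C])
    fix \<pi> assume \<pi>: "\<pi> \<in> D"
    show "form_bounded (*) ({..<deg G \<pi>} \<times> {..<N})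
        (\<lambda>a b. mtrunc N Z (snd a) (snd b) \<pi> (fst a) (fst b) 1) C"
      using y[OF \<pi>] \<pi> by (subst form_bounded_cong[OF e]) auto
  qed auto
  then show ?thesis using Y e by blast
qed

context
  fixes n :: nat and B :: "nat \<Rightarrow> nat \<Rightarrow> 'g rep_class \<Rightarrow> nat \<Rightarrow> nat \<Rightarrow> complex"
  assumes n: "1 \<le> n"
begin

lemma L1_amplify:
  assumes "Y \<in> matrices N Linf_dual"
  shows "mnorm (Mat n scalar_space) N (amplify N (\<lambda>x. mtrunc n (\<lambda>i j. L1_embedding G T (B i j) x)) Y)
    = op_matrix_norm (*) (N * n) (\<lambda>r s. dual_pair (\<lambda>\<pi> k l. Y (r div n) (s div n) \<pi> k l 1)
        (B (r mod n) (s mod n)))"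
  unfolding mnorm_Mat mnorm_scalar_space
  by (rule op_matrix_norm_cong)
    (simp add: div_less_mult mod_less_mult L1_embedding_eq matricesD[OF assms])

lemma L1_mnorm_eq:
  "mnorm (L1 G T) n B = cb_norm Linf_dual (Mat n scalar_space)
     (\<lambda>x. mtrunc n (\<lambda>i j. L1_embedding G T (B i j) x))"
  by (simp add: L1_def op_dual_def cb_def)

lemma L1_amplify_le:
  assumes K: "0 \<le> K" "\<And>(N::nat) y. 1 \<le> N \<Longrightarrow> (\<And>\<pi>. \<pi> \<in> D \<Longrightarrow>
      form_bounded (*) ({..<deg G \<pi>} \<times> {..<N}) (\<lambda>a b. y (snd a) (snd b) \<pi> (fst a) (fst b)) 1) \<Longrightarrow>
      form_bounded (*) ({..<N} \<times> {..<n}) (\<lambda>a b. dual_pair (y (fst a) (fst b)) (B (snd a) (snd b))) K"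
    and Y: "1 \<le> N" "Y \<in> matrices N Linf_dual" "mnorm Linf_dual N Y \<le> 1"
  shows "mnorm (Mat n scalar_space) N (amplify N (\<lambda>x. mtrunc n (\<lambda>i j. L1_embedding G T (B i j) x)) Y) \<le> K"
  unfolding L1_amplify[OF Y(2)]
proof (rule op_matrix_norm_le[OF _ K(1)])
  have "form_bounded (*) ({..<deg G \<pi>} \<times> {..<N}) (\<lambda>a b. Y (snd a) (snd b) \<pi> (fst a) (fst b) 1) 1"
    if "\<pi> \<in> D" for \<pi>
    by (rule form_bounded_mono[OF Linf_dual_form_bounded[OF _ _ Y(1,2) that] Y(3)]) auto
  from K(2)[where y = "\<lambda>u v \<pi> k l. Y u v \<pi> k l 1", OF Y(1) this]
  show "form_bounded (*) {..<N * n} (\<lambda>r s. dual_pair (\<lambda>\<pi> k l. Y (r div n) (s div n) \<pi> k l 1)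
        (B (r mod n) (s mod n))) K"
    by (subst form_bounded_flatten[where Z = "\<lambda>a b c d. dual_pair (\<lambda>\<pi> k l. Y a b \<pi> k l 1) (B c d)"])
      (simp_all add: bounded_linear_mult_right)
qed

lemma L1_mnorm_le:
  assumes "0 \<le> K" "\<And>(N::nat) y. 1 \<le> N \<Longrightarrow> (\<And>\<pi>. \<pi> \<in> D \<Longrightarrow>
      form_bounded (*) ({..<deg G \<pi>} \<times> {..<N}) (\<lambda>a b. y (snd a) (snd b) \<pi> (fst a) (fst b)) 1) \<Longrightarrow>
      form_bounded (*) ({..<N} \<times> {..<n}) (\<lambda>a b. dual_pair (y (fst a) (fst b)) (B (snd a) (snd b))) K"
  shows "mnorm (L1 G T) n B \<le> K"
proof -
  obtain Y where "Y \<in> matrices 1 Linf_dual" "mnorm Linf_dual 1 Y \<le> 1"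
    using Linf_dual_test[where y = "\<lambda>_ _ _ _ _. 0", OF order_refl zero_le_one
        form_bounded_zero[OF zero_le_one]] by (elim bexE conjE)
  then show ?thesis
    unfolding L1_mnorm_eq by (rule cb_norm_least) (rule L1_amplify_le[OF assms])
qed

text \<open>Adds the bounds of the individual entries of \<open>B\<close>. This makes the supremum
  defining the norm of L1 finite.\<close>

lemma L1_crude:
  fixes N :: nat
  assumes B: "\<And>p q. p < n \<Longrightarrow> q < n \<Longrightarrow> B p q \<in> vecs (L1 G T)"
    and y: "\<And>\<pi>. \<pi> \<in> D \<Longrightarrow>
      form_bounded (*) ({..<deg G \<pi>} \<times> {..<N}) (\<lambda>a b. y (snd a) (snd b) \<pi> (fst a) (fst b)) 1"
  shows "form_bounded (*) ({..<N} \<times> {..<n})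
    (\<lambda>a b. dual_pair (y (fst a) (fst b)) (B (snd a) (snd b))) (\<Sum>p<n. \<Sum>q<n. L1sum (B p q) * 1)"
proof (rule form_bounded_blocks)
  fix p q assume pq: "p \<in> {..<n}" "q \<in> {..<n}"
  have "form_bounded (*) {..<N} (\<lambda>u v. dual_pair (y u v) (B p q)) (L1sum (B p q) * 1)"
    using pq by (intro dual_pair_form_bounded[where y = y, OF B _ _ y]) auto
  then show "form_bounded (*) {..<N} (\<lambda>i j. dual_pair (y (fst (i, p)) (fst (j, q)))
      (B (snd (i, p)) (snd (j, q)))) (L1sum (B p q) * 1)"
    by simp
qed (simp_all add: L1sum_nonneg)

lemma L1_test_le:
  fixes N :: nat
  assumes B: "\<And>p q. p < n \<Longrightarrow> q < n \<Longrightarrow> B p q \<in> vecs (L1 G T)" and N: "1 \<le> N"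
    and y: "\<And>\<pi>. \<pi> \<in> D \<Longrightarrow>
      form_bounded (*) ({..<deg G \<pi>} \<times> {..<N}) (\<lambda>a b. y (snd a) (snd b) \<pi> (fst a) (fst b)) 1"
  shows "form_bounded (*) ({..<N} \<times> {..<n})
    (\<lambda>a b. dual_pair (y (fst a) (fst b)) (B (snd a) (snd b))) (mnorm (L1 G T) n B)"
    and "0 \<le> mnorm (L1 G T) n B"
proof -
  note bl = bounded_linear_mult_right
  let ?f = "\<lambda>x. mtrunc n (\<lambda>i j. L1_embedding G T (B i j) x)"
  obtain Y where Y: "Y \<in> matrices N Linf_dual" "mnorm Linf_dual N Y \<le> 1"
    "\<And>u v \<pi> k l. u < N \<Longrightarrow> v < N \<Longrightarrow> \<pi> \<in> D \<Longrightarrow> k < deg G \<pi> \<Longrightarrow> l < deg G \<pi> \<Longrightarrow>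
       Y u v \<pi> k l 1 = y u v \<pi> k l"
    using Linf_dual_test[where y = y, OF N zero_le_one y] by blast
  have "mnorm (Mat n scalar_space) N (amplify N ?f Y) \<le> mnorm (L1 G T) n B"
    unfolding L1_mnorm_eq
  proof (rule cb_norm_upper[OF _ N Y(1,2)])
    show "mnorm (Mat n scalar_space) N (amplify N ?f Y) \<le> (\<Sum>p<n. \<Sum>q<n. L1sum (B p q) * 1)"
      if "1 \<le> N" "Y \<in> matrices N Linf_dual" "mnorm Linf_dual N Y \<le> 1" for N Y
      using that by (intro L1_amplify_le L1_crude B)
        (auto intro!: sum_nonneg simp: L1sum_nonneg)
  qed
  then have le: "op_matrix_norm (*) (N * n) (\<lambda>r s. dual_pair (\<lambda>\<pi> k l. Y (r div n) (s div n) \<pi> k l 1)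
        (B (r mod n) (s mod n))) \<le> mnorm (L1 G T) n B"
    by (simp only: L1_amplify[OF Y(1)])
  show "0 \<le> mnorm (L1 G T) n B"
    by (rule order_trans[OF op_matrix_norm_nonneg[OF bl] le])
  have "form_bounded (*) {..<N * n} (\<lambda>r s. dual_pair (\<lambda>\<pi> k l. Y (r div n) (s div n) \<pi> k l 1)
        (B (r mod n) (s mod n))) (mnorm (L1 G T) n B)"
    by (rule form_bounded_mono[OF form_bounded_op_matrix_norm[OF bl] le])
  then have *: "form_bounded (*) ({..<N} \<times> {..<n}) (\<lambda>a b. dual_pair (\<lambda>\<pi> k l. Y (fst a) (fst b) \<pi> k l 1)
        (B (snd a) (snd b))) (mnorm (L1 G T) n B)"
    by (simp only: form_bounded_flatten[OF bl, where
        Z = "\<lambda>a b c d. dual_pair (\<lambda>\<pi> k l. Y a b \<pi> k l 1) (B c d)"])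
  have "dual_pair (\<lambda>\<pi> k l. Y u v \<pi> k l 1) X = dual_pair (y u v) X" if "u < N" "v < N" for u v X
    unfolding dual_pair_def mtrace_def using that Y(3)
    by (intro infsum_cong arg_cong2[where f = "(*)"] sum.cong) auto
  then show "form_bounded (*) ({..<N} \<times> {..<n})
    (\<lambda>a b. dual_pair (y (fst a) (fst b)) (B (snd a) (snd b))) (mnorm (L1 G T) n B)"
    by (intro form_bounded_cong[THEN iffD1, OF _ *]) auto
qed

lemma L1_mnorm_nonneg:
  assumes "\<And>p q. p < n \<Longrightarrow> q < n \<Longrightarrow> B p q \<in> vecs (L1 G T)"
  shows "0 \<le> mnorm (L1 G T) n B"
  by (rule L1_test_le(2)[OF assms, where N = 1 and y = "\<lambda>_ _ _ _ _. 0"])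
    (simp_all add: form_bounded_zero)

text \<open>The form in which the norm of L1 is applied. The constant does not depend on
  \<open>P\<close>, so \<open>P\<close> may combine matrix indices with coordinates in a Hilbert
  space. The passage to arbitrary \<open>P\<close> and \<open>C\<close> is as in
  \<open>schatten1_form_bounded\<close>.\<close>

lemma L1_form_bounded:
  fixes y :: "'p \<Rightarrow> 'p \<Rightarrow> 'g rep_class \<Rightarrow> nat \<Rightarrow> nat \<Rightarrow> complex"
  assumes B: "\<And>p q. p < n \<Longrightarrow> q < n \<Longrightarrow> B p q \<in> vecs (L1 G T)"
    and P: "finite P" and C: "0 \<le> C"
    and y: "\<And>\<pi>. \<pi> \<in> D \<Longrightarrow>
      form_bounded (*) ({..<deg G \<pi>} \<times> P) (\<lambda>a b. y (snd a) (snd b) \<pi> (fst a) (fst b)) C"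
  shows "form_bounded (*) (P \<times> {..<n})
    (\<lambda>a b. dual_pair (y (fst a) (fst b)) (B (snd a) (snd b))) (mnorm (L1 G T) n B * C)"
proof (cases "P = {}")
  case False
  note bl = bounded_linear_mult_right
  show ?thesis
  proof (rule form_bounded_rescale[OF C])
    fix e :: real assume e: "0 < e"
    let ?c = "complex_of_real (1 / (C + e))"
    obtain g where g: "bij_betw g {..<card P} P"
      using ex_bij_betw_nat_finite[OF P] by (auto simp: atLeast0LessThan)
    have 1: "form_bounded (*) ({..<deg G \<pi>} \<times> {..<card P})
        (\<lambda>a b. ?c * y (g (snd a)) (g (snd b)) \<pi> (fst a) (fst b)) 1" if "\<pi> \<in> D" for \<pi>
    proof (rule form_bounded_reindex[OF form_bounded_normalize[OF y[OF that] C e] bl])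
      show "bij_betw (map_prod id g) ({..<deg G \<pi>} \<times> {..<card P}) ({..<deg G \<pi>} \<times> P)"
        by (intro bij_betw_map_prod bij_betw_id g)
    qed (use P in auto)
    have 2: "form_bounded (*) ({..<card P} \<times> {..<n})
       (\<lambda>a b. dual_pair (\<lambda>\<pi> k l. ?c * y (g (fst a)) (g (fst b)) \<pi> k l) (B (snd a) (snd b)))
       (mnorm (L1 G T) n B)"
      using False P
      by (intro L1_test_le(1)[where y = "\<lambda>u v \<pi> k l. ?c * y (g u) (g v) \<pi> k l"] B 1)
        (auto simp: Suc_le_eq card_gt_0_iff)
    have c: "dual_pair (\<lambda>\<pi> k l. ?c * z \<pi> k l) X = ?c * dual_pair z X" for z X
      unfolding dual_pair_def mtrace_def
      by (simp only: infsum_cmult_right'[symmetric] sum_distrib_left mult_ac)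
    let ?i = "the_inv_into {..<card P} g"
    show "form_bounded (*) (P \<times> {..<n}) (\<lambda>a b. ?c * dual_pair (y (fst a) (fst b)) (B (snd a) (snd b)))
       (mnorm (L1 G T) n B)"
    proof (rule form_bounded_reindex[OF 2 bl])
      have "bij_betw ?i P {..<card P}"
        by (rule bij_betw_the_inv_into[OF g])
      then show "bij_betw (map_prod ?i id) (P \<times> {..<n}) ({..<card P} \<times> {..<n})"
        by (intro bij_betw_map_prod bij_betw_id)
      fix a b assume "a \<in> P \<times> {..<n}" "b \<in> P \<times> {..<n}"
      then have "g (?i (fst a)) = fst a" "g (?i (fst b)) = fst b"
        using f_the_inv_into_f_bij_betw[OF g] by auto
      then show "?c * dual_pair (y (fst a) (fst b)) (B (snd a) (snd b))
        = dual_pair (\<lambda>\<pi> k l. ?c * y (g (fst (map_prod ?i id a))) (g (fst (map_prod ?i id b))) \<pi> k l)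
            (B (snd (map_prod ?i id a)) (snd (map_prod ?i id b)))"
        by (simp only: c fst_map_prod snd_map_prod id_apply)
    qed simp
  qed
qed (simp add: form_bounded_def)

end

end

section \<open>Complex Hilbert spaces\<close>

lemma cinner_add_right: "cinner x (y + z) = cinner x y + cinner x (z :: 'a :: complex_hilbert)"
  by (metis cinner_add_left cinner_commute complex_cnj_add)

lemma cinner_scaleC_right: "cinner x (c *\<^sub>C y) = cnj c * cinner x (y :: 'a :: complex_hilbert)"
  by (metis cinner_commute cinner_scaleC_left complex_cnj_mult)

lemma cinner_zero_left [simp]: "cinner 0 (y :: 'a :: complex_hilbert) = 0"
  using cinner_add_left[of 0 0 y] by simp

lemma cinner_zero_right [simp]: "cinner y (0 :: 'a :: complex_hilbert) = 0"
  using cinner_add_right[of y 0 0] by simp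

lemma cinner_diff_left: "cinner (x - y) z = cinner x z - cinner y (z :: 'a :: complex_hilbert)"
  using cinner_add_left[of "x - y" y z] by simp

lemma cinner_sum_left: "cinner (sum f A) y = (\<Sum>a\<in>A. cinner (f a) (y :: 'a :: complex_hilbert))"
  by (induction A rule: infinite_finite_induct) (auto simp: cinner_add_left)

lemma cinner_sum_right: "cinner y (sum f A) = (\<Sum>a\<in>A. cinner (y :: 'a :: complex_hilbert) (f a))"
  by (induction A rule: infinite_finite_induct) (auto simp: cinner_add_right)

lemma cinner_self: "cinner x x = complex_of_real ((norm (x :: 'a :: complex_hilbert))\<^sup>2)"
proof -
  have "Im (cinner x x) = 0" using cinner_commute[of x x] by (simp add: complex_eq_iff)
  then show ?thesis
    by (simp add: complex_eq_iff Re_cinner power2_norm_eq_inner)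
qed

lemma scaleC_sum_right: "c *\<^sub>C sum f A = (\<Sum>a\<in>A. c *\<^sub>C (f a :: 'a :: complex_vector))"
  by (induction A rule: infinite_finite_induct) (auto simp: scaleC_add_right)

lemma scaleC_zero_left [simp]: "0 *\<^sub>C x = (0 :: 'a :: complex_vector)"
  using scaleC_add_left[of 0 0 x] by simp

text \<open>A scalar of modulus 1 rotates \<open>x\<close> so that the product becomes real and
  nonnegative; then the real Cauchy-Schwarz inequality applies.\<close>

lemma norm_cinner_le: "cmod (cinner x y) \<le> norm x * norm (y :: 'a :: complex_hilbert)"
proof (cases "cinner x y = 0")
  case False
  define c where "c = cnj (cinner x y) / cmod (cinner x y)"
  have "cinner (c *\<^sub>C x) y = complex_of_real (cmod (cinner x y))"
    using False by (simp add: c_def cinner_scaleC_left mult.commute[of "cnj _"]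
        complex_norm_square[symmetric] power2_eq_square)
  then have "cmod (cinner x y) = inner (c *\<^sub>C x) y"
    by (metis Re_cinner Re_complex_of_real)
  also have "\<dots> \<le> norm (c *\<^sub>C x) * norm y" by (rule norm_cauchy_schwarz)
  also have "norm (c *\<^sub>C x) = norm x" using False by (simp add: norm_scaleC c_def norm_divide)
  finally show ?thesis .
qed simp

lemma bounded_linear_cinner_left: "bounded_linear (\<lambda>x. cinner x (y :: 'a :: complex_hilbert))"
proof (rule bounded_linear_intro)
  show "cinner (r *\<^sub>R x) y = r *\<^sub>R cinner x y" for r x
    using cinner_scaleC_left[of "complex_of_real r" x y] by (simp add: scaleC_of_real scaleR_conv_of_real)
qed (rule cinner_add_left, rule norm_cinner_le)

text \<open>This makes the bounded operators a Banach space, in which absolutely summable families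
  are summable.\<close>

instance complex_hilbert \<subseteq> banach ..

lemma bounded_linear_scaleC_blinfun:
  "bounded_linear (\<lambda>S. c *\<^sub>C (S :: 'a :: real_normed_vector \<Rightarrow>\<^sub>L 'b :: complex_hilbert))"
proof (rule bounded_linear_intro)
  show "c *\<^sub>C (r *\<^sub>R S) = r *\<^sub>R (c *\<^sub>C S)" for r and S :: "'a \<Rightarrow>\<^sub>L 'b"
    by (rule blinfun_eqI)
      (simp only: scaleC_blinfun.rep_eq blinfun.scaleR_left scaleC_of_real[symmetric] scaleC_scaleC
        mult.commute)
  show "norm (c *\<^sub>C S) \<le> norm S * cmod c" for S :: "'a \<Rightarrow>\<^sub>L 'b"
    by (rule norm_blinfun_bound)
      (simp_all add: scaleC_blinfun.rep_eq norm_scaleC mult.commute[of _ "cmod c"] mult.assoc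
        mult_left_mono norm_blinfun)
qed (rule scaleC_add_right)

text \<open>The map from coefficients to vectors is a contraction, which is what a compression
  needs. Orthonormality would exclude the zero vectors that \<open>gram_schmidt\<close> may
  produce.\<close>

definition subframe :: "nat \<Rightarrow> (nat \<Rightarrow> 'a :: complex_hilbert) \<Rightarrow> bool" where
  "subframe N e \<longleftrightarrow>
     (\<forall>c. norm (\<Sum>a<N. c a *\<^sub>C e a) \<le> L2_set (\<lambda>a. cmod (c a)) {..<N})"

text \<open>Gram-Schmidt without discarding dependent vectors: those are replaced by zero.\<close>

lemma gram_schmidt:
  fixes v :: "nat \<Rightarrow> 'a :: complex_hilbert"
  shows "\<exists>e. (\<forall>a<n. \<forall>b<n. a \<noteq> b \<longrightarrow> cinner (e a) (e b) = 0) \<and> (\<forall>a<n. e a = 0 \<or> norm (e a) = 1) \<and>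
    (\<forall>i<n. v i = (\<Sum>a<n. cinner (v i) (e a) *\<^sub>C e a))"
proof (induction n)
  case (Suc n)
  then obtain e where e: "\<And>a b. a < n \<Longrightarrow> b < n \<Longrightarrow> a \<noteq> b \<Longrightarrow> cinner (e a) (e b) = 0"
    "\<And>a. a < n \<Longrightarrow> e a = 0 \<or> norm (e a) = 1"
    "\<And>i. i < n \<Longrightarrow> v i = (\<Sum>a<n. cinner (v i) (e a) *\<^sub>C e a)" by auto
  define s where "s = (\<Sum>a<n. cinner (v n) (e a) *\<^sub>C e a)"
  define w where "w = v n - s"
  \<comment> \<open>For \<open>w = 0\<close> division by zero gives \<open>r = 0\<close>, so the new
    vector is zero.\<close>
  define r where "r = complex_of_real (1 / norm w)"
  define f where "f = e(n := r *\<^sub>C w)"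
  have f: "f a = e a" if "a < n" for a using that by (simp add: f_def)
  have fn: "f n = r *\<^sub>C w" by (simp add: f_def)
  have orth: "cinner w (e b) = 0" if b: "b < n" for b
  proof -
    have "cinner s (e b) = (\<Sum>a<n. if a = b then cinner (v n) (e b) * cinner (e b) (e b) else 0)"
      unfolding s_def cinner_sum_left cinner_scaleC_left
      using e(1) b by (intro sum.cong) auto
    also have "\<dots> = cinner (v n) (e b) * cinner (e b) (e b)" using b by simp
    also have "\<dots> = cinner (v n) (e b)" using e(2)[OF b] by (auto simp: cinner_self)
    finally show ?thesis by (simp add: w_def cinner_diff_left)
  qed
  have orth': "cinner (e b) w = 0" if "b < n" for b
    using orth[OF that] by (subst cinner_commute) simp
  have 1: "cinner (f a) (f b) = 0" if "a < Suc n" "b < Suc n" "a \<noteq> b" for a b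
    using that e(1)[of a b]
    by (auto simp: less_Suc_eq f fn orth orth' cinner_scaleC_left cinner_scaleC_right)
  have 2: "f a = 0 \<or> norm (f a) = 1" if "a < Suc n" for a
    using that e(2)[of a] by (cases "w = 0") (auto simp: less_Suc_eq f fn norm_scaleC r_def norm_divide)
  have 3: "v i = (\<Sum>a<Suc n. cinner (v i) (f a) *\<^sub>C f a)" if "i < Suc n" for i
  proof (cases "i = n")
    case False
    then have i: "i < n" using that by simp
    have "cinner (v i) w = cinner (\<Sum>a<n. cinner (v i) (e a) *\<^sub>C e a) w"
      by (rule arg_cong[OF e(3)[OF i]])
    also have "\<dots> = 0"
      unfolding cinner_sum_left cinner_scaleC_left using orth' by simp
    finally have "cinner (v i) w = 0" .
    then have "cinner (v i) (f n) *\<^sub>C f n = 0"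
      by (simp add: fn cinner_scaleC_right)
    then show ?thesis by (intro trans[OF e(3)[OF i]]) (simp add: f)
  next
    case True
    have "cinner s w = 0"
      unfolding s_def cinner_sum_left cinner_scaleC_left using orth' by simp
    then have "cinner (v n) w = cinner w w" by (simp add: w_def cinner_diff_left)
    then have "cinner (v n) (f n) *\<^sub>C f n = (cnj r * cinner w w * r) *\<^sub>C w"
      by (simp only: fn cinner_scaleC_right scaleC_scaleC)
    also have "\<dots> = w"
    proof (cases "w = 0")
      case False
      then have "cnj r * cinner w w * r = 1"
        by (simp add: r_def cinner_self power2_eq_square)
      then show ?thesis by (simp add: scaleC_one)
    qed simp
    finally show ?thesis using True by (simp add: f s_def[symmetric]) (simp add: w_def)
  qed
  show ?case using 1 2 3 by blast
qed auto

text \<open>Orthogonality reduces the squared norm of a combination to its diagonal terms, each of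
  weight at most 1. For a vector in \<open>F\<close> the expansion is exact, and pairing it with the
  vector itself gives the Parseval identity.\<close>

lemma subframe_exists:
  fixes F :: "'a :: complex_hilbert set"
  assumes "finite F"
  shows "\<exists>N e. subframe N e \<and> (\<forall>x\<in>F. x = (\<Sum>a<N. cinner x (e a) *\<^sub>C e a) \<and>
    norm x = L2_set (\<lambda>a. cmod (cinner x (e a))) {..<N})"
proof -
  define N where "N = card F"
  obtain v where v: "bij_betw v {..<N} F"
    using ex_bij_betw_nat_finite[OF assms] by (auto simp: N_def atLeast0LessThan)
  obtain e where e: "\<And>a b. a < N \<Longrightarrow> b < N \<Longrightarrow> a \<noteq> b \<Longrightarrow> cinner (e a) (e b) = 0"
    "\<And>a. a < N \<Longrightarrow> e a = 0 \<or> norm (e a) = 1"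
    "\<And>i. i < N \<Longrightarrow> v i = (\<Sum>a<N. cinner (v i) (e a) *\<^sub>C e a)"
    using gram_schmidt[of N v] by auto
  have "subframe N e"
    unfolding subframe_def
  proof
    fix c
    let ?s = "\<Sum>a<N. c a *\<^sub>C e a"
    have "cinner ?s ?s = (\<Sum>a<N. \<Sum>b<N. c a * (cnj (c b) * cinner (e a) (e b)))"
      unfolding cinner_sum_left
      unfolding cinner_sum_right cinner_scaleC_left cinner_scaleC_right sum_distrib_left
      by (simp only: mult_ac)
    also have "\<dots> = (\<Sum>a<N. \<Sum>b<N. if b = a then c a * (cnj (c a) * cinner (e a) (e a)) else 0)"
      using e(1) by (intro sum.cong) auto
    also have "\<dots> = (\<Sum>a<N. complex_of_real ((cmod (c a))\<^sup>2 * (norm (e a))\<^sup>2))"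
      by (simp add: cinner_self complex_norm_square[symmetric] mult.assoc[symmetric])
    finally have "(norm ?s)\<^sup>2 = (\<Sum>a<N. (cmod (c a))\<^sup>2 * (norm (e a))\<^sup>2)"
      unfolding cinner_self of_real_sum[symmetric] of_real_eq_iff .
    also have "\<dots> \<le> (\<Sum>a<N. (cmod (c a))\<^sup>2)"
    proof (rule sum_mono)
      fix a assume "a \<in> {..<N}"
      then show "(cmod (c a))\<^sup>2 * (norm (e a))\<^sup>2 \<le> (cmod (c a))\<^sup>2" using e(2)[of a] by auto
    qed
    finally show "norm ?s \<le> L2_set (\<lambda>a. cmod (c a)) {..<N}"
      unfolding L2_set_def by (rule real_le_rsqrt)
  qed
  moreover have "x = (\<Sum>a<N. cinner x (e a) *\<^sub>C e a) \<and>
    norm x = L2_set (\<lambda>a. cmod (cinner x (e a))) {..<N}" if "x \<in> F" for x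
  proof
    obtain i where i: "i < N" "x = v i" using \<open>x \<in> F\<close> v by (auto simp: bij_betw_def)
    show x: "x = (\<Sum>a<N. cinner x (e a) *\<^sub>C e a)"
      unfolding i(2) by (rule e(3)[OF i(1)])
    have "complex_of_real ((norm x)\<^sup>2) = cinner (\<Sum>a<N. cinner x (e a) *\<^sub>C e a) x"
      by (subst x[symmetric]) (simp add: cinner_self)
    also have "\<dots> = (\<Sum>a<N. cinner x (e a) * cnj (cinner x (e a)))"
      unfolding cinner_sum_left cinner_scaleC_left by (simp only: cinner_commute[symmetric])
    also have "\<dots> = complex_of_real (\<Sum>a<N. (cmod (cinner x (e a)))\<^sup>2)"
      by (simp add: complex_norm_square[symmetric])
    finally have "(norm x)\<^sup>2 = (\<Sum>a<N. (cmod (cinner x (e a)))\<^sup>2)"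
      unfolding of_real_eq_iff .
    then show "norm x = L2_set (\<lambda>a. cmod (cinner x (e a))) {..<N}"
      unfolding L2_set_def by (metis norm_ge_zero real_sqrt_unique)
  qed
  ultimately show ?thesis by blast
qed

section \<open>Compression of operators to finitely many vectors\<close>

definition complex_linear_op :: "('h :: complex_hilbert \<Rightarrow>\<^sub>L 'h) \<Rightarrow> bool" where
  "complex_linear_op S \<longleftrightarrow> (\<forall>c x. blinfun_apply S (c *\<^sub>C x) = c *\<^sub>C blinfun_apply S x)"

lemma inner_complex: "inner (x :: complex) y = Re (x * cnj y)"
  by (simp add: inner_complex_def)

text \<open>The scalar form at given coefficients is the operator form at the vectors that they
  synthesize, whose norms grow by at most \<open>\<kappa>\<close> and \<open>\<mu>\<close>. A
  subframe has constants 1. A single pair of vectors, with their norms as constants, is the case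
  used in \<open>norm_op_term_le\<close>.\<close>

lemma form_bounded_compress:
  fixes X :: "'i \<Rightarrow> 'i \<Rightarrow> 'h :: complex_hilbert \<Rightarrow>\<^sub>L 'h" and e f :: "'q \<Rightarrow> 'h"
  assumes X: "form_bounded blinfun_apply I X C" "0 \<le> C"
    and lin: "\<And>i j. i \<in> I \<Longrightarrow> j \<in> I \<Longrightarrow> complex_linear_op (X i j)"
    and e: "\<And>c. norm (\<Sum>a\<in>Q. c a *\<^sub>C e a) \<le> \<kappa> * L2_set (\<lambda>a. cmod (c a)) Q" "0 \<le> \<kappa>"
    and f: "\<And>c. norm (\<Sum>a\<in>Q. c a *\<^sub>C f a) \<le> \<mu> * L2_set (\<lambda>a. cmod (c a)) Q" "0 \<le> \<mu>"
  shows "form_bounded (*) (I \<times> Q) (\<lambda>a b. cinner (X (fst a) (fst b) (e (snd b))) (f (snd a)))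
    (C * \<kappa> * \<mu>)"
  unfolding form_bounded_def
proof (intro allI)
  fix c c' :: "'i \<times> 'q \<Rightarrow> complex"
  define \<xi> where "\<xi> j = (\<Sum>b\<in>Q. c (j, b) *\<^sub>C e b)" for j
  define \<eta> where "\<eta> i = (\<Sum>a\<in>Q. c' (i, a) *\<^sub>C f a)" for i
  let ?L = "\<lambda>c. L2_set (\<lambda>a. cmod (c a)) (I \<times> Q)"
  have \<xi>: "L2_set (\<lambda>j. norm (\<xi> j)) I \<le> \<kappa> * ?L c"
  proof -
    have "L2_set (\<lambda>j. norm (\<xi> j)) I \<le> L2_set (\<lambda>j. \<kappa> * L2_set (\<lambda>b. cmod (c (j, b))) Q) I"
      unfolding \<xi>_def by (intro L2_set_mono e) simp
    then show ?thesis
      using L2_set_Times[of "\<lambda>x. cmod (c x)" Q I] e(2) by (simp add: L2_set_right_distrib[symmetric])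
  qed
  have \<eta>: "L2_set (\<lambda>j. norm (\<eta> j)) I \<le> \<mu> * ?L c'"
  proof -
    have "L2_set (\<lambda>j. norm (\<eta> j)) I \<le> L2_set (\<lambda>j. \<mu> * L2_set (\<lambda>b. cmod (c' (j, b))) Q) I"
      unfolding \<eta>_def by (intro L2_set_mono f) simp
    then show ?thesis
      using L2_set_Times[of "\<lambda>x. cmod (c' x)" Q I] f(2) by (simp add: L2_set_right_distrib[symmetric])
  qed
  have t: "inner (X i j (\<xi> j)) (\<eta> i)
     = (\<Sum>a\<in>Q. \<Sum>b\<in>Q. inner (cinner (X i j (e b)) (f a) * c (j, b)) (c' (i, a)))"
    if "i \<in> I" "j \<in> I" for i j
  proof -
    have l: "X i j (c *\<^sub>C x) = c *\<^sub>C X i j x" for c x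
      using lin[OF that] by (simp add: complex_linear_op_def)
    have "cinner (X i j (\<xi> j)) (\<eta> i)
       = (\<Sum>a\<in>Q. \<Sum>b\<in>Q. cinner (X i j (e b)) (f a) * c (j, b) * cnj (c' (i, a)))"
      unfolding \<xi>_def \<eta>_def blinfun.sum_right l cinner_sum_right cinner_sum_left
        cinner_scaleC_right cinner_scaleC_left sum_distrib_left
      by (simp only: mult_ac)
    then show ?thesis
      by (simp only: Re_cinner[symmetric, of "X i j (\<xi> j)"] Re_sum inner_complex)
  qed
  have "(\<Sum>p\<in>I \<times> Q. \<Sum>q\<in>I \<times> Q.
      inner (cinner (X (fst p) (fst q) (e (snd q))) (f (snd p)) * c q) (c' p))
     = (\<Sum>i\<in>I. \<Sum>a\<in>Q. \<Sum>j\<in>I. \<Sum>b\<in>Q. inner (cinner (X i j (e b)) (f a) * c (j, b)) (c' (i, a)))"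
    by (simp only: sum_Times fst_conv snd_conv)
  also have "\<dots> = (\<Sum>i\<in>I. \<Sum>j\<in>I. \<Sum>a\<in>Q. \<Sum>b\<in>Q.
      inner (cinner (X i j (e b)) (f a) * c (j, b)) (c' (i, a)))"
    by (intro sum.cong refl sum.swap)
  also have "\<dots> = (\<Sum>i\<in>I. \<Sum>j\<in>I. inner (X i j (\<xi> j)) (\<eta> i))"
    by (intro sum.cong refl t[symmetric])
  also have "\<dots> \<le> C * L2_set (\<lambda>j. norm (\<xi> j)) I * L2_set (\<lambda>i. norm (\<eta> i)) I"
    by (rule form_boundedD[OF X(1)])
  also have "\<dots> \<le> C * (\<kappa> * ?L c) * (\<mu> * ?L c')"
    using \<xi> \<eta> X(2) e(2) by (intro mult_mono mult_left_mono mult_nonneg_nonneg) auto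
  finally show "(\<Sum>p\<in>I \<times> Q. \<Sum>q\<in>I \<times> Q.
      inner (cinner (X (fst p) (fst q) (e (snd q))) (f (snd p)) * c q) (c' p))
      \<le> C * \<kappa> * \<mu> * ?L c * ?L c'"
    by (simp add: mult_ac)
qed

text \<open>The subframe is chosen after \<xi> and \<eta>, and for these vectors the coefficients
  have exactly the same norms. Hence the bound is assumed for all subframes with one constant
  \<open>C\<close>.\<close>

lemma form_bounded_decompress:
  fixes X :: "'i \<Rightarrow> 'i \<Rightarrow> 'h :: complex_hilbert \<Rightarrow>\<^sub>L 'h"
  assumes lin: "\<And>i j. i \<in> I \<Longrightarrow> j \<in> I \<Longrightarrow> complex_linear_op (X i j)" and I: "finite I"
    and bd: "\<And>N e. subframe N e \<Longrightarrow> form_bounded (*) (I \<times> {..<N})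
      (\<lambda>a b. cinner (X (fst a) (fst b) (e (snd b))) (e (snd a))) C"
  shows "form_bounded blinfun_apply I X C"
  unfolding form_bounded_def
proof (intro allI)
  fix \<xi> \<eta> :: "'i \<Rightarrow> 'h"
  obtain N e where e: "subframe N e" and ex: "\<And>x. x \<in> \<xi> ` I \<union> \<eta> ` I \<Longrightarrow>
     x = (\<Sum>a<N. cinner x (e a) *\<^sub>C e a) \<and> norm x = L2_set (\<lambda>a. cmod (cinner x (e a))) {..<N}"
    using subframe_exists[of "\<xi> ` I \<union> \<eta> ` I"] I by blast
  define c where "c p = cinner (\<xi> (fst p)) (e (snd p))" for p
  define c' where "c' p = cinner (\<eta> (fst p)) (e (snd p))" for p
  let ?Q = "{..<N}"
  have \<xi>: "\<xi> j = (\<Sum>b\<in>?Q. c (j, b) *\<^sub>C e b)" "norm (\<xi> j) = L2_set (\<lambda>b. cmod (c (j, b))) ?Q"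
    and \<eta>: "\<eta> j = (\<Sum>b\<in>?Q. c' (j, b) *\<^sub>C e b)" "norm (\<eta> j) = L2_set (\<lambda>b. cmod (c' (j, b))) ?Q"
    if "j \<in> I" for j
    unfolding c_def c'_def fst_conv snd_conv using ex that by blast+
  have t: "inner (X i j (\<xi> j)) (\<eta> i)
     = (\<Sum>a\<in>?Q. \<Sum>b\<in>?Q. inner (cinner (X i j (e b)) (e a) * c (j, b)) (c' (i, a)))"
    if "i \<in> I" "j \<in> I" for i j
  proof -
    have l: "X i j (c *\<^sub>C x) = c *\<^sub>C X i j x" for c x
      using lin[OF that] by (simp add: complex_linear_op_def)
    have "cinner (X i j (\<xi> j)) (\<eta> i)
       = (\<Sum>a\<in>?Q. \<Sum>b\<in>?Q. cinner (X i j (e b)) (e a) * c (j, b) * cnj (c' (i, a)))"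
      unfolding \<xi>(1)[OF that(2)] \<eta>(1)[OF that(1)] blinfun.sum_right l cinner_sum_right cinner_sum_left
        cinner_scaleC_right cinner_scaleC_left sum_distrib_left
      by (simp only: mult_ac)
    then show ?thesis
      by (simp only: Re_cinner[symmetric, of "X i j (\<xi> j)"] Re_sum inner_complex)
  qed
  have L: "L2_set (\<lambda>j. norm (\<xi> j)) I = L2_set (\<lambda>p. cmod (c p)) (I \<times> ?Q)"
    "L2_set (\<lambda>j. norm (\<eta> j)) I = L2_set (\<lambda>p. cmod (c' p)) (I \<times> ?Q)"
    unfolding L2_set_Times[symmetric] using \<xi>(2) \<eta>(2) by (auto intro!: L2_set_cong)
  have "(\<Sum>i\<in>I. \<Sum>j\<in>I. inner (X i j (\<xi> j)) (\<eta> i)) = (\<Sum>i\<in>I. \<Sum>j\<in>I. \<Sum>a\<in>?Q. \<Sum>b\<in>?Q.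
      inner (cinner (X i j (e b)) (e a) * c (j, b)) (c' (i, a)))"
    by (intro sum.cong refl t)
  also have "\<dots> = (\<Sum>i\<in>I. \<Sum>a\<in>?Q. \<Sum>j\<in>I. \<Sum>b\<in>?Q.
      inner (cinner (X i j (e b)) (e a) * c (j, b)) (c' (i, a)))"
    by (intro sum.cong refl sum.swap)
  also have "\<dots> = (\<Sum>p\<in>I \<times> ?Q. \<Sum>q\<in>I \<times> ?Q.
      inner (cinner (X (fst p) (fst q) (e (snd q))) (e (snd p)) * c q) (c' p))"
    by (simp only: sum_Times fst_conv snd_conv)
  also have "\<dots> \<le> C * L2_set (\<lambda>p. cmod (c p)) (I \<times> ?Q) * L2_set (\<lambda>p. cmod (c' p)) (I \<times> ?Q)"
    by (rule form_boundedD[OF bd[OF e]])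
  finally show "(\<Sum>i\<in>I. \<Sum>j\<in>I. inner (X i j (\<xi> j)) (\<eta> i))
      \<le> C * L2_set (\<lambda>j. norm (\<xi> j)) I * L2_set (\<lambda>i. norm (\<eta> i)) I"
    unfolding L .
qed

section \<open>The map Lambda\<close>

context nonempty_dual
begin

text \<open>The matrix unit with indices l, k, in this order, since the trace pairs the entry k, l of
  one factor with the entry l, k of the other.\<close>

definition unit_family ::
    "'g rep_class \<Rightarrow> nat \<Rightarrow> nat \<Rightarrow> 'g rep_class \<Rightarrow> nat \<Rightarrow> nat \<Rightarrow> complex" where
  "unit_family \<pi> k l = (\<lambda>\<sigma> r s. if \<sigma> = \<pi> \<and> r = l \<and> s = k then 1 / of_nat (deg G \<pi>) else 0)"

lemma unit_family_neq: "\<sigma> \<noteq> \<pi> \<Longrightarrow> unit_family \<pi> k l \<sigma> = 0"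
  by (auto simp: unit_family_def fun_eq_iff)

lemma unit_family_in_L1:
  assumes "\<pi> \<in> D" "k < deg G \<pi>" "l < deg G \<pi>"
  shows "unit_family \<pi> k l \<in> vecs (L1 G T)"
proof -
  have "(\<lambda>\<sigma>. real (deg G \<sigma>) * schatten1_norm (deg G \<sigma>) (unit_family \<pi> k l \<sigma>)) summable_on D"
  proof (rule finite_nonzero_values_imp_summable_on, rule finite_subset)
    show "{\<sigma> \<in> D. real (deg G \<sigma>) * schatten1_norm (deg G \<sigma>) (unit_family \<pi> k l \<sigma>) \<noteq> 0} \<subseteq> {\<pi>}"
      using unit_family_neq by (metis (mono_tags, lifting) mem_Collect_eq mult_zero_right
          schatten1_norm_zero singletonI subsetI)
  qed simp
  moreover have "mtrunc (deg G \<sigma>) (unit_family \<pi> k l \<sigma>) = unit_family \<pi> k l \<sigma>" for \<sigma>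
    using assms by (auto simp: mtrunc_def unit_family_def fun_eq_iff)
  moreover have "unit_family \<pi> k l \<sigma> = 0" if "\<sigma> \<notin> D" for \<sigma>
    using that assms by (intro unit_family_neq) auto
  ultimately show ?thesis by (simp add: L1_iff)
qed

lemma dual_pair_unit:
  assumes "\<pi> \<in> D" "k < deg G \<pi>" "l < deg G \<pi>"
  shows "dual_pair y (unit_family \<pi> k l) = y \<pi> k l"
  unfolding dual_pair_def
proof (rule infsumI, rule has_sum_finite_neutralI[of "{\<pi>}"])
  have "mtrace (*) (deg G \<pi>) (y \<pi>) (unit_family \<pi> k l \<pi>) = y \<pi> k l / of_nat (deg G \<pi>)"
    unfolding mtrace_def using assms(2,3)
    by (subst sum_delta2[of k _ l]) (auto simp: unit_family_def)
  then show "y \<pi> k l = (\<Sum>\<sigma>\<in>{\<pi>}. of_nat (deg G \<sigma>) * mtrace (*) (deg G \<sigma>) (y \<sigma>) (unit_family \<pi> k l \<sigma>))"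
    using deg_pos[OF assms(1)] by simp
qed (use assms in \<open>auto simp: unit_family_neq mtrace_def\<close>)

definition unit_matrix where "unit_matrix \<pi> = mtrunc (deg G \<pi>) (unit_family \<pi>)"

lemma unit_matrix_in_matrices: "\<pi> \<in> D \<Longrightarrow> unit_matrix \<pi> \<in> matrices (deg G \<pi>) (L1 G T)"
  unfolding unit_matrix_def by (intro matricesI unit_family_in_L1)

lemma unit_matrix_mnorm_le:
  assumes \<pi>: "\<pi> \<in> D"
  shows "mnorm (L1 G T) (deg G \<pi>) (unit_matrix \<pi>) \<le> 1"
proof (rule L1_mnorm_le)
  show "1 \<le> deg G \<pi>" using deg_pos[OF \<pi>] by simp
  fix N :: nat and y :: "nat \<Rightarrow> nat \<Rightarrow> 'g rep_class \<Rightarrow> nat \<Rightarrow> nat \<Rightarrow> complex"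
  assume "\<And>\<pi>. \<pi> \<in> D \<Longrightarrow>
      form_bounded (*) ({..<deg G \<pi>} \<times> {..<N}) (\<lambda>a b. y (snd a) (snd b) \<pi> (fst a) (fst b)) 1"
  then have "form_bounded (*) ({..<deg G \<pi>} \<times> {..<N}) (\<lambda>a b. y (snd a) (snd b) \<pi> (fst a) (fst b)) 1"
    using \<pi> by blast
  then have 1: "form_bounded (*) ({..<N} \<times> {..<deg G \<pi>}) (\<lambda>a b. y (fst a) (fst b) \<pi> (snd a) (snd b)) 1"
    by (rule form_bounded_swap[where X = "\<lambda>k l u v. y u v \<pi> k l"])
      (auto simp: bounded_linear_mult_right)
  show "form_bounded (*) ({..<N} \<times> {..<deg G \<pi>})
      (\<lambda>a b. dual_pair (y (fst a) (fst b)) (unit_matrix \<pi> (snd a) (snd b))) 1"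
    by (rule form_bounded_cong[THEN iffD1, OF _ 1]) (auto simp: unit_matrix_def dual_pair_unit[OF \<pi>])
qed simp

lemma L1_zero: "0 \<in> vecs (L1 G T)"
  by (auto simp: L1_iff mtrunc_def fun_eq_iff)

text \<open>Supplies the element of the unit ball that \<open>cb_norm_least\<close> asks
  for.\<close>

lemma L1_zero_mnorm_le: "mnorm (L1 G T) 1 0 \<le> 1"
proof (rule L1_mnorm_le)
  have "dual_pair y 0 = 0" for y
    by (simp add: dual_pair_def mtrace_def)
  then show "form_bounded (*) ({..<N} \<times> {..<1}) (\<lambda>a b. dual_pair (y (fst a) (fst b)) (0 (snd a) (snd b))) 1"
    for N :: nat and y :: "nat \<Rightarrow> nat \<Rightarrow> 'g rep_class \<Rightarrow> nat \<Rightarrow> nat \<Rightarrow> complex"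
    by (simp add: form_bounded_zero)
qed auto

text \<open>Links the two norms: a completely bounded map is controlled by the norm of the
  embedding, while tails are seen to be small in \<open>L1sum\<close>.\<close>

lemma L1_single_mnorm_le:
  assumes "B \<in> vecs (L1 G T)"
  shows "mnorm (L1 G T) 1 (mtrunc 1 (\<lambda>_ _. B)) \<le> L1sum B"
proof (rule L1_mnorm_le)
  fix N :: nat and y :: "nat \<Rightarrow> nat \<Rightarrow> 'g rep_class \<Rightarrow> nat \<Rightarrow> nat \<Rightarrow> complex"
  assume y: "\<And>\<pi>. \<pi> \<in> D \<Longrightarrow>
      form_bounded (*) ({..<deg G \<pi>} \<times> {..<N}) (\<lambda>a b. y (snd a) (snd b) \<pi> (fst a) (fst b)) 1"
  have 1: "form_bounded (*) {..<N} (\<lambda>u v. dual_pair (y u v) B) (L1sum B * 1)"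
    by (rule dual_pair_form_bounded[OF assms _ _ y]) auto
  show "form_bounded (*) ({..<N} \<times> {..<1})
      (\<lambda>a b. dual_pair (y (fst a) (fst b)) (mtrunc 1 (\<lambda>_ _. B) (snd a) (snd b))) (L1sum B)"
  proof (rule form_bounded_reindex[OF 1[unfolded mult_1_right] bounded_linear_mult_right])
    show "bij_betw fst ({..<N} \<times> {..<1::nat}) {..<N}"
      by (intro bij_betwI[where g = "\<lambda>i. (i, 0)"]) auto
  qed auto
qed (simp_all add: L1sum_nonneg)

lemma L1_sum: "(\<And>i. i \<in> I \<Longrightarrow> f i \<in> vecs (L1 G T)) \<Longrightarrow> sum f I \<in> vecs (L1 G T)"
  by (induction I rule: infinite_finite_induct) (auto simp: L1_zero L1_add)

section \<open>Finite parts of families in L1\<close>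

definition restrict_family :: "'g rep_class set \<Rightarrow> ('g rep_class \<Rightarrow> nat \<Rightarrow> nat \<Rightarrow> complex)
    \<Rightarrow> 'g rep_class \<Rightarrow> nat \<Rightarrow> nat \<Rightarrow> complex" where
  "restrict_family S B = (\<lambda>\<sigma>. if \<sigma> \<in> S then B \<sigma> else 0)"

lemma restrict_family_in_L1:
  assumes B: "B \<in> vecs (L1 G T)"
  shows "restrict_family S B \<in> vecs (L1 G T)"
proof -
  have "(\<lambda>\<sigma>. real (deg G \<sigma>) * schatten1_norm (deg G \<sigma>) (restrict_family S B \<sigma>)) summable_on D"
    by (rule summable_on_comparison_test[of "\<lambda>\<sigma>. real (deg G \<sigma>) * schatten1_norm (deg G \<sigma>) (B \<sigma>)"])
      (use B in \<open>auto simp: L1_iff restrict_family_def\<close>)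
  moreover have "mtrunc n 0 = (0 :: nat \<Rightarrow> nat \<Rightarrow> complex)" for n
    by (auto simp: mtrunc_def fun_eq_iff)
  ultimately show ?thesis using B by (simp add: L1_iff restrict_family_def)
qed

text \<open>The tail of a convergent sum, which tends to 0 as \<open>F\<close> grows.\<close>

lemma L1sum_restrict_compl:
  assumes B: "B \<in> vecs (L1 G T)" and F: "finite F" "F \<subseteq> D"
  shows "L1sum (restrict_family (- F) B)
    = L1sum B - (\<Sum>\<sigma>\<in>F. real (deg G \<sigma>) * schatten1_norm (deg G \<sigma>) (B \<sigma>))"
proof -
  have "L1sum (restrict_family (- F) B) =
      (\<Sum>\<^sub>\<infinity>\<sigma>\<in>D - F. real (deg G \<sigma>) * schatten1_norm (deg G \<sigma>) (B \<sigma>))"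
    unfolding L1sum_def by (rule infsum_cong_neutral) (auto simp: restrict_family_def)
  also have "\<dots> = L1sum B - (\<Sum>\<^sub>\<infinity>\<sigma>\<in>F. real (deg G \<sigma>) * schatten1_norm (deg G \<sigma>) (B \<sigma>))"
    unfolding L1sum_def using B F by (intro infsum_Diff) (auto simp: L1_iff)
  finally show ?thesis using F by simp
qed

text \<open>The factor \<open>deg G \<pi>\<close> undoes the normalization of the matrix units, and
  the indices of \<open>B\<close> are transposed as in the trace.\<close>

lemma restrict_family_single:
  assumes B: "B \<in> vecs (L1 G T)" and \<pi>: "\<pi> \<in> D"
  shows "restrict_family {\<pi>} B
    = (\<Sum>k<deg G \<pi>. \<Sum>l<deg G \<pi>. (of_nat (deg G \<pi>) * B \<pi> l k) *\<^sub>C unit_family \<pi> k l)"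
proof (intro ext)
  fix \<sigma> r s
  let ?d = "deg G \<pi>"
  have sum_apply: "(\<Sum>i\<in>I. f i) x = (\<Sum>i\<in>I. f i x)" for f :: "nat \<Rightarrow> 'x \<Rightarrow> 'y :: comm_monoid_add" and I x
    by (induction I rule: infinite_finite_induct) auto
  have "(\<Sum>k<?d. \<Sum>l<?d. (of_nat ?d * B \<pi> l k) *\<^sub>C unit_family \<pi> k l) \<sigma> r s
      = (\<Sum>k<?d. \<Sum>l<?d. of_nat ?d * B \<pi> l k * unit_family \<pi> k l \<sigma> r s)"
    by (simp add: sum_apply scaleC_fun_def scaleC_complex_def)
  also have "\<dots> = restrict_family {\<pi>} B \<sigma> r s"
  proof (cases "\<sigma> = \<pi> \<and> r < ?d \<and> s < ?d")
    case True
    then show ?thesis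
      using deg_pos[OF \<pi>] by (subst sum_delta2[of s _ r]) (auto simp: unit_family_def restrict_family_def)
  next
    case False
    have "mtrunc ?d (B \<pi>) = B \<pi>" using B \<pi> by (simp add: L1_iff)
    then have "B \<pi> r s = 0" if "\<not> (r < ?d \<and> s < ?d)"
      using that by (metis mtrunc_ge)
    then have "restrict_family {\<pi>} B \<sigma> r s = 0"
      using False by (auto simp: restrict_family_def)
    moreover have "(\<Sum>k<?d. \<Sum>l<?d. of_nat ?d * B \<pi> l k * unit_family \<pi> k l \<sigma> r s) = 0"
      using False by (intro sum.neutral ballI) (auto simp: unit_family_def)
    ultimately show ?thesis by simp
  qed
  finally show "restrict_family {\<pi>} B \<sigma> r s
    = (\<Sum>k<?d. \<Sum>l<?d. (of_nat ?d * B \<pi> l k) *\<^sub>C unit_family \<pi> k l) \<sigma> r s" ..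
qed

section \<open>The pairing with a fixed operator space\<close>

context
  fixes E :: "('h :: complex_hilbert \<Rightarrow>\<^sub>L 'h) set"
  assumes E: "operator_space E"
begin

lemma E_linear: "S \<in> E \<Longrightarrow> complex_linear_op S"
  and E_zero: "0 \<in> E"
  and E_add: "S \<in> E \<Longrightarrow> S' \<in> E \<Longrightarrow> S + S' \<in> E"
  and E_scale: "S \<in> E \<Longrightarrow> c *\<^sub>C S \<in> E"
  and E_closed: "closed E"
  using E by (simp_all add: operator_space_def complex_linear_op_def)

lemma E_sum: "(\<And>i. i \<in> I \<Longrightarrow> f i \<in> E) \<Longrightarrow> sum f I \<in> E"
  by (induction I rule: infinite_finite_induct) (auto simp: E_zero E_add)

abbreviation "Linf_E \<equiv> Linf G T (opspace E)"
abbreviation "op_term \<equiv> pairing_term G (\<lambda>a b. b *\<^sub>C (a :: 'h \<Rightarrow>\<^sub>L 'h))"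
abbreviation "\<Lambda> \<equiv> Lambda G T :: _ \<Rightarrow> _ \<Rightarrow> 'h \<Rightarrow>\<^sub>L 'h"

lemma opspace_repr: "mnorm (opspace E) k F = op_matrix_norm blinfun_apply k (\<lambda>i j. F i j)"
  by simp

lemmas Linf_E_form_bounded =
  Linf_form_bounded[where V = "opspace E" and h = "\<lambda>x. x" and act = blinfun_apply,
    OF opspace_repr blinfun.bounded_linear_right]

lemmas Linf_E_mnorm_nonneg =
  Linf_mnorm_nonneg[where V = "opspace E" and h = "\<lambda>x. x" and act = blinfun_apply,
    OF opspace_repr blinfun.bounded_linear_right]

lemmas Linf_E_mnorm_le =
  Linf_mnorm_le[where V = "opspace E" and h = "\<lambda>x. x" and act = blinfun_apply,
    OF opspace_repr blinfun.bounded_linear_right]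

lemma Linf_E_entry:
  "A \<in> vecs Linf_E \<Longrightarrow> \<pi> \<in> D \<Longrightarrow> k < deg G \<pi> \<Longrightarrow> l < deg G \<pi> \<Longrightarrow> A \<pi> k l \<in> E"
  using Linf_entry[of A "opspace E" \<pi> k l] by simp

lemma Linf_E_bound:
  assumes "A \<in> vecs Linf_E"
  shows "\<exists>C\<ge>0. \<forall>\<pi>\<in>D. form_bounded blinfun_apply {..<deg G \<pi>} (A \<pi>) C"
proof -
  obtain C where C: "\<And>\<pi>. \<pi> \<in> D \<Longrightarrow> op_matrix_norm blinfun_apply (deg G \<pi>) (A \<pi>) \<le> C"
    using assms by (auto simp: Linf_def bdd_above_def)
  have "form_bounded blinfun_apply {..<deg G \<pi>} (A \<pi>) (max C 0)" if "\<pi> \<in> D" for \<pi>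
    using C[OF that]
    by (intro form_bounded_mono[OF form_bounded_op_matrix_norm[OF blinfun.bounded_linear_right]]) simp
  then show ?thesis by (intro exI[of _ "max C 0"]) auto
qed

text \<open>Matrix coefficients reduce the operator-valued pairing to the scalar one, for which the
  norm estimates are available.\<close>

lemma cinner_op_term:
  "cinner (blinfun_apply (op_term A B \<pi>) x) y =
    of_nat (deg G \<pi>) * mtrace (*) (deg G \<pi>) (\<lambda>k l. cinner (blinfun_apply (A \<pi> k l) x) y) (B \<pi>)"
  unfolding pairing_term_def mtrace_def scaleC_blinfun.rep_eq blinfun.sum_left
    cinner_scaleC_left cinner_sum_left
  by (simp only: mult.commute[of "B _ _ _"])

text \<open>Compressing to the single vectors \<open>x\<close> and its image \<open>?y\<close>
  bounds the squared norm of \<open>?y\<close> by a multiple of the product of both norms; one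
  factor cancels.\<close>

lemma norm_op_term_le:
  assumes A: "A \<in> vecs Linf_E" and \<pi>: "\<pi> \<in> D" and C: "0 \<le> C"
    "form_bounded blinfun_apply {..<deg G \<pi>} (A \<pi>) C"
  shows "norm (op_term A B \<pi>) \<le> real (deg G \<pi>) * schatten1_norm (deg G \<pi>) (B \<pi>) * C"
proof (rule norm_blinfun_bound)
  fix x
  let ?y = "blinfun_apply (op_term A B \<pi>) x"
  let ?d = "deg G \<pi>"
  have "form_bounded (*) ({..<?d} \<times> {()})
      (\<lambda>a b. cinner (blinfun_apply (A \<pi> (fst a) (fst b)) ((\<lambda>_. x) (snd b))) ((\<lambda>_. ?y) (snd a)))
      (C * norm x * norm ?y)"
    by (rule form_bounded_compress[OF C(2,1)])
      (use E_linear Linf_E_entry[OF A \<pi>] in \<open>auto simp: norm_scaleC mult.commute\<close>)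
  then have "form_bounded (*) {()} (\<lambda>u v. of_nat ?d * mtrace (*) ?d
      (\<lambda>k l. cinner (blinfun_apply (A \<pi> k l) x) ?y) (B \<pi>))
      (real ?d * schatten1_norm ?d (B \<pi>) * (C * norm x * norm ?y))"
    by (intro pair_term_form_bounded[where y = "\<lambda>u v k l. cinner (blinfun_apply (A \<pi> k l) x) ?y"])
      (use C in auto)
  then have "cmod (cinner ?y ?y) \<le> real ?d * schatten1_norm ?d (B \<pi>) * (C * norm x * norm ?y)"
    unfolding cinner_op_term[symmetric] by (rule form_bounded_entry) (use C in auto)
  then have "norm ?y * norm ?y \<le> (real ?d * schatten1_norm ?d (B \<pi>) * C * norm x) * norm ?y"
    by (simp add: cinner_self power2_eq_square norm_mult mult_ac)
  then show "norm ?y \<le> real ?d * schatten1_norm ?d (B \<pi>) * C * norm x"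
    using C by (cases "norm ?y = 0") (auto dest: mult_right_le_imp_le)
qed (use C in auto)

lemma op_term_summable:
  assumes A: "A \<in> vecs Linf_E" and B: "B \<in> vecs (L1 G T)"
  shows "op_term A B summable_on D"
proof -
  obtain C where C: "0 \<le> C" "\<And>\<pi>. \<pi> \<in> D \<Longrightarrow> form_bounded blinfun_apply {..<deg G \<pi>} (A \<pi>) C"
    using Linf_E_bound[OF A] by blast
  have "(\<lambda>\<pi>. norm (op_term A B \<pi>)) summable_on D"
  proof (rule summable_on_comparison_test)
    show "(\<lambda>\<pi>. real (deg G \<pi>) * schatten1_norm (deg G \<pi>) (B \<pi>) * C) summable_on D"
      using B by (intro summable_on_cmult_left) (simp add: L1_iff)
  qed (use norm_op_term_le[OF A _ C] in auto)
  then show ?thesis by (rule abs_summable_summable)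
qed

lemma Lambda_has_sum:
  assumes "A \<in> vecs Linf_E" "B \<in> vecs (L1 G T)"
  shows "(op_term A B has_sum \<Lambda> A B) D"
  using op_term_summable[OF assms] assms(2) by (simp add: Lambda_def extend_zero_def)

lemma cinner_Lambda:
  assumes "A \<in> vecs Linf_E" "B \<in> vecs (L1 G T)"
  shows "cinner (blinfun_apply (\<Lambda> A B) x) y =
    dual_pair (\<lambda>\<pi> k l. cinner (blinfun_apply (A \<pi> k l) x) y) B"
proof -
  have "bounded_linear (\<lambda>S. cinner (blinfun_apply S x) y)"
    by (rule bounded_linear_compose[OF bounded_linear_cinner_left blinfun.bounded_linear_left])
  from has_sum_bounded_linear[OF this Lambda_has_sum[OF assms]] show ?thesis
    unfolding cinner_op_term dual_pair_def by (rule infsumI[symmetric])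
qed

lemma op_term_in_E: "A \<in> vecs Linf_E \<Longrightarrow> \<pi> \<in> D \<Longrightarrow> op_term A B \<pi> \<in> E"
  unfolding pairing_term_def mtrace_def by (intro E_scale E_sum) (auto intro: Linf_E_entry)

lemma Lambda_in_E:
  assumes "A \<in> vecs Linf_E" "B \<in> vecs (L1 G T)"
  shows "\<Lambda> A B \<in> E"
proof (rule Lim_in_closed_set[OF E_closed])
  show "(sum (op_term A B) \<longlongrightarrow> \<Lambda> A B) (finite_subsets_at_top D)"
    using Lambda_has_sum[OF assms] by (simp add: has_sum_def)
  show "\<forall>\<^sub>F F in finite_subsets_at_top D. sum (op_term A B) F \<in> E"
    by (rule eventually_finite_subsets_at_top_weakI) (use op_term_in_E[OF assms(1)] in \<open>auto intro: E_sum\<close>)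
qed simp

text \<open>The set \<open>?P\<close> joins the matrix index of \<open>A\<close> with the
  coordinates of the subframe, and the compressed \<open>A\<close> is one array of scalar families
  over it. To \<open>L1_form_bounded\<close> this array is a single test matrix, so neither size
  enters the constant. What remains is a permutation of three indices.\<close>

lemma Lambda_form_bounded:
  fixes m n :: nat
  assumes A: "\<And>i j. i < m \<Longrightarrow> j < m \<Longrightarrow> A i j \<in> vecs Linf_E" and C: "0 \<le> C"
    and b: "\<And>\<pi>. \<pi> \<in> D \<Longrightarrow> form_bounded blinfun_apply ({..<deg G \<pi>} \<times> {..<m})
       (\<lambda>a b. A (snd a) (snd b) \<pi> (fst a) (fst b)) C"
    and n: "1 \<le> n" and X: "\<And>p q. p < n \<Longrightarrow> q < n \<Longrightarrow> X p q \<in> vecs (L1 G T)"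
  shows "form_bounded blinfun_apply ({..<n} \<times> {..<m})
    (\<lambda>a b. \<Lambda> (A (snd a) (snd b)) (X (fst a) (fst b))) (mnorm (L1 G T) n X * C)"
proof (rule form_bounded_decompress)
  fix N and e :: "nat \<Rightarrow> 'h" assume e: "subframe N e"
  note bl = bounded_linear_mult_right
  define y where "y u v \<pi> k l = cinner (blinfun_apply (A (fst u) (fst v) \<pi> k l) (e (snd v))) (e (snd u))"
    for u v :: "nat \<times> nat" and \<pi> k l
  let ?P = "{..<m} \<times> {..<N}"
  have y: "form_bounded (*) ({..<deg G \<pi>} \<times> ?P) (\<lambda>a b. y (snd a) (snd b) \<pi> (fst a) (fst b)) C"
    if \<pi>: "\<pi> \<in> D" for \<pi>
  proof -
    have 1: "form_bounded (*) (({..<deg G \<pi>} \<times> {..<m}) \<times> {..<N})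
      (\<lambda>a b. cinner (blinfun_apply (A (snd (fst a)) (snd (fst b)) \<pi> (fst (fst a)) (fst (fst b)))
          (e (snd b))) (e (snd a))) (C * 1 * 1)"
      by (rule form_bounded_compress[OF b[OF \<pi>] C])
        (use e E_linear Linf_E_entry[OF A \<pi>] in \<open>auto simp: subframe_def\<close>)
    show ?thesis
    proof (rule form_bounded_reindex[OF 1[unfolded mult_1_right] bl])
      show "bij_betw (\<lambda>(k, i, a). ((k, i), a)) ({..<deg G \<pi>} \<times> ?P)
          (({..<deg G \<pi>} \<times> {..<m}) \<times> {..<N})"
        by (intro bij_betwI[where g = "\<lambda>((k, i), a). (k, i, a)"]) auto
    qed (auto simp: y_def)
  qed
  have 2: "form_bounded (*) (?P \<times> {..<n}) (\<lambda>a b. dual_pair (y (fst a) (fst b)) (X (snd a) (snd b)))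
      (mnorm (L1 G T) n X * C)"
    by (rule L1_form_bounded[OF n X _ C y]) auto
  show "form_bounded (*) (({..<n} \<times> {..<m}) \<times> {..<N})
      (\<lambda>a b. cinner (blinfun_apply (\<Lambda> (A (snd (fst a)) (snd (fst b))) (X (fst (fst a)) (fst (fst b))))
        (e (snd b))) (e (snd a))) (mnorm (L1 G T) n X * C)"
  proof (rule form_bounded_reindex[OF 2 bl])
    show "bij_betw (\<lambda>((p, i), a). ((i, a), p)) (({..<n} \<times> {..<m}) \<times> {..<N}) (?P \<times> {..<n})"
      by (intro bij_betwI[where g = "\<lambda>((i, a), p). ((p, i), a)"]) auto
  qed (auto simp: y_def[abs_def] cinner_Lambda[OF A X])
qed (use E_linear Lambda_in_E A X in auto)

lemma op_term_add_right: "op_term A (B + B') = (\<lambda>\<pi>. op_term A B \<pi> + op_term A B' \<pi>)"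
  by (simp add: fun_eq_iff pairing_term_def mtrace_def scaleC_add_left scaleC_add_right sum.distrib)

lemma op_term_add_left: "op_term (A + A') B = (\<lambda>\<pi>. op_term A B \<pi> + op_term A' B \<pi>)"
  by (simp add: fun_eq_iff pairing_term_def mtrace_def scaleC_add_right sum.distrib)

lemma op_term_scale_right: "op_term A (c *\<^sub>C B) = (\<lambda>\<pi>. c *\<^sub>C op_term A B \<pi>)"
  unfolding pairing_term_def mtrace_def scaleC_fun_def scaleC_sum_right
  by (simp add: fun_eq_iff scaleC_scaleC scaleC_complex_def mult_ac)

lemma op_term_scale_left: "op_term (c *\<^sub>C A) B = (\<lambda>\<pi>. c *\<^sub>C op_term A B \<pi>)"
  unfolding pairing_term_def mtrace_def scaleC_fun_def scaleC_sum_right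
  by (simp add: fun_eq_iff scaleC_scaleC mult_ac)

lemma Lambda_eqI: "B \<in> vecs (L1 G T) \<Longrightarrow> (op_term A B has_sum S) D \<Longrightarrow> \<Lambda> A B = S"
  unfolding Lambda_def extend_zero_def by (simp add: infsumI)

lemma Lambda_outside: "B \<notin> vecs (L1 G T) \<Longrightarrow> \<Lambda> A B = 0"
  by (simp add: Lambda_def extend_zero_def)

lemma Lambda_add: "A \<in> vecs Linf_E \<Longrightarrow> A' \<in> vecs Linf_E \<Longrightarrow> \<Lambda> (A + A') = \<Lambda> A + \<Lambda> A'"
proof
  fix B assume A: "A \<in> vecs Linf_E" "A' \<in> vecs Linf_E"
  show "\<Lambda> (A + A') B = (\<Lambda> A + \<Lambda> A') B"
  proof (cases "B \<in> vecs (L1 G T)")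
    case True
    then show ?thesis
      using has_sum_add[OF Lambda_has_sum[OF A(1) True] Lambda_has_sum[OF A(2) True]]
      by (intro Lambda_eqI) (simp_all add: op_term_add_left)
  qed (simp add: Lambda_outside)
qed

lemma Lambda_scale: "A \<in> vecs Linf_E \<Longrightarrow> \<Lambda> (c *\<^sub>C A) = c *\<^sub>C \<Lambda> A"
proof
  fix B assume A: "A \<in> vecs Linf_E"
  show "\<Lambda> (c *\<^sub>C A) B = (c *\<^sub>C \<Lambda> A) B"
  proof (cases "B \<in> vecs (L1 G T)")
    case True
    then show ?thesis
      using has_sum_bounded_linear[OF bounded_linear_scaleC_blinfun Lambda_has_sum[OF A True], of c]
      by (intro Lambda_eqI) (simp_all add: op_term_scale_left scaleC_fun_def[of c "\<Lambda> A"])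
  qed (simp add: Lambda_outside scaleC_fun_def[of c "\<Lambda> A"])
qed

lemma Lambda_linear:
  assumes A: "A \<in> vecs Linf_E"
  shows "complex_linear_between (L1 G T) (opspace E) (\<Lambda> A)"
  unfolding complex_linear_between_def
proof (intro conjI ballI allI)
  show "\<Lambda> A \<in> vecs (L1 G T) \<rightarrow> vecs (opspace E)"
    using Lambda_in_E[OF A] by simp
  fix B assume B: "B \<in> vecs (L1 G T)"
  show "\<Lambda> A (c *\<^sub>C B) = c *\<^sub>C \<Lambda> A B" for c
    using has_sum_bounded_linear[OF bounded_linear_scaleC_blinfun Lambda_has_sum[OF A B], of c]
    by (intro Lambda_eqI L1_scale B) (simp add: op_term_scale_right)
  fix B' assume B': "B' \<in> vecs (L1 G T)"
  show "\<Lambda> A (B + B') = \<Lambda> A B + \<Lambda> A B'"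
    using has_sum_add[OF Lambda_has_sum[OF A B] Lambda_has_sum[OF A B']]
    by (intro Lambda_eqI L1_add B B') (simp add: op_term_add_right)
qed

text \<open>The case \<open>m = 1\<close> of \<open>Lambda_form_bounded\<close>, with the singleton
  index removed.\<close>

lemma Lambda_completely_bounded:
  assumes A: "A \<in> vecs Linf_E"
  shows "completely_bounded (L1 G T) (opspace E) (\<Lambda> A)"
proof -
  note bl = blinfun.bounded_linear_right
  obtain C where C: "0 \<le> C" "\<And>\<pi>. \<pi> \<in> D \<Longrightarrow> form_bounded blinfun_apply {..<deg G \<pi>} (A \<pi>) C"
    using Linf_E_bound[OF A] by blast
  have "mnorm (opspace E) n (amplify n (\<Lambda> A) X) \<le> C * mnorm (L1 G T) n X"
    if n: "1 \<le> n" and X: "X \<in> matrices n (L1 G T)" for n X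
  proof -
    note Xv = matricesD[OF X]
    have b: "form_bounded blinfun_apply ({..<deg G \<pi>} \<times> {..<1::nat}) (\<lambda>a b. A \<pi> (fst a) (fst b)) C"
      if "\<pi> \<in> D" for \<pi>
    proof (rule form_bounded_reindex[OF C(2)[OF that] bl])
      show "bij_betw fst ({..<deg G \<pi>} \<times> {..<1::nat}) {..<deg G \<pi>}"
        by (intro bij_betwI[where g = "\<lambda>i. (i, 0)"]) auto
    qed auto
    have 1: "form_bounded blinfun_apply ({..<n} \<times> {..<1::nat}) (\<lambda>a b. \<Lambda> A (X (fst a) (fst b)))
        (mnorm (L1 G T) n X * C)"
      by (rule Lambda_form_bounded[where A = "\<lambda>_ _. A", OF A C(1) b n Xv]) auto
    have "form_bounded blinfun_apply {..<n} (\<lambda>i j. \<Lambda> A (X i j)) (mnorm (L1 G T) n X * C)"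
    proof (rule form_bounded_reindex[OF 1 bl])
      show "bij_betw (\<lambda>i. (i, 0)) {..<n} ({..<n} \<times> {..<1::nat})"
        by (intro bij_betwI[where g = fst]) auto
    qed auto
    moreover have "0 \<le> mnorm (L1 G T) n X * C"
      using L1_mnorm_nonneg[OF n Xv] C(1) by simp
    ultimately have "op_matrix_norm blinfun_apply n (\<lambda>i j. \<Lambda> A (X i j)) \<le> mnorm (L1 G T) n X * C"
      by (rule op_matrix_norm_le)
    then show ?thesis
      by (simp add: mult.commute op_matrix_norm_cong[of n "amplify n (\<Lambda> A) X" "\<lambda>i j. \<Lambda> A (X i j)"])
  qed
  then show ?thesis by (auto simp: completely_bounded_def)
qed

lemma Lambda_in_cb:
  assumes "A \<in> vecs Linf_E"
  shows "\<Lambda> A \<in> vecs (cb (L1 G T) (opspace E))"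
  using Lambda_linear[OF assms] Lambda_completely_bounded[OF assms]
  by (simp add: cb_def extend_zero_def fun_eq_iff Lambda_outside)

lemma Lambda_unit:
  assumes "\<pi> \<in> D" "k < deg G \<pi>" "l < deg G \<pi>"
  shows "\<Lambda> A (unit_family \<pi> k l) = A \<pi> k l"
proof (rule Lambda_eqI[OF unit_family_in_L1[OF assms]], rule has_sum_finite_neutralI[of "{\<pi>}"])
  have "mtrace (\<lambda>a b. b *\<^sub>C a) (deg G \<pi>) (A \<pi>) (unit_family \<pi> k l \<pi>)
      = (1 / of_nat (deg G \<pi>)) *\<^sub>C A \<pi> k l"
    unfolding mtrace_def using assms(2,3)
    by (subst sum_delta2[of k _ l]) (auto simp: unit_family_def)
  then show "A \<pi> k l = sum (op_term A (unit_family \<pi> k l)) {\<pi>}"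
    using deg_pos[OF assms(1)] by (simp add: pairing_term_def scaleC_scaleC scaleC_one)
qed (use assms in \<open>auto simp: unit_family_neq mtrace_def pairing_term_def\<close>)

text \<open>At \<open>unit_matrix\<close> the amplification reproduces a component of
  \<open>X\<close> in the very block layout by which the norm of bounded families is computed, so
  the lower bound holds class by class. The upper bound also supplies the finite bound that makes
  \<open>cb_norm\<close> meaningful.\<close>

lemma Lambda_isometric:
  assumes m: "1 \<le> m" and X: "X \<in> matrices m Linf_E"
  shows "mnorm (cb (L1 G T) (opspace E)) m (amplify m \<Lambda> X) = mnorm Linf_E m X"
proof -
  note bl = blinfun.bounded_linear_right
  note Xv = matricesD[OF X]
  let ?f = "\<lambda>B. mtrunc m (\<lambda>i j. amplify m \<Lambda> X i j B)"
  let ?M = "mnorm Linf_E m X"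
  have M: "0 \<le> ?M" by (rule Linf_E_mnorm_nonneg[OF m X])
  have amp: "mnorm (Mat m (opspace E)) n (amplify n ?f Y) = op_matrix_norm blinfun_apply (n * m)
      (\<lambda>r s. \<Lambda> (X (r mod m) (s mod m)) (Y (r div m) (s div m)))" for n Y
    unfolding mnorm_Mat mnorm_opspace
    by (rule op_matrix_norm_cong) (simp add: div_less_mult mod_less_mult)
  have up: "mnorm (Mat m (opspace E)) n (amplify n ?f Y) \<le> ?M"
    if n: "1 \<le> n" and Y: "Y \<in> matrices n (L1 G T)" "mnorm (L1 G T) n Y \<le> 1" for n Y
    unfolding amp
  proof (rule op_matrix_norm_le[OF _ M])
    have "form_bounded blinfun_apply ({..<n} \<times> {..<m})
        (\<lambda>a b. \<Lambda> (X (snd a) (snd b)) (Y (fst a) (fst b))) (mnorm (L1 G T) n Y * ?M)"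
      by (rule Lambda_form_bounded[OF Xv M Linf_E_form_bounded[OF m X] n matricesD[OF Y(1)]])
    then have "form_bounded blinfun_apply ({..<n} \<times> {..<m})
        (\<lambda>a b. \<Lambda> (X (snd a) (snd b)) (Y (fst a) (fst b))) ?M"
      by (rule form_bounded_mono) (use M Y(2) in \<open>simp add: mult_left_le_one_le L1_mnorm_nonneg[OF n matricesD[OF Y(1)]]\<close>)
    then show "form_bounded blinfun_apply {..<n * m}
        (\<lambda>r s. \<Lambda> (X (r mod m) (s mod m)) (Y (r div m) (s div m))) ?M"
      by (subst form_bounded_flatten[OF bl, where Z = "\<lambda>p q i j. \<Lambda> (X i j) (Y p q)"])
  qed
  have "cb_norm (L1 G T) (Mat m (opspace E)) ?f \<le> ?M"
  proof (rule cb_norm_least[OF _ _ up])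
    show "0 \<in> matrices 1 (L1 G T)"
      by (auto simp: matrices_def L1_zero mtrunc_def fun_eq_iff)
  qed (rule L1_zero_mnorm_le)
  moreover have "?M \<le> cb_norm (L1 G T) (Mat m (opspace E)) ?f"
  proof (rule Linf_E_mnorm_le[OF m X])
    have le: "op_matrix_norm blinfun_apply (deg G \<pi> * m)
        (\<lambda>r s. \<Lambda> (X (r mod m) (s mod m)) (unit_matrix \<pi> (r div m) (s div m)))
        \<le> cb_norm (L1 G T) (Mat m (opspace E)) ?f" if \<pi>: "\<pi> \<in> D" for \<pi>
      unfolding amp[symmetric]
      by (rule cb_norm_upper[OF up])
        (use deg_pos[OF \<pi>] unit_matrix_in_matrices[OF \<pi>] unit_matrix_mnorm_le[OF \<pi>] in auto)
    obtain \<pi> where "\<pi> \<in> D" using dual_nonempty by blast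
    from order_trans[OF op_matrix_norm_nonneg[OF bl] le[OF this]]
    show "0 \<le> cb_norm (L1 G T) (Mat m (opspace E)) ?f" .
    fix \<pi> assume \<pi>: "\<pi> \<in> D"
    have "form_bounded blinfun_apply {..<deg G \<pi> * m}
        (\<lambda>r s. \<Lambda> (X (r mod m) (s mod m)) (unit_matrix \<pi> (r div m) (s div m)))
        (cb_norm (L1 G T) (Mat m (opspace E)) ?f)"
      by (rule form_bounded_mono[OF form_bounded_op_matrix_norm[OF bl] le[OF \<pi>]])
    then have 1: "form_bounded blinfun_apply ({..<deg G \<pi>} \<times> {..<m})
        (\<lambda>a b. \<Lambda> (X (snd a) (snd b)) (unit_matrix \<pi> (fst a) (fst b)))
        (cb_norm (L1 G T) (Mat m (opspace E)) ?f)"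
      by (simp only: form_bounded_flatten[OF bl, where Z = "\<lambda>p q i j. \<Lambda> (X i j) (unit_matrix \<pi> p q)"])
    show "form_bounded blinfun_apply ({..<deg G \<pi>} \<times> {..<m})
        (\<lambda>a b. X (snd a) (snd b) \<pi> (fst a) (fst b)) (cb_norm (L1 G T) (Mat m (opspace E)) ?f)"
      by (rule form_bounded_cong[THEN iffD1, OF _ 1]) (auto simp: unit_matrix_def Lambda_unit[OF \<pi>])
  qed
  ultimately show ?thesis by (simp add: cb_def)
qed

section \<open>Bijectivity of Lambda\<close>

lemma Lambda_inj: "inj_on \<Lambda> (vecs Linf_E)"
proof (rule inj_onI)
  fix A A' assume A: "A \<in> vecs Linf_E" "A' \<in> vecs Linf_E" "\<Lambda> A = \<Lambda> A'"
  \<comment> \<open>A bounded family vanishes outside its index ranges, so its entries inside them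
    determine it.\<close>
  have fam: "C \<pi> = (if \<pi> \<in> D then mtrunc (deg G \<pi>) (C \<pi>) else 0)" if "C \<in> vecs Linf_E" for C \<pi>
  proof -
    have "extend_zero D C \<pi> = C \<pi>" "\<pi> \<in> D \<Longrightarrow> mtrunc (deg G \<pi>) (C \<pi>) = C \<pi>"
      using that by (simp_all add: Linf_def families_def matrices_def)
    then show ?thesis by (simp add: extend_zero_def split: if_splits)
  qed
  have "mtrunc (deg G \<pi>) (A \<pi>) = mtrunc (deg G \<pi>) (A' \<pi>)" if \<pi>: "\<pi> \<in> D" for \<pi>
    using Lambda_unit[OF \<pi>, of _ _ A] Lambda_unit[OF \<pi>, of _ _ A'] A(3)
    by (auto simp: mtrunc_def fun_eq_iff)
  then show "A = A'"
    using fam[OF A(1)] fam[OF A(2)] by (metis ext)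
qed

lemma linear_L1_sum:
  assumes u: "complex_linear_between (L1 G T) (opspace E) u"
    and f: "\<And>i. i \<in> I \<Longrightarrow> f i \<in> vecs (L1 G T)"
  shows "u (sum f I) = (\<Sum>i\<in>I. u (f i))"
proof -
  have "u (0 *\<^sub>C 0) = 0 *\<^sub>C u 0"
    using u L1_zero by (simp only: complex_linear_between_def)
  then have z: "u 0 = 0" by simp
  show ?thesis
    using f
    by (induction I rule: infinite_finite_induct)
      (use u in \<open>auto simp: z complex_linear_between_def L1_sum\<close>)
qed

text \<open>Complete boundedness enters through \<open>unit_matrix\<close>, whose size is the degree
  of the class: one constant bounds all components of \<open>A\<close>, however large the degrees.
  The convergence argument needs the estimate on 1 by 1 matrices.\<close>

lemma Lambda_surj:
  assumes u: "u \<in> vecs (cb (L1 G T) (opspace E))"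
  shows "\<exists>A\<in>vecs Linf_E. \<Lambda> A = u"
proof -
  note bl = blinfun.bounded_linear_right
  have lin: "complex_linear_between (L1 G T) (opspace E) u"
    and out: "\<And>B. B \<notin> vecs (L1 G T) \<Longrightarrow> u B = 0"
    and cb: "completely_bounded (L1 G T) (opspace E) u"
    using u by (auto simp: cb_def extend_zero_def fun_eq_iff split: if_splits)
  have in_E: "u B \<in> E" if "B \<in> vecs (L1 G T)" for B
    using lin that by (auto simp: complex_linear_between_def)
  from cb obtain K0 where K0: "\<And>n X. 1 \<le> n \<Longrightarrow> X \<in> matrices n (L1 G T) \<Longrightarrow>
      op_matrix_norm blinfun_apply n (amplify n u X) \<le> K0 * mnorm (L1 G T) n X"
    by (auto simp: completely_bounded_def)
  \<comment> \<open>\<open>completely_bounded\<close> leaves the sign of its constant open.\<close>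
  define K where "K = max K0 0"
  have K: "0 \<le> K" by (simp add: K_def)
  have bd: "op_matrix_norm blinfun_apply n (amplify n u X) \<le> K * mnorm (L1 G T) n X"
    if "1 \<le> n" "X \<in> matrices n (L1 G T)" for n X
  proof -
    have "K0 * mnorm (L1 G T) n X \<le> K * mnorm (L1 G T) n X"
      using L1_mnorm_nonneg[OF that(1) matricesD[OF that(2)]] by (intro mult_right_mono) (auto simp: K_def)
    then show ?thesis using K0[OF that] by linarith
  qed
  define A where "A = extend_zero D (\<lambda>\<pi>. mtrunc (deg G \<pi>) (\<lambda>k l. u (unit_family \<pi> k l)))"
  have A_eq: "A \<pi> k l = u (unit_family \<pi> k l)" if "\<pi> \<in> D" "k < deg G \<pi>" "l < deg G \<pi>" for \<pi> k l
    using that by (simp add: A_def extend_zero_def)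
  have "A \<in> families G T (opspace E)"
    using in_E unit_family_in_L1
    by (auto simp: families_def A_def extend_zero_def intro!: matricesI)
  moreover have "mnorm (opspace E) (deg G \<pi>) (A \<pi>) \<le> K" if \<pi>: "\<pi> \<in> D" for \<pi>
  proof -
    have "mnorm (opspace E) (deg G \<pi>) (A \<pi>)
        = op_matrix_norm blinfun_apply (deg G \<pi>) (amplify (deg G \<pi>) u (unit_matrix \<pi>))"
      unfolding mnorm_opspace by (rule op_matrix_norm_cong) (simp add: A_eq[OF \<pi>] unit_matrix_def)
    also have "\<dots> \<le> K * mnorm (L1 G T) (deg G \<pi>) (unit_matrix \<pi>)"
      using deg_pos[OF \<pi>] by (intro bd unit_matrix_in_matrices \<pi>) simp
    also have "\<dots> \<le> K" using unit_matrix_mnorm_le[OF \<pi>] K by (rule mult_left_le)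
    finally show ?thesis .
  qed
  ultimately have A: "A \<in> vecs Linf_E" by (auto simp: Linf_def intro!: bdd_aboveI[of _ K])
  \<comment> \<open>Boundedness on 1 by 1 matrices is restated in terms of \<open>L1sum\<close>,
    whose tails are explicit.\<close>
  have u_norm: "norm (u B) \<le> K * L1sum B" if B: "B \<in> vecs (L1 G T)" for B
  proof -
    have m: "mtrunc 1 (\<lambda>_ _. B) \<in> matrices 1 (L1 G T)" using B by (intro matricesI)
    have "op_matrix_norm blinfun_apply 1 (amplify 1 u (mtrunc 1 (\<lambda>_ _. B))) \<le> K * L1sum B"
      using bd[OF order_refl m] mult_left_mono[OF L1_single_mnorm_le[OF B] K] by linarith
    then have "form_bounded blinfun_apply {..<1} (amplify 1 u (mtrunc 1 (\<lambda>_ _. B))) (K * L1sum B)"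
      by (rule form_bounded_mono[OF form_bounded_op_matrix_norm[OF bl]])
    from form_bounded_norm_le[OF this bl, of 0 0]
    show ?thesis using K by (intro norm_blinfun_bound) (auto simp: L1sum_nonneg)
  qed
  have "\<Lambda> A B = u B" if B: "B \<in> vecs (L1 G T)" for B
  proof (rule Lambda_eqI[OF B])
    \<comment> \<open>The part of \<open>B\<close> at one class is a combination of matrix units, so
      linearity suffices.\<close>
    have single: "u (restrict_family {\<pi>} B) = op_term A B \<pi>" if \<pi>: "\<pi> \<in> D" for \<pi>
    proof -
      let ?d = "deg G \<pi>"
      have U: "unit_family \<pi> k l \<in> vecs (L1 G T)" if "k < ?d" "l < ?d" for k l
        using \<pi> that by (rule unit_family_in_L1)
      have "u (restrict_family {\<pi>} B) = (\<Sum>k<?d. \<Sum>l<?d. u ((of_nat ?d * B \<pi> l k) *\<^sub>C unit_family \<pi> k l))"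
        unfolding restrict_family_single[OF B \<pi>]
        by (subst linear_L1_sum[OF lin], (auto intro!: L1_sum L1_scale U)[1],
            intro sum.cong refl, subst linear_L1_sum[OF lin]) (auto intro!: L1_scale U)
      also have "\<dots> = (\<Sum>k<?d. \<Sum>l<?d. (of_nat ?d * B \<pi> l k) *\<^sub>C A \<pi> k l)"
        using lin U by (intro sum.cong refl) (simp add: complex_linear_between_def A_eq[OF \<pi>])
      also have "\<dots> = op_term A B \<pi>"
        by (simp add: pairing_term_def mtrace_def scaleC_sum_right scaleC_scaleC)
      finally show ?thesis .
    qed
    have fin: "u (restrict_family F B) = sum (op_term A B) F" if F: "finite F" "F \<subseteq> D" for F
    proof -
      have "restrict_family F B = (\<Sum>\<pi>\<in>F. restrict_family {\<pi>} B)"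
        using F(1)
      proof induction
        case (insert \<pi> F)
        have "restrict_family (insert \<pi> F) B = restrict_family {\<pi>} B + restrict_family F B"
          using insert.hyps by (auto simp: restrict_family_def fun_eq_iff)
        then show ?case using insert by simp
      qed (simp add: restrict_family_def fun_eq_iff)
      then have "u (restrict_family F B) = (\<Sum>\<pi>\<in>F. u (restrict_family {\<pi>} B))"
        by (simp add: linear_L1_sum[OF lin] restrict_family_in_L1[OF B])
      also have "\<dots> = sum (op_term A B) F" using single F by (intro sum.cong) auto
      finally show ?thesis .
    qed
    let ?w = "\<lambda>\<sigma>. real (deg G \<sigma>) * schatten1_norm (deg G \<sigma>) (B \<sigma>)"
    \<comment> \<open>The error of the partial sum over \<open>F\<close> is the value of
      \<open>u\<close> at the part of \<open>B\<close> outside \<open>F\<close>.\<close>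
    have est: "norm (sum (op_term A B) F - u B) \<le> K * (L1sum B - sum ?w F)"
      if F: "finite F" "F \<subseteq> D" for F
    proof -
      have "B = restrict_family F B + restrict_family (- F) B"
        by (auto simp: restrict_family_def fun_eq_iff)
      then have "u B = u (restrict_family F B) + u (restrict_family (- F) B)"
        using lin restrict_family_in_L1[OF B] unfolding complex_linear_between_def by metis
      then have "norm (sum (op_term A B) F - u B) = norm (u (restrict_family (- F) B))"
        by (simp add: fin[OF F])
      also have "\<dots> \<le> K * L1sum (restrict_family (- F) B)"
        by (rule u_norm[OF restrict_family_in_L1[OF B]])
      finally show ?thesis by (simp only: L1sum_restrict_compl[OF B F])
    qed
    have "(sum ?w \<longlongrightarrow> L1sum B) (finite_subsets_at_top D)"
      unfolding L1sum_def using B by (intro infsum_tendsto) (simp add: L1_iff)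
    then have "((\<lambda>F. K * (L1sum B - sum ?w F)) \<longlongrightarrow> K * (L1sum B - L1sum B)) (finite_subsets_at_top D)"
      by (intro tendsto_intros)
    then have "((\<lambda>F. K * (L1sum B - sum ?w F)) \<longlongrightarrow> 0) (finite_subsets_at_top D)"
      by (simp only: diff_self mult_zero_right)
    moreover have "\<forall>\<^sub>F F in finite_subsets_at_top D.
        norm (sum (op_term A B) F - u B) \<le> K * (L1sum B - sum ?w F)"
      by (rule eventually_finite_subsets_at_top_weakI) (rule est)
    ultimately have "((\<lambda>F. sum (op_term A B) F - u B) \<longlongrightarrow> 0) (finite_subsets_at_top D)"
      by (rule Lim_null_comparison[rotated])
    then show "(op_term A B has_sum u B) D"
      by (simp add: has_sum_def LIM_zero_iff)
  qed
  \<comment> \<open>Both maps vanish outside L1, so agreement on L1 is equality of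
    functions.\<close>
  then have "\<Lambda> A = u" using out Lambda_outside by (intro HOL.ext) metis
  then show ?thesis using A by blast
qed

lemma Lambda_complete_isometric_isomorphism:
  "complete_isometric_isomorphism Linf_E (cb (L1 G T) (opspace E)) \<Lambda>"
  unfolding complete_isometric_isomorphism_def
proof (intro conjI allI impI ballI)
  show "complex_linear_between Linf_E (cb (L1 G T) (opspace E)) \<Lambda>"
    unfolding complex_linear_between_def using Lambda_in_cb Lambda_add Lambda_scale by auto
  show "bij_betw \<Lambda> (vecs Linf_E) (vecs (cb (L1 G T) (opspace E)))"
    unfolding bij_betw_def using Lambda_inj Lambda_in_cb Lambda_surj by auto
qed (rule Lambda_isometric)

end

end

section \<open>The dual object\<close>

lemma irrepD:
  assumes "\<rho> \<in> irreps G T" "group G"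
  shows "\<And>x. x \<in> carrier G \<Longrightarrow> \<rho> x \<in> carrier_mat (rep_degree G \<rho>) (rep_degree G \<rho>)"
    and "0 < rep_degree G \<rho>"
proof -
  obtain d where d: "unitary_rep G T d \<rho>" "irreducible_rep G d \<rho>"
    using assms by (auto simp: irreps_def)
  have "\<one>\<^bsub>G\<^esub> \<in> carrier G" using assms(2) by (simp add: group.is_monoid monoid.one_closed)
  then have "rep_degree G \<rho> = d"
    using d(1) by (auto simp: unitary_rep_def unitary_matrix_def rep_degree_def)
  then show "\<And>x. x \<in> carrier G \<Longrightarrow> \<rho> x \<in> carrier_mat (rep_degree G \<rho>) (rep_degree G \<rho>)"
    "0 < rep_degree G \<rho>"
    using d by (auto simp: unitary_rep_def unitary_matrix_def irreducible_rep_def)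
qed

lemma unitary_matrix_one: "unitary_matrix d (1\<^sub>m d)"
  unfolding unitary_matrix_def
  by (auto intro!: eq_matI simp: mat_adjoint_def mat_of_rows_def conjugate_vec_def)

text \<open>Makes every class nonempty, so that the representative chosen in \<open>deg\<close> is
  an irreducible representation.\<close>

lemma rep_equiv_refl:
  assumes "\<rho> \<in> irreps G T" "group G"
  shows "(\<rho>, \<rho>) \<in> rep_equiv G T"
proof -
  have "1\<^sub>m (rep_degree G \<rho>) * \<rho> x = \<rho> x * 1\<^sub>m (rep_degree G \<rho>)" if "x \<in> carrier G" for x
    using irrepD(1)[OF assms that] by simp
  then show ?thesis
    using assms(1) unitary_matrix_one by (auto simp: rep_equiv_def)
qed

text \<open>A nonzero vector spans a one-dimensional space, so a nonzero subspace is everything.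
  This representation shows that the dual object is nonempty.\<close>

lemma trivial_rep_irrep:
  "(\<lambda>_. 1\<^sub>m 1) \<in> irreps (G :: ('g, 'm) monoid_scheme) T"
proof -
  have "unitary_rep G T 1 (\<lambda>_. 1\<^sub>m 1)"
    unfolding unitary_rep_def using unitary_matrix_one by auto
  moreover have "irreducible_rep G 1 (\<lambda>_. 1\<^sub>m 1)"
    unfolding irreducible_rep_def
  proof (intro conjI allI impI)
    fix W :: "complex vec set"
    assume W: "W \<subseteq> carrier_vec 1"
      "0\<^sub>v 1 \<in> W \<and> (\<forall>v\<in>W. \<forall>w\<in>W. v + w \<in> W) \<and> (\<forall>c. \<forall>w\<in>W. c \<cdot>\<^sub>v w \<in> W) \<and>
        (\<forall>x\<in>carrier G. \<forall>w\<in>W. 1\<^sub>m 1 *\<^sub>v w \<in> W)"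
    show "W = {0\<^sub>v 1} \<or> W = carrier_vec 1"
    proof (rule disjCI)
      assume "W \<noteq> carrier_vec 1"
      then obtain z where z: "z \<in> carrier_vec 1" "z \<notin> W" using W(1) by blast
      have "w = 0\<^sub>v 1" if w: "w \<in> W" for w
      proof (rule ccontr)
        assume "w \<noteq> 0\<^sub>v 1"
        then have nz: "w $ 0 \<noteq> 0" using w W(1) by (auto simp: vec_eq_iff)
        have "z = (z $ 0 / w $ 0) \<cdot>\<^sub>v w"
          using w W(1) z(1) nz by (auto simp: vec_eq_iff)
        then show False using z(2) W(2) w by metis
      qed
      then show "W = {0\<^sub>v 1}" using W(2) by auto
    qed
  qed simp
  ultimately show ?thesis by (auto simp: irreps_def)
qed

lemma nonempty_dual_group:
  assumes "group G"
  shows "nonempty_dual G T"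
proof
  show "dual_object G T \<noteq> {}"
    unfolding dual_object_def using trivial_rep_irrep[of G T] by (auto simp: quotient_def)
  fix \<pi> assume "\<pi> \<in> dual_object G T"
  then obtain \<rho> where \<rho>: "\<rho> \<in> irreps G T" "\<pi> = rep_equiv G T `` {\<rho>}"
    by (auto simp: dual_object_def quotient_def)
  then have "\<rho> \<in> \<pi>" using rep_equiv_refl[OF _ assms] by auto
  then have "(SOME \<sigma>. \<sigma> \<in> \<pi>) \<in> \<pi>" by (rule someI[where P = "\<lambda>\<sigma>. \<sigma> \<in> \<pi>"])
  then have "(SOME \<sigma>. \<sigma> \<in> \<pi>) \<in> irreps G T" using \<rho>(2) by (auto simp: rep_equiv_def)
  then show "0 < deg G \<pi>" unfolding deg_def by (rule irrepD(2)[OF _ assms])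
qed

text \<open>An infinite sum over a family that is not summable is 0 by convention, so the
  convergence of the series defining Lambda is asserted separately.\<close>

theorem proposition2p4:
  fixes G :: "('g, 'm) monoid_scheme" and T :: "'g topology"
    and E :: "('h :: complex_hilbert \<Rightarrow>\<^sub>L 'h) set"
  assumes "compact_hausdorff_group G T" and "operator_space E"
  shows "(\<forall>A\<in>vecs (Linf G T (opspace E)). \<forall>B\<in>vecs (L1 G T).
            pairing_term G (\<lambda>a b. b *\<^sub>C a) A B summable_on dual_object G T) \<and>
         complete_isometric_isomorphism (Linf G T (opspace E)) (cb (L1 G T) (opspace E))
           (Lambda G T)"
proof -
  interpret nonempty_dual G T
    using assms(1) by (intro nonempty_dual_group) (simp add: compact_hausdorff_group_def)
  show ?thesis
    using op_term_summable[OF assms(2)] Lambda_complete_isometric_isomorphism[OF assms(2)] by blast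
qed

end
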